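(* Let $G$ be a locally compact group, $H$ a compact subgroup of $G$, $1\le p<\infty$, and let $\xi:H\to\mathbb{T}$ be a character of $H$. Then the Banach space $L^p_\xi(G,H)$ is isometrically isomorphic to the quotient Banach space $L^p(G)/\mathcal{N}^p_\xi(G,H)$.
   Context: $\lambda_G$ is a fixed left Haar measure on $G$, $L^p(G)=L^p(G,\lambda_G)$ (complex valued), and $\lambda_H$ is the probability Haar measure on the compact group $H$. $\mathbb{T}=\{z\in\mathbb{C}:|z|=1\}$; a character of $H$ is a continuous group homomorphism $H\to\mathbb{T}$. $\mathrm{q}:G\to G/H$, $\mathrm{q}(x)=xH$, is the canonical map, and $\mathcal{C}(G)$ (resp. $\mathcal{C}_c(G)$) is the space of continuous complex functions on $G$ (resp. those with compact support). $\mathcal{C}_c(G|H):=\{\psi\in\mathcal{C}(G): \mathrm{q}(\mathrm{supp}(\psi))\text{ is compact in }G/H\}$, and $M_\xi(G,H):=\{\psi\in\mathcal{C}_c(G|H): \psi(xh)=\xi(h)\psi(x)\text{ for all }x\in G,\ h\in H\}$. (Since $H$ is compact, $M_\xi(G,H)\subseteq\mathcal{C}_c(G)$.) $L^p_\xi(G,H)$ is the Banach completion of $M_\xi(G,H)$ with respect to $\|\cdot\|_{L^p(G)}$, viewed as a closed subspace of $L^p(G)$ (the closure of $M_\xi(G,H)$ in $L^p(G)$). For $f\in\mathcal{C}_c(G)$ put $T_\xi(f)(x):=\int_H f(xs)\overline{\xi(s)}\,\mathrm{d}\lambda_H(s)$, $x\in G$. This maps $\mathcal{C}_c(G)$ onto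 $M_\xi(G,H)$ and is bounded for $\|\cdot\|_{L^p(G)}$; its unique bounded linear extension $L^p(G)\to L^p_\xi(G,H)$ is still denoted $T_\xi$ (and is given by the same integral formula). $\mathcal{N}^p_\xi(G,H):=\{f\in L^p(G): T_\xi(f)=0\text{ in }L^p_\xi(G,H)\}$. The quotient carries the usual quotient norm. *)

theory Defs
  imports "HOL-Probability.Probability" "HOL-Algebra.Module" "HOL-Algebra.AbelCoset"
    "HOL-Algebra.Algebraic_Closure_Type"
begin

section \<open>Complex normed spaces with explicit carrier\<close>

text \<open>
  The scalar field is the complex field, in the shape of a ring record
  (\<^const>\<open>ring_of_type_algebra\<close>). The fields \<^const>\<open>monoid.mult\<close> and \<^const>\<open>monoid.one\<close>, which a
  module record inherits from rings, play no role in a vector space and are left \<^const>\<open>undefined\<close>.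
\<close>

record 'a nspace = "(complex, 'a) module" +
  nrm :: "'a \<Rightarrow> real"

definition normed_space :: "('a, 'm) nspace_scheme \<Rightarrow> bool" where
  "normed_space V \<longleftrightarrow>
     Module.module (ring_of_type_algebra :: complex ring) V \<and>
     (\<forall>x\<in>carrier V. 0 \<le> nrm V x) \<and>
     (\<forall>x\<in>carrier V. nrm V x = 0 \<longleftrightarrow> x = \<zero>\<^bsub>V\<^esub>) \<and>
     (\<forall>c. \<forall>x\<in>carrier V. nrm V (c \<odot>\<^bsub>V\<^esub> x) = cmod c * nrm V x) \<and>
     (\<forall>x\<in>carrier V. \<forall>y\<in>carrier V. nrm V (x \<oplus>\<^bsub>V\<^esub> y) \<le> nrm V x + nrm V y)"

definition banach_space :: "('a, 'm) nspace_scheme \<Rightarrow> bool" where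
  "banach_space V \<longleftrightarrow> normed_space V \<and>
     (\<forall>s. (\<forall>n::nat. s n \<in> carrier V) \<and>
          (\<forall>e>0. \<exists>N. \<forall>m\<ge>N. \<forall>n\<ge>N. nrm V (s m \<ominus>\<^bsub>V\<^esub> s n) < e) \<longrightarrow>
          (\<exists>l\<in>carrier V. (\<lambda>n. nrm V (s n \<ominus>\<^bsub>V\<^esub> l)) \<longlonglongrightarrow> 0))"

definition linear_map :: "('a, 'm) nspace_scheme \<Rightarrow> ('b, 'n) nspace_scheme \<Rightarrow> ('a \<Rightarrow> 'b) \<Rightarrow> bool" where
  "linear_map V W T \<longleftrightarrow>
     T \<in> carrier V \<rightarrow> carrier W \<and>
     (\<forall>x\<in>carrier V. \<forall>y\<in>carrier V. T (x \<oplus>\<^bsub>V\<^esub> y) = T x \<oplus>\<^bsub>W\<^esub> T y) \<and>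
     (\<forall>c. \<forall>x\<in>carrier V. T (c \<odot>\<^bsub>V\<^esub> x) = c \<odot>\<^bsub>W\<^esub> T x)"

definition bounded_linear_map :: "('a, 'm) nspace_scheme \<Rightarrow> ('b, 'n) nspace_scheme \<Rightarrow> ('a \<Rightarrow> 'b) \<Rightarrow> bool" where
  "bounded_linear_map V W T \<longleftrightarrow>
     linear_map V W T \<and> (\<exists>B. \<forall>x\<in>carrier V. nrm W (T x) \<le> B * nrm V x)"

definition isometrically_isomorphic :: "('a, 'm) nspace_scheme \<Rightarrow> ('b, 'n) nspace_scheme \<Rightarrow> bool" where
  "isometrically_isomorphic V W \<longleftrightarrow>
     (\<exists>\<Phi>. linear_map V W \<Phi> \<and> bij_betw \<Phi> (carrier V) (carrier W) \<and>
          (\<forall>x\<in>carrier V. nrm W (\<Phi> x) = nrm V x))"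

definition norm_closure :: "('a, 'm) nspace_scheme \<Rightarrow> 'a set \<Rightarrow> 'a set" where
  "norm_closure V S = {x \<in> carrier V. \<forall>e>0. \<exists>y\<in>S. nrm V (x \<ominus>\<^bsub>V\<^esub> y) < e}"

text \<open>
  The quotient by a subspace \<open>N\<close>: the elements are the cosets of \<open>N\<close>, with the quotient norm.
  In the scalar multiplication, adding \<open>N\<close> makes \<open>0 \<odot> A\<close> the coset \<open>N\<close> instead of \<open>{0}\<close>.
\<close>

definition quotient_space :: "'a nspace \<Rightarrow> 'a set \<Rightarrow> 'a set nspace" where
  "quotient_space V N =
     \<lparr> carrier = a_rcosets\<^bsub>V\<^esub> N,
       monoid.mult = undefined,
       monoid.one = undefined,
       ring.zero = N,
       add = (\<lambda>A B. A <+>\<^bsub>V\<^esub> B),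
       smult = (\<lambda>c A. N <+>\<^bsub>V\<^esub> ((\<lambda>x. c \<odot>\<^bsub>V\<^esub> x) ` A)),
       nrm = (\<lambda>A. INF x\<in>A. nrm V x) \<rparr>"

section \<open>\<open>L\<^sup>p\<close> spaces\<close>

definition Lp_functions :: "'a measure \<Rightarrow> real \<Rightarrow> ('a \<Rightarrow> complex) nspace" where
  "Lp_functions M p =
     \<lparr> carrier = {f \<in> borel_measurable M. integrable M (\<lambda>x. cmod (f x) powr p)},
       monoid.mult = undefined,
       monoid.one = undefined,
       ring.zero = (\<lambda>x. 0),
       add = (\<lambda>f g x. f x + g x),
       smult = (\<lambda>c f x. c * f x),
       nrm = (\<lambda>f. (\<integral>x. cmod (f x) powr p \<partial>M) powr (1 / p)) \<rparr>"

definition Lp_null :: "'a measure \<Rightarrow> real \<Rightarrow> ('a \<Rightarrow> complex) set" where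
  "Lp_null M p = {f \<in> carrier (Lp_functions M p). AE x in M. f x = 0}"

definition Lp_space :: "'a measure \<Rightarrow> real \<Rightarrow> ('a \<Rightarrow> complex) set nspace" where
  "Lp_space M p = quotient_space (Lp_functions M p) (Lp_null M p)"

definition Lp_class :: "'a measure \<Rightarrow> real \<Rightarrow> ('a \<Rightarrow> complex) \<Rightarrow> ('a \<Rightarrow> complex) set" where
  "Lp_class M p f = Lp_null M p +>\<^bsub>Lp_functions M p\<^esub> f"

lemma Lp_functions_carrier_AE_cong:
  assumes f: "f \<in> carrier (Lp_functions M p)" and g: "g \<in> borel_measurable M"
    and ae: "AE x in M. g x = f x"
  shows "g \<in> carrier (Lp_functions M p)"
proof -
  have fm: "f \<in> borel_measurable M" "integrable M (\<lambda>x. cmod (f x) powr p)"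
    using f by (auto simp: Lp_functions_def)
  have "integrable M (\<lambda>x. cmod (g x) powr p) = integrable M (\<lambda>x. cmod (f x) powr p)"
  proof (rule integrable_cong_AE)
    show "(\<lambda>x. cmod (g x) powr p) \<in> borel_measurable M" "(\<lambda>x. cmod (f x) powr p) \<in> borel_measurable M"
      using fm g by measurable
    show "AE x in M. cmod (g x) powr p = cmod (f x) powr p"
      using ae by eventually_elim simp
  qed
  then show ?thesis using fm g by (simp add: Lp_functions_def)
qed

text \<open>The elements of \<^const>\<open>Lp_space\<close> are the usual classes of functions modulo equality
  almost everywhere.\<close>

lemma Lp_class_eq:
  assumes "f \<in> carrier (Lp_functions M p)"
  shows "Lp_class M p f = {g \<in> carrier (Lp_functions M p). AE x in M. g x = f x}"
proof (intro Set.set_eqI iffI)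
  fix g assume "g \<in> Lp_class M p f"
  then obtain n where n: "n \<in> Lp_null M p" "g = (\<lambda>x. n x + f x)"
    by (auto simp: Lp_class_def a_r_coset_def r_coset_def Lp_functions_def)
  have m: "n \<in> borel_measurable M" "f \<in> borel_measurable M" "AE x in M. n x = 0"
    using n assms by (auto simp: Lp_null_def Lp_functions_def)
  then have "AE x in M. g x = f x" "g \<in> borel_measurable M"
    using n(2) by auto
  then show "g \<in> {g \<in> carrier (Lp_functions M p). AE x in M. g x = f x}"
    using Lp_functions_carrier_AE_cong[OF assms] by auto
next
  fix g assume g: "g \<in> {g \<in> carrier (Lp_functions M p). AE x in M. g x = f x}"
  have m: "g \<in> borel_measurable M" "f \<in> borel_measurable M"
    using g assms by (auto simp: Lp_functions_def)
  have z: "(\<lambda>x. 0) \<in> carrier (Lp_functions M p)"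
    by (simp add: Lp_functions_def)
  have ae: "AE x in M. g x - f x = 0" using g by auto
  have "(\<lambda>x. g x - f x) \<in> carrier (Lp_functions M p)"
    by (rule Lp_functions_carrier_AE_cong[OF z]) (use m ae in auto)
  then have "(\<lambda>x. g x - f x) \<in> Lp_null M p" using ae by (simp add: Lp_null_def)
  moreover have "g = (\<lambda>x. (g x - f x) + f x)" by auto
  ultimately show "g \<in> Lp_class M p f"
    unfolding Lp_class_def a_r_coset_def r_coset_def
    by (auto simp: Lp_functions_def intro!: bexI[of _ "\<lambda>x. g x - f x"])
qed

section \<open>Topological groups, Haar measures and characters\<close>

text \<open>
  Groups are written additively, since \<^class>\<open>topological_group_add\<close> is the library's class of
  topological groups; its addition is not assumed commutative, and \<open>x + h\<close> stands for
  the product \<open>xh\<close>, \<open>-x\<close> for the inverse of \<open>x\<close>.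
\<close>

definition is_subgroup :: "'g::group_add set \<Rightarrow> bool" where
  "is_subgroup H \<longleftrightarrow> 0 \<in> H \<and> (\<forall>x\<in>H. \<forall>y\<in>H. x + y \<in> H) \<and> (\<forall>x\<in>H. - x \<in> H)"

text \<open>
  Left Haar measures on a closed subgroup \<open>S\<close> (with its subspace topology; \<open>S = UNIV\<close> for the
  whole group): nonzero left-invariant Radon measures. The group need not be second countable,
  so regularity has to be part of the definition.
\<close>

definition radon_measure_on :: "'g::topological_space set \<Rightarrow> 'g measure \<Rightarrow> bool" where
  "radon_measure_on S \<mu> \<longleftrightarrow>
     space \<mu> = S \<and> sets \<mu> = sets (restrict_space borel S) \<and>
     (\<forall>K. compact K \<and> K \<subseteq> S \<longrightarrow> emeasure \<mu> K < \<infinity>) \<and>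
     (\<forall>A\<in>sets \<mu>. emeasure \<mu> A = (INF U\<in>{U. openin (top_of_set S) U \<and> A \<subseteq> U}. emeasure \<mu> U)) \<and>
     (\<forall>U. openin (top_of_set S) U \<longrightarrow>
        emeasure \<mu> U = (SUP K\<in>{K. compact K \<and> K \<subseteq> U}. emeasure \<mu> K))"

definition left_haar_measure_on :: "'g::topological_group_add set \<Rightarrow> 'g measure \<Rightarrow> bool" where
  "left_haar_measure_on S \<mu> \<longleftrightarrow>
     radon_measure_on S \<mu> \<and> emeasure \<mu> S \<noteq> 0 \<and>
     (\<forall>x\<in>S. \<forall>A\<in>sets \<mu>. emeasure \<mu> ((+) x ` A) = emeasure \<mu> A)"

text \<open>A character is given by a function on the whole group of which only the values on \<open>H\<close>
  matter.\<close>

definition character_on :: "'g::topological_group_add set \<Rightarrow> ('g \<Rightarrow> complex) \<Rightarrow> bool" where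
  "character_on H \<xi> \<longleftrightarrow>
     continuous_on H \<xi> \<and> (\<forall>h\<in>H. cmod (\<xi> h) = 1) \<and>
     (\<forall>h\<in>H. \<forall>k\<in>H. \<xi> (h + k) = \<xi> h * \<xi> k)"

definition left_coset :: "'g::group_add set \<Rightarrow> 'g \<Rightarrow> 'g set" where
  "left_coset H x = (\<lambda>h. x + h) ` H"

definition coset_topology :: "'g::topological_group_add set \<Rightarrow> 'g set topology" where
  "coset_topology H =
     topology (\<lambda>V. V \<subseteq> range (left_coset H) \<and> open (left_coset H -` V))"

lemma openin_coset_topology:
  "openin (coset_topology H) V \<longleftrightarrow> V \<subseteq> range (left_coset H) \<and> open (left_coset H -` V)"
proof -
  have "istopology (\<lambda>V. V \<subseteq> range (left_coset H) \<and> open (left_coset H -` V))"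
    by (auto simp: istopology_def vimage_Union)
  then show ?thesis by (simp add: coset_topology_def topology_inverse')
qed

section \<open>Covariant functions of a character\<close>

definition supp :: "('g::topological_space \<Rightarrow> complex) \<Rightarrow> 'g set" where
  "supp f = closure {x. f x \<noteq> 0}"

definition Cc :: "('g::topological_space \<Rightarrow> complex) set" where
  "Cc = {f. continuous_on UNIV f \<and> compact (supp f)}"

definition Cc_rel :: "'g::topological_group_add set \<Rightarrow> ('g \<Rightarrow> complex) set" where
  "Cc_rel H = {\<psi>. continuous_on UNIV \<psi> \<and> compactin (coset_topology H) (left_coset H ` supp \<psi>)}"

definition M_cov :: "'g::topological_group_add set \<Rightarrow> ('g \<Rightarrow> complex) \<Rightarrow> ('g \<Rightarrow> complex) set" where
  "M_cov H \<xi> = {\<psi> \<in> Cc_rel H. \<forall>x. \<forall>h\<in>H. \<psi> (x + h) = \<xi> h * \<psi> x}"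

definition Lp_cov ::
  "'g::topological_group_add measure \<Rightarrow> real \<Rightarrow> 'g set \<Rightarrow> ('g \<Rightarrow> complex) \<Rightarrow> ('g \<Rightarrow> complex) set nspace" where
  "Lp_cov \<mu>G p H \<xi> =
     (Lp_space \<mu>G p)\<lparr>carrier := norm_closure (Lp_space \<mu>G p) (Lp_class \<mu>G p ` M_cov H \<xi>)\<rparr>"

definition T_fun :: "'g::topological_group_add measure \<Rightarrow> ('g \<Rightarrow> complex) \<Rightarrow> ('g \<Rightarrow> complex) \<Rightarrow> 'g \<Rightarrow> complex" where
  "T_fun \<mu>H \<xi> f = (\<lambda>x. \<integral>s. f (x + s) * cnj (\<xi> s) \<partial>\<mu>H)"

text \<open>The unique bounded linear extension of \<^const>\<open>T_fun\<close> to \<open>L\<^sup>p\<close>; extensionality off the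
  carrier makes it unique as a total function.\<close>

definition T_ext ::
  "'g::topological_group_add measure \<Rightarrow> real \<Rightarrow> 'g set \<Rightarrow> 'g measure \<Rightarrow> ('g \<Rightarrow> complex)
     \<Rightarrow> ('g \<Rightarrow> complex) set \<Rightarrow> ('g \<Rightarrow> complex) set" where
  "T_ext \<mu>G p H \<mu>H \<xi> =
     (THE T. T \<in> extensional (carrier (Lp_space \<mu>G p)) \<and>
             bounded_linear_map (Lp_space \<mu>G p) (Lp_cov \<mu>G p H \<xi>) T \<and>
             (\<forall>f\<in>Cc. T (Lp_class \<mu>G p f) = Lp_class \<mu>G p (T_fun \<mu>H \<xi> f)))"

definition N_cov ::
  "'g::topological_group_add measure \<Rightarrow> real \<Rightarrow> 'g set \<Rightarrow> 'g measure \<Rightarrow> ('g \<Rightarrow> complex)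
     \<Rightarrow> ('g \<Rightarrow> complex) set set" where
  "N_cov \<mu>G p H \<mu>H \<xi> =
     {F \<in> carrier (Lp_space \<mu>G p). T_ext \<mu>G p H \<mu>H \<xi> F = \<zero>\<^bsub>Lp_cov \<mu>G p H \<xi>\<^esub>}"

end

theory Submission
  imports Defs
begin

text \<open>
  The averaging operator \<open>T\<close> is a contractive projection of \<open>L\<^sup>p(G)\<close> onto the covariant functions, and a
  contractive projection \<open>P\<close> of a Banach space \<open>V\<close> onto a closed subspace \<open>W\<close> with kernel \<open>N\<close> identifies
  \<open>W\<close> isometrically with \<open>V/N\<close>: if \<open>w \<in> W\<close> and \<open>n \<in> N\<close>, then \<open>\<parallel>w\<parallel> = \<parallel>P(w + n)\<parallel> \<le> \<parallel>w + n\<parallel>\<close>.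

  Contractivity of \<open>T\<close> on functions of compact support follows from Minkowski's inequality, because \<open>T f\<close> is
  a uniform limit of convex combinations of right translates of \<open>f\<close> by \<open>H\<close>, up to unimodular factors. That
  these translates have the same norm means that the modular function is trivial on \<open>H\<close>. This is
  proved without uniqueness of Haar measure: \<open>f\<close> is a uniform limit of linear combinations of left
  translates of small bump functions \<open>\<phi>\<close> that are invariant under conjugation by \<open>H\<close>, and for these
  \<open>\<phi>(xh) = \<phi>(hx)\<close>. Riemann sums take the place of Fubini's theorem throughout.
\<close>

section \<open>Complex vector spaces with explicit carrier\<close>

text \<open>The crux is right translation by \<open>H\<close>: \<open>G\<close> need not be
  unimodular, so right translates may rescale a left Haar measure. The textbook reason that elements
  of \<open>H\<close> do not is that the modular function maps the compact group \<open>H\<close>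
  onto a compact subgroup of the positive reals, which is trivial; but that function is available
  only through uniqueness of Haar measure.

  Fubini's theorem is delicate because \<open>G\<close> need not be second countable: Borel sets of
  a product may lie outside the product sigma-algebra, and the measure need not be sigma-finite. All
  integrands to be exchanged are continuous with compact support, so a finite sum that approximates
  an integral uniformly in the remaining parameter does the same work.

  Since \<open>T_ext\<close> is a definite description, \<open>N_cov\<close> carries no information
  until the extension of \<open>T_fun\<close> is known to exist and to be unique. Regularity of the
  measure enters here, through density of \<open>Cc\<close> in \<open>L\<^sup>p\<close>.\<close>

locale complex_module = module "ring_of_type_algebra :: complex ring" V for V (structure)
begin

lemma scalar_closed [simp, intro]: "x \<in> carrier V \<Longrightarrow> c \<odot> x \<in> carrier V"
  using smult_closed[of c x] by (simp add: ring_of_type_algebra_def)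

lemma scalar_add_left: "x \<in> carrier V \<Longrightarrow> (a + b) \<odot> x = a \<odot> x \<oplus> b \<odot> x"
  using smult_l_distr[of a b x] by (simp add: ring_of_type_algebra_def)

lemma scalar_add_right:
  "x \<in> carrier V \<Longrightarrow> y \<in> carrier V \<Longrightarrow> c \<odot> (x \<oplus> y) = c \<odot> x \<oplus> c \<odot> y"
  using smult_r_distr[of c x y] by (simp add: ring_of_type_algebra_def)

lemma scalar_scalar: "x \<in> carrier V \<Longrightarrow> a \<odot> (b \<odot> x) = (a * b) \<odot> x"
  using smult_assoc1[of a b x] by (simp add: ring_of_type_algebra_def)

lemma scalar_one [simp]: "x \<in> carrier V \<Longrightarrow> 1 \<odot> x = x"
  using smult_one[of x] by (simp add: ring_of_type_algebra_def)

lemma scalar_zero_left [simp]: "x \<in> carrier V \<Longrightarrow> 0 \<odot> x = \<zero>"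
  using smult_l_null[of x] by (simp add: ring_of_type_algebra_def)

lemma scalar_zero_right [simp]: "c \<odot> \<zero> = \<zero>"
  using smult_r_null[of c] by (simp add: ring_of_type_algebra_def)

text \<open>\<open>linear_map\<close> and \<open>subspace_of\<close> speak of sums and scalar
  multiples only. Writing negatives as multiples by -1 lets both of them handle differences.\<close>

lemma uminus_eq_scalar: "x \<in> carrier V \<Longrightarrow> \<ominus> x = (- 1) \<odot> x"
proof -
  assume x: "x \<in> carrier V"
  have "(- 1) \<odot> x \<oplus> x = \<zero>"
    using scalar_add_left[OF x, of "- 1" 1] x by simp
  then show ?thesis using x by (simp add: minus_equality)
qed

lemma diff_eq_scalar:
  "x \<in> carrier V \<Longrightarrow> y \<in> carrier V \<Longrightarrow> x \<ominus> y = x \<oplus> (- 1) \<odot> y"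
  by (simp add: minus_eq uminus_eq_scalar)

lemma diff_add_diff:
  assumes "x \<in> carrier V" "y \<in> carrier V" "v \<in> carrier V" "w \<in> carrier V"
  shows "(x \<oplus> y) \<ominus> (v \<oplus> w) = (x \<ominus> v) \<oplus> (y \<ominus> w)"
  using assms by (simp add: minus_eq minus_add a_ac)

lemma scalar_diff:
  assumes "x \<in> carrier V" "y \<in> carrier V"
  shows "c \<odot> (x \<ominus> y) = c \<odot> x \<ominus> c \<odot> y"
  using assms by (simp add: diff_eq_scalar scalar_add_right scalar_scalar)

lemma diff_split:
  assumes "x \<in> carrier V" "y \<in> carrier V" "z \<in> carrier V"
  shows "x \<ominus> z = (x \<ominus> y) \<oplus> (y \<ominus> z)"
  using assms by (simp add: minus_eq a_assoc r_neg2 r_neg1)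

lemma diff_add_cancel: "x \<in> carrier V \<Longrightarrow> y \<in> carrier V \<Longrightarrow> (x \<ominus> y) \<oplus> y = x"
  by (simp add: minus_eq a_assoc l_neg)

lemma diff_zero_iff: "x \<in> carrier V \<Longrightarrow> y \<in> carrier V \<Longrightarrow> x \<ominus> y = \<zero> \<longleftrightarrow> x = y"
  by (metis diff_add_cancel minus_eq r_neg l_zero)

end

text \<open>The last premise takes the place of additive inverses: once
  \<open>0 \<odot> x = \<zero>\<close> is known, \<open>(- 1) \<odot> x\<close> is an inverse of
  \<open>x\<close>. For function spaces and quotients this is the easier fact to check.\<close>

lemma complex_moduleI:
  fixes V (structure)
  assumes "\<And>x y. x \<in> carrier V \<Longrightarrow> y \<in> carrier V \<Longrightarrow> x \<oplus> y \<in> carrier V" "\<zero> \<in> carrier V"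
    "\<And>x y z. x \<in> carrier V \<Longrightarrow> y \<in> carrier V \<Longrightarrow> z \<in> carrier V \<Longrightarrow> (x \<oplus> y) \<oplus> z = x \<oplus> (y \<oplus> z)"
    "\<And>x y. x \<in> carrier V \<Longrightarrow> y \<in> carrier V \<Longrightarrow> x \<oplus> y = y \<oplus> x"
    "\<And>x. x \<in> carrier V \<Longrightarrow> \<zero> \<oplus> x = x"
    "\<And>c x. x \<in> carrier V \<Longrightarrow> c \<odot> x \<in> carrier V"
    "\<And>a b x. x \<in> carrier V \<Longrightarrow> (a + b) \<odot> x = a \<odot> x \<oplus> b \<odot> x"
    "\<And>c x y. x \<in> carrier V \<Longrightarrow> y \<in> carrier V \<Longrightarrow> c \<odot> (x \<oplus> y) = c \<odot> x \<oplus> c \<odot> y"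
    "\<And>a b x. x \<in> carrier V \<Longrightarrow> (a * b) \<odot> x = a \<odot> (b \<odot> x)"
    "\<And>x. x \<in> carrier V \<Longrightarrow> 1 \<odot> x = x"
    "\<And>x. x \<in> carrier V \<Longrightarrow> (0::complex) \<odot> x = \<zero>"
  shows "Module.module (ring_of_type_algebra :: complex ring) V"
proof (rule moduleI)
  show "cring (ring_of_type_algebra :: complex ring)" by (rule cring_from_type_algebra)
  show "abelian_group V"
  proof (rule abelian_groupI)
    fix x assume x: "x \<in> carrier V"
    have "(- 1) \<odot> x \<oplus> x = \<zero>"
      using assms(7)[OF x, of "- 1" 1] assms(10,11)[OF x] by simp
    then show "\<exists>y\<in>carrier V. y \<oplus> x = \<zero>" using assms(6)[OF x] by blast
  qed (use assms in auto)
qed (use assms in \<open>auto simp: ring_of_type_algebra_def\<close>)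

definition subspace_of :: "(complex, 'a, 'm) module_scheme \<Rightarrow> 'a set \<Rightarrow> bool" where
  "subspace_of V S \<longleftrightarrow> S \<subseteq> carrier V \<and> \<zero>\<^bsub>V\<^esub> \<in> S \<and> (\<forall>x\<in>S. \<forall>y\<in>S. x \<oplus>\<^bsub>V\<^esub> y \<in> S) \<and>
     (\<forall>c. \<forall>x\<in>S. c \<odot>\<^bsub>V\<^esub> x \<in> S)"

context complex_module
begin

lemma subspace_module:
  assumes "subspace_of V S"
  shows "Module.module (ring_of_type_algebra :: complex ring) (V\<lparr>carrier := S\<rparr>)"
proof -
  have S: "x \<in> S \<Longrightarrow> x \<in> carrier V" for x using assms by (auto simp: subspace_of_def)
  show ?thesis
    by (rule complex_moduleI)
      (use assms S in \<open>auto simp: subspace_of_def a_assoc scalar_add_left scalar_add_right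
        scalar_scalar intro: a_comm\<close>)
qed

lemma subspace_diff:
  assumes "subspace_of V S" "x \<in> S" "y \<in> S"
  shows "x \<ominus> y \<in> S"
proof -
  have "x \<in> carrier V" "y \<in> carrier V" using assms by (auto simp: subspace_of_def)
  then show ?thesis using assms by (simp add: diff_eq_scalar subspace_of_def)
qed

text \<open>Subtraction is not a field of the record: inverses are picked inside the carrier, so
  shrinking the carrier could a priori change them. Both differences equal the sum with
  \<open>(- 1) \<odot> y\<close>, which uses record fields only.\<close>

lemma subspace_diff_eq:
  assumes S: "subspace_of V S" and "x \<in> S" "y \<in> S"
  shows "x \<ominus>\<^bsub>V\<lparr>carrier := S\<rparr>\<^esub> y = x \<ominus> y"
proof -
  interpret S: complex_module "V\<lparr>carrier := S\<rparr>"
    using subspace_module[OF S] by (simp add: complex_module_def)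
  have "x \<in> carrier V" "y \<in> carrier V" using assms by (auto simp: subspace_of_def)
  then show ?thesis using assms S.diff_eq_scalar[of x y] diff_eq_scalar[of x y] by simp
qed

end

section \<open>Quotients\<close>

locale quotient_module = complex_module V for V :: "'a nspace" (structure) +
  fixes N assumes subspace_N: "subspace_of V N"
begin

lemma N_carrier: "n \<in> N \<Longrightarrow> n \<in> carrier V" and N_zero: "\<zero> \<in> N"
  and N_add: "m \<in> N \<Longrightarrow> n \<in> N \<Longrightarrow> m \<oplus> n \<in> N" and N_scalar: "n \<in> N \<Longrightarrow> c \<odot> n \<in> N"
  using subspace_N by (auto simp: subspace_of_def)

sublocale abelian_subgroup N V
proof (rule abelian_subgroupI3)
  show "additive_subgroup N V"
    by (intro additive_subgroup.intro add.subgroupI)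
      (use N_carrier N_zero N_add N_scalar uminus_eq_scalar in \<open>auto simp flip: a_inv_def\<close>)
  show "abelian_group V" ..
qed

lemma mem_coset_iff: "x \<in> carrier V \<Longrightarrow> y \<in> N +> x \<longleftrightarrow> y \<in> carrier V \<and> y \<ominus> x \<in> N"
proof safe
  assume x: "x \<in> carrier V" and "y \<in> N +> x"
  then obtain n where "n \<in> N" "y = n \<oplus> x" by (auto simp: a_r_coset_def')
  then show "y \<in> carrier V" "y \<ominus> x \<in> N"
    using x N_carrier[of n] by (simp_all add: minus_eq a_assoc r_neg)
next
  assume "x \<in> carrier V" "y \<in> carrier V" "y \<ominus> x \<in> N"
  then show "y \<in> N +> x"
    using diff_add_cancel[of y x] by (force simp: a_r_coset_def')
qed

lemma coset_self: "x \<in> carrier V \<Longrightarrow> x \<in> N +> x"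
  by (simp add: mem_coset_iff minus_eq r_neg N_zero)

lemma coset_eq_iff:
  assumes "x \<in> carrier V" "y \<in> carrier V"
  shows "N +> x = N +> y \<longleftrightarrow> x \<ominus> y \<in> N"
proof
  assume "N +> x = N +> y"
  then show "x \<ominus> y \<in> N" using coset_self[of x] mem_coset_iff[of y x] assms by simp
next
  assume "x \<ominus> y \<in> N"
  then have "x \<in> N +> y" using mem_coset_iff assms by simp
  then show "N +> x = N +> y" using a_repr_independence'[of x y] assms(2) by simp
qed

abbreviation Q where "Q \<equiv> quotient_space V N"

lemma carrier_quotient: "carrier Q = (\<lambda>x. N +> x) ` carrier V"
  by (auto simp: quotient_space_def A_RCOSETS_def')

lemma quotientE:
  assumes "A \<in> carrier Q" obtains x where "x \<in> carrier V" "A = N +> x"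
  using assms by (auto simp: carrier_quotient)

lemma coset_in_quotient [simp]: "x \<in> carrier V \<Longrightarrow> N +> x \<in> carrier Q"
  by (simp add: carrier_quotient)

lemma add_quotient:
  "x \<in> carrier V \<Longrightarrow> y \<in> carrier V \<Longrightarrow> (N +> x) \<oplus>\<^bsub>Q\<^esub> (N +> y) = N +> (x \<oplus> y)"
  by (simp add: quotient_space_def a_rcos_sum)

lemma zero_quotient: "\<zero>\<^bsub>Q\<^esub> = N +> \<zero>"
  using N_carrier by (auto simp: quotient_space_def a_r_coset_def')

lemma scalar_quotient:
  assumes x: "x \<in> carrier V" shows "c \<odot>\<^bsub>Q\<^esub> (N +> x) = N +> (c \<odot> x)"
proof -
  have "set_add V N ((\<lambda>x. c \<odot> x) ` (N +> x)) = N +> (c \<odot> x)"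
  proof (intro Set.set_eqI iffI)
    fix z assume "z \<in> set_add V N ((\<lambda>x. c \<odot> x) ` (N +> x))"
    then obtain m n where mn: "m \<in> N" "n \<in> N" "z = m \<oplus> c \<odot> (n \<oplus> x)"
      by (auto simp: set_add_def' a_r_coset_def')
    then have "z = (m \<oplus> c \<odot> n) \<oplus> c \<odot> x"
      using x by (simp add: N_carrier scalar_add_right a_assoc)
    then show "z \<in> N +> (c \<odot> x)"
      using mn N_add N_scalar by (auto simp: a_r_coset_def')
  next
    fix z assume "z \<in> N +> (c \<odot> x)"
    then obtain n where "n \<in> N" "z = n \<oplus> c \<odot> x" by (auto simp: a_r_coset_def')
    then show "z \<in> set_add V N ((\<lambda>x. c \<odot> x) ` (N +> x))"
      using coset_self[OF x] unfolding set_add_def' by blast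
  qed
  then show ?thesis by (simp add: quotient_space_def)
qed

lemma quotient_module: "Module.module (ring_of_type_algebra :: complex ring) Q"
proof (rule complex_moduleI)
  fix A B assume "A \<in> carrier Q" "B \<in> carrier Q"
  then obtain x y where "x \<in> carrier V" "A = N +> x" "y \<in> carrier V" "B = N +> y"
    by (metis quotientE)
  then show "A \<oplus>\<^bsub>Q\<^esub> B = B \<oplus>\<^bsub>Q\<^esub> A" by (simp add: add_quotient a_comm)
qed (auto elim!: quotientE simp: add_quotient zero_quotient scalar_quotient a_assoc
      scalar_add_left scalar_add_right scalar_scalar)

sublocale Q: complex_module Q
  using quotient_module by (simp add: complex_module_def)

lemma diff_quotient:
  "x \<in> carrier V \<Longrightarrow> y \<in> carrier V \<Longrightarrow> (N +> x) \<ominus>\<^bsub>Q\<^esub> (N +> y) = N +> (x \<ominus> y)"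
  by (simp add: Q.diff_eq_scalar diff_eq_scalar scalar_quotient add_quotient)

lemma nrm_quotient: "nrm Q A = (INF x\<in>A. nrm V x)"
  by (simp add: quotient_space_def)

end

section \<open>Normed spaces\<close>

text \<open>Definiteness is left out on purpose: \<open>L\<^sup>p\<close> functions, before they are
  identified almost everywhere, carry only a seminorm.\<close>

locale complex_normed = complex_module V for V :: "('a, 'm) nspace_scheme" (structure) +
  assumes nrm_nonneg: "x \<in> carrier V \<Longrightarrow> 0 \<le> nrm V x"
    and nrm_scalar: "x \<in> carrier V \<Longrightarrow> nrm V (c \<odot> x) = cmod c * nrm V x"
    and nrm_add: "x \<in> carrier V \<Longrightarrow> y \<in> carrier V \<Longrightarrow> nrm V (x \<oplus> y) \<le> nrm V x + nrm V y"
begin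

lemma nrm_zero [simp]: "nrm V \<zero> = 0"
  using nrm_scalar[of "\<zero>" 0] by simp

lemma nrm_diff_commute:
  assumes "x \<in> carrier V" "y \<in> carrier V" shows "nrm V (x \<ominus> y) = nrm V (y \<ominus> x)"
proof -
  have "x \<ominus> y = (- 1) \<odot> (y \<ominus> x)"
    using assms by (simp add: diff_eq_scalar scalar_add_right scalar_scalar a_comm)
  then show ?thesis using assms nrm_scalar[of "y \<ominus> x" "- 1"] by simp
qed

lemma nrm_diff_triangle:
  assumes "x \<in> carrier V" "y \<in> carrier V" "z \<in> carrier V"
  shows "nrm V (x \<ominus> z) \<le> nrm V (x \<ominus> y) + nrm V (y \<ominus> z)"
  using nrm_add[of "x \<ominus> y" "y \<ominus> z"] diff_split[OF assms] assms by simp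

lemma nrm_le_add_diff:
  assumes "x \<in> carrier V" "y \<in> carrier V" shows "nrm V x \<le> nrm V y + nrm V (x \<ominus> y)"
  using nrm_add[of "x \<ominus> y" y] diff_add_cancel[of x y] assms by simp

definition complete_nrm :: bool where
  "complete_nrm \<longleftrightarrow> (\<forall>s. (\<forall>n::nat. s n \<in> carrier V) \<and>
     (\<forall>e>0. \<exists>N. \<forall>m\<ge>N. \<forall>n\<ge>N. nrm V (s m \<ominus> s n) < e) \<longrightarrow>
     (\<exists>l\<in>carrier V. (\<lambda>n. nrm V (s n \<ominus> l)) \<longlonglongrightarrow> 0))"

lemma normed_spaceI:
  "(\<And>x. x \<in> carrier V \<Longrightarrow> nrm V x = 0 \<Longrightarrow> x = \<zero>) \<Longrightarrow> normed_space V"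
  unfolding normed_space_def using module_axioms nrm_nonneg nrm_scalar nrm_add by auto

lemma banach_space_iff: "banach_space V \<longleftrightarrow> normed_space V \<and> complete_nrm"
  by (simp add: banach_space_def complete_nrm_def)

end

lemma normed_space_imp_complex_normed: "normed_space V \<Longrightarrow> complex_normed V"
  unfolding normed_space_def complex_normed_def complex_normed_axioms_def complex_module_def by auto

lemma normed_space_zero_iff:
  "normed_space V \<Longrightarrow> x \<in> carrier V \<Longrightarrow> nrm V x = 0 \<longleftrightarrow> x = \<zero>\<^bsub>V\<^esub>"
  by (simp add: normed_space_def)

lemma banach_imp_normed: "banach_space V \<Longrightarrow> normed_space V"
  by (simp add: banach_space_def)

lemma banach_spaceD:
  assumes "banach_space V" "\<And>n::nat. s n \<in> carrier V"
    "\<And>e. e > 0 \<Longrightarrow> \<exists>N. \<forall>m\<ge>N. \<forall>n\<ge>N. nrm V (s m \<ominus>\<^bsub>V\<^esub> s n) < e"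
  shows "\<exists>l\<in>carrier V. (\<lambda>n. nrm V (s n \<ominus>\<^bsub>V\<^esub> l)) \<longlonglongrightarrow> 0"
  using assms by (simp add: banach_space_def)

text \<open>The seminorm is constant on cosets of its null space, so the infimum in the quotient
  norm runs over a single value. Hence any choice of representatives of a Cauchy sequence is again
  Cauchy, and completeness descends without passing to subsequences.\<close>

lemma seminorm_quotient:
  fixes V :: "'a nspace"
  assumes "complex_normed V" and N: "N = {x \<in> carrier V. nrm V x = 0}"
  shows "subspace_of V N" "\<And>x. x \<in> carrier V \<Longrightarrow> nrm (quotient_space V N) (N +>\<^bsub>V\<^esub> x) = nrm V x"
    "normed_space (quotient_space V N)"
    "complex_normed.complete_nrm V \<Longrightarrow> banach_space (quotient_space V N)"
proof -
  interpret complex_normed V by fact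
  have N_iff: "n \<in> N \<longleftrightarrow> n \<in> carrier V \<and> nrm V n = 0" for n by (simp add: N)
  show sub: "subspace_of V N"
  proof -
    have "nrm V (x \<oplus>\<^bsub>V\<^esub> y) = 0" if "x \<in> N" "y \<in> N" for x y
      using that nrm_add[of x y] nrm_nonneg[of "x \<oplus>\<^bsub>V\<^esub> y"] by (simp add: N)
    then show ?thesis unfolding subspace_of_def by (simp add: nrm_scalar N)
  qed
  interpret quotient_module V N by unfold_locales (rule sub)
  have coset: "nrm V y = nrm V x" if x: "x \<in> carrier V" and y: "y \<in> N +>\<^bsub>V\<^esub> x" for x y
  proof -
    have y: "y \<in> carrier V" "y \<ominus>\<^bsub>V\<^esub> x \<in> N" using x y mem_coset_iff by blast+
    have "nrm V (y \<ominus>\<^bsub>V\<^esub> x) = 0" using y(2) N_iff by blast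
    with y(1) show ?thesis
      using nrm_le_add_diff[of x y] nrm_le_add_diff[of y x] nrm_diff_commute[of x y] x by simp
  qed
  show nrmQ: "nrm Q (N +>\<^bsub>V\<^esub> x) = nrm V x" if x: "x \<in> carrier V" for x
  proof -
    have "nrm V ` (N +>\<^bsub>V\<^esub> x) = {nrm V x}"
      using coset[OF x] coset_self[OF x] by blast
    then show ?thesis by (simp add: nrm_quotient)
  qed
  have cn: "complex_normed Q"
  proof
    fix A B c assume A: "A \<in> carrier Q"
    then obtain x where x: "x \<in> carrier V" "A = N +>\<^bsub>V\<^esub> x" by (rule quotientE)
    show "0 \<le> nrm Q A" "nrm Q (c \<odot>\<^bsub>Q\<^esub> A) = cmod c * nrm Q A"
      using x by (simp_all add: nrmQ nrm_nonneg scalar_quotient nrm_scalar)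
    assume "B \<in> carrier Q"
    then obtain y where "y \<in> carrier V" "B = N +>\<^bsub>V\<^esub> y" by (rule quotientE)
    then show "nrm Q (A \<oplus>\<^bsub>Q\<^esub> B) \<le> nrm Q A + nrm Q B"
      using x by (simp add: nrmQ add_quotient nrm_add)
  qed
  interpret QN: complex_normed Q by (rule cn)
  show ns: "normed_space Q"
  proof (rule QN.normed_spaceI)
    fix A assume "A \<in> carrier Q" and A: "nrm Q A = 0"
    then obtain x where x: "x \<in> carrier V" "A = N +>\<^bsub>V\<^esub> x" using quotientE by blast
    then have "nrm V x = 0" using A nrmQ by simp
    then have "x \<in> N" using x N_iff by blast
    then have "x \<ominus>\<^bsub>V\<^esub> \<zero>\<^bsub>V\<^esub> \<in> N" using x by (simp add: minus_eq)
    then show "A = \<zero>\<^bsub>Q\<^esub>" using x by (simp add: zero_quotient coset_eq_iff)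
  qed
  assume complete: complete_nrm
  have "QN.complete_nrm"
    unfolding QN.complete_nrm_def
  proof safe
    fix s :: "nat \<Rightarrow> _" assume "\<forall>n. s n \<in> carrier Q"
      and cauchy: "\<forall>e>0. \<exists>N. \<forall>m\<ge>N. \<forall>n\<ge>N. nrm Q (s m \<ominus>\<^bsub>Q\<^esub> s n) < e"
    then have "\<forall>n. \<exists>x. x \<in> carrier V \<and> s n = N +>\<^bsub>V\<^esub> x" by (metis quotientE)
    then obtain r where r: "\<And>n. r n \<in> carrier V" "\<And>n. s n = N +>\<^bsub>V\<^esub> r n" by metis
    have "\<forall>e>0. \<exists>N. \<forall>m\<ge>N. \<forall>n\<ge>N. nrm V (r m \<ominus>\<^bsub>V\<^esub> r n) < e"
      using cauchy by (simp add: r diff_quotient nrmQ)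
    then obtain l where "l \<in> carrier V" "(\<lambda>n. nrm V (r n \<ominus>\<^bsub>V\<^esub> l)) \<longlonglongrightarrow> 0"
      using complete r(1) unfolding complete_nrm_def by blast
    then show "\<exists>L\<in>carrier Q. (\<lambda>n. nrm Q (s n \<ominus>\<^bsub>Q\<^esub> L)) \<longlonglongrightarrow> 0"
      by (intro bexI[of _ "N +>\<^bsub>V\<^esub> l"]) (simp_all add: r diff_quotient nrmQ)
  qed
  then show "banach_space Q" using ns QN.banach_space_iff by simp
qed

lemma linear_map_zero:
  assumes "complex_module V" "complex_module W" "linear_map V W T"
  shows "T \<zero>\<^bsub>V\<^esub> = \<zero>\<^bsub>W\<^esub>"
proof -
  interpret V: complex_module V by fact
  interpret W: complex_module W by fact
  have "T (0 \<odot>\<^bsub>V\<^esub> \<zero>\<^bsub>V\<^esub>) = 0 \<odot>\<^bsub>W\<^esub> T \<zero>\<^bsub>V\<^esub>" "T \<zero>\<^bsub>V\<^esub> \<in> carrier W"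
    using assms(3) V.zero_closed unfolding linear_map_def by (blast, auto)
  then show ?thesis by simp
qed

lemma linear_map_diff:
  assumes "complex_module V" "complex_module W" "linear_map V W T" "x \<in> carrier V" "y \<in> carrier V"
  shows "T (x \<ominus>\<^bsub>V\<^esub> y) = T x \<ominus>\<^bsub>W\<^esub> T y"
proof -
  interpret V: complex_module V by fact
  interpret W: complex_module W by fact
  have "T x \<in> carrier W" "T y \<in> carrier W" using assms by (auto simp: linear_map_def)
  then show ?thesis
    using assms by (simp add: V.diff_eq_scalar W.diff_eq_scalar linear_map_def)
qed

text \<open>\<open>U\<close> is only a module with some function \<open>nrm U\<close>; all norm
  axioms and completeness are carried over by \<Phi>. For the quotient by the kernel of a projection
  this replaces the usual arguments with infima over cosets and summable series.\<close>

lemma banach_space_isometry: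
  assumes W: "banach_space W" and U: "complex_module U" and lin: "linear_map W U \<Phi>"
    and bij: "bij_betw \<Phi> (carrier W) (carrier U)"
    and iso: "\<And>x. x \<in> carrier W \<Longrightarrow> nrm U (\<Phi> x) = nrm W x"
  shows "banach_space U"
proof -
  interpret W: complex_normed W
    by (intro normed_space_imp_complex_normed banach_imp_normed W)
  interpret U: complex_module U by fact
  note linD = lin[unfolded linear_map_def]
  have surj: "\<exists>x\<in>carrier W. y = \<Phi> x" if "y \<in> carrier U" for y
    using bij that by (auto simp: bij_betw_def)
  interpret U: complex_normed U
  proof
    fix y z c assume "y \<in> carrier U"
    then obtain x where x: "x \<in> carrier W" "y = \<Phi> x" using surj by blast
    have "nrm U (\<Phi> (c \<odot>\<^bsub>W\<^esub> x)) = cmod c * nrm W x" using x by (simp add: iso W.nrm_scalar)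
    then show "0 \<le> nrm U y" "nrm U (c \<odot>\<^bsub>U\<^esub> y) = cmod c * nrm U y"
      using x linD by (auto simp: iso W.nrm_nonneg)
    assume "z \<in> carrier U"
    then obtain w where w: "w \<in> carrier W" "z = \<Phi> w" using surj by blast
    have "nrm U (\<Phi> (x \<oplus>\<^bsub>W\<^esub> w)) \<le> nrm W x + nrm W w" using x w by (simp add: iso W.nrm_add)
    then show "nrm U (y \<oplus>\<^bsub>U\<^esub> z) \<le> nrm U y + nrm U z"
      using x w linD by (simp add: iso)
  qed
  have ns: "normed_space U"
  proof (rule U.normed_spaceI)
    fix y assume "y \<in> carrier U" "nrm U y = 0"
    then obtain x where "x \<in> carrier W" "y = \<Phi> x" "nrm W x = 0" using surj iso by metis
    then show "y = \<zero>\<^bsub>U\<^esub>"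
      using normed_space_zero_iff[OF banach_imp_normed[OF W]]
        linear_map_zero[OF W.complex_module_axioms U.complex_module_axioms lin] by auto
  qed
  have "U.complete_nrm"
    unfolding U.complete_nrm_def
  proof safe
    fix s :: "nat \<Rightarrow> _" assume "\<forall>n. s n \<in> carrier U"
      and cauchy: "\<forall>e>0. \<exists>N. \<forall>m\<ge>N. \<forall>n\<ge>N. nrm U (s m \<ominus>\<^bsub>U\<^esub> s n) < e"
    then have "\<forall>n. \<exists>x. x \<in> carrier W \<and> s n = \<Phi> x" using surj by blast
    then obtain r where r: "\<And>n. r n \<in> carrier W" "\<And>n. s n = \<Phi> (r n)" by metis
    have d: "nrm U (\<Phi> x \<ominus>\<^bsub>U\<^esub> \<Phi> y) = nrm W (x \<ominus>\<^bsub>W\<^esub> y)" if "x \<in> carrier W" "y \<in> carrier W" for x y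
      using linear_map_diff[OF W.complex_module_axioms U.complex_module_axioms lin that]
        iso[of "x \<ominus>\<^bsub>W\<^esub> y"] that by simp
    have "\<exists>l\<in>carrier W. (\<lambda>n. nrm W (r n \<ominus>\<^bsub>W\<^esub> l)) \<longlonglongrightarrow> 0"
      using cauchy by (intro banach_spaceD[OF W]) (simp_all add: r d)
    then obtain l where "l \<in> carrier W" "(\<lambda>n. nrm W (r n \<ominus>\<^bsub>W\<^esub> l)) \<longlonglongrightarrow> 0" by blast
    then show "\<exists>L\<in>carrier U. (\<lambda>n. nrm U (s n \<ominus>\<^bsub>U\<^esub> L)) \<longlonglongrightarrow> 0"
      using linD by (intro bexI[of _ "\<Phi> l"]) (auto simp: r d)
  qed
  then show ?thesis using ns U.banach_space_iff by simp
qed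

lemma norm_closure_banach:
  assumes V: "banach_space V" and S: "subspace_of V S"
  shows "subspace_of V (norm_closure V S)" "S \<subseteq> norm_closure V S"
    "banach_space (V\<lparr>carrier := norm_closure V S\<rparr>)"
proof -
  interpret V: complex_normed V
    by (intro normed_space_imp_complex_normed banach_imp_normed V)
  let ?C = "norm_closure V S"
  let ?W = "V\<lparr>carrier := ?C\<rparr>"
  have S': "x \<in> S \<Longrightarrow> x \<in> carrier V" for x using S by (auto simp: subspace_of_def)
  have C': "x \<in> ?C \<Longrightarrow> x \<in> carrier V" for x by (auto simp: norm_closure_def)
  show SC: "S \<subseteq> ?C"
    using S' by (auto simp: norm_closure_def V.minus_eq V.r_neg intro!: bexI)
  have "x \<oplus>\<^bsub>V\<^esub> y \<in> ?C" if x: "x \<in> ?C" and y: "y \<in> ?C" for x y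
    unfolding norm_closure_def
  proof (safe, goal_cases)
    case (2 e)
    then have "e / 2 > 0" by simp
    then obtain v w where v: "v \<in> S" "nrm V (x \<ominus>\<^bsub>V\<^esub> v) < e / 2"
      and w: "w \<in> S" "nrm V (y \<ominus>\<^bsub>V\<^esub> w) < e / 2"
      using x y unfolding norm_closure_def by blast
    have "nrm V ((x \<oplus>\<^bsub>V\<^esub> y) \<ominus>\<^bsub>V\<^esub> (v \<oplus>\<^bsub>V\<^esub> w)) < e"
      using v w C'[OF x] C'[OF y] S' V.nrm_add[of "x \<ominus>\<^bsub>V\<^esub> v" "y \<ominus>\<^bsub>V\<^esub> w"]
      by (simp add: V.diff_add_diff)
    then show ?case using v w S by (auto simp: subspace_of_def)
  qed (use C' that in auto)
  moreover have "c \<odot>\<^bsub>V\<^esub> x \<in> ?C" if x: "x \<in> ?C" for c x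
    unfolding norm_closure_def
  proof (safe, goal_cases)
    case (2 e)
    \<comment> \<open>The summand 1 keeps the denominator positive when
      \<open>c = 0\<close>.\<close>
    then have "e / (cmod c + 1) > 0" by (simp add: add_nonneg_pos)
    then obtain v where v: "v \<in> S" "nrm V (x \<ominus>\<^bsub>V\<^esub> v) < e / (cmod c + 1)"
      using x unfolding norm_closure_def by blast
    have "nrm V (c \<odot>\<^bsub>V\<^esub> x \<ominus>\<^bsub>V\<^esub> c \<odot>\<^bsub>V\<^esub> v) = cmod c * nrm V (x \<ominus>\<^bsub>V\<^esub> v)"
      using v C'[OF x] S' by (simp flip: V.scalar_diff add: V.nrm_scalar)
    also have "\<dots> \<le> (cmod c + 1) * nrm V (x \<ominus>\<^bsub>V\<^esub> v)"
      using v C'[OF x] S' by (intro mult_right_mono V.nrm_nonneg) auto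
    also have "\<dots> < e"
      using v by (simp add: pos_less_divide_eq add_nonneg_pos mult.commute)
    finally show ?case using v S by (auto simp: subspace_of_def)
  qed (use C' that in auto)
  ultimately show sub: "subspace_of V ?C"
    using SC S C' unfolding subspace_of_def by blast
  interpret W: complex_module ?W
    using V.subspace_module[OF sub] by (simp add: complex_module_def)
  interpret W: complex_normed ?W
    by unfold_locales (use C' in \<open>auto simp: V.nrm_nonneg V.nrm_scalar V.nrm_add\<close>)
  have ns: "normed_space ?W"
    by (rule W.normed_spaceI) (use C' normed_space_zero_iff[OF banach_imp_normed[OF V]] in auto)
  have "W.complete_nrm"
    unfolding W.complete_nrm_def
  proof safe
    fix s :: "nat \<Rightarrow> _" assume s: "\<forall>n. s n \<in> carrier ?W"
      and cauchy: "\<forall>e>0. \<exists>N. \<forall>m\<ge>N. \<forall>n\<ge>N. nrm ?W (s m \<ominus>\<^bsub>?W\<^esub> s n) < e"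
    have sC: "s n \<in> ?C" for n using s by simp
    have "\<exists>l\<in>carrier V. (\<lambda>n. nrm V (s n \<ominus>\<^bsub>V\<^esub> l)) \<longlonglongrightarrow> 0"
      using cauchy C'[OF sC] by (intro banach_spaceD[OF V]) (simp_all add: sC V.subspace_diff_eq[OF sub])
    then obtain l where l: "l \<in> carrier V" "(\<lambda>n. nrm V (s n \<ominus>\<^bsub>V\<^esub> l)) \<longlonglongrightarrow> 0" by blast
    have "l \<in> ?C"
      unfolding norm_closure_def
    proof (safe, goal_cases)
      case (2 e)
      then have e: "e / 2 > 0" by simp
      obtain n where n: "nrm V (s n \<ominus>\<^bsub>V\<^esub> l) < e / 2"
        using order_tendstoD(2)[OF l(2) e] by (auto simp: eventually_sequentially)
      obtain v where v: "v \<in> S" "nrm V (s n \<ominus>\<^bsub>V\<^esub> v) < e / 2"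
        using sC[of n] e unfolding norm_closure_def by blast
      have "nrm V (l \<ominus>\<^bsub>V\<^esub> v) < e"
        using n v V.nrm_diff_triangle[OF l(1) C'[OF sC[of n]] S'[OF v(1)]]
          V.nrm_diff_commute[OF l(1) C'[OF sC[of n]]] by simp
      then show ?case using v by blast
    qed (rule l)
    then show "\<exists>L\<in>carrier ?W. (\<lambda>n. nrm ?W (s n \<ominus>\<^bsub>?W\<^esub> L)) \<longlonglongrightarrow> 0"
      using l sC by (intro bexI[of _ l]) (simp_all add: V.subspace_diff_eq[OF sub])
  qed
  then show "banach_space ?W" using ns W.banach_space_iff by simp
qed

section \<open>Extension of densely defined contractions\<close>

lemma bounded_linear_map_eq_on_dense:
  assumes V: "normed_space V" and W: "normed_space W"
    and T: "bounded_linear_map V W T" and T': "bounded_linear_map V W T'"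
    and D: "D \<subseteq> carrier V" "\<And>x e. x \<in> carrier V \<Longrightarrow> e > 0 \<Longrightarrow> \<exists>d\<in>D. nrm V (x \<ominus>\<^bsub>V\<^esub> d) < e"
    and eq: "\<And>d. d \<in> D \<Longrightarrow> T d = T' d" and x: "x \<in> carrier V"
  shows "T x = T' x"
proof -
  interpret V: complex_normed V by (rule normed_space_imp_complex_normed[OF V])
  interpret W: complex_normed W by (rule normed_space_imp_complex_normed[OF W])
  obtain A B where A: "\<And>x. x \<in> carrier V \<Longrightarrow> nrm W (T x) \<le> A * nrm V x"
    and B: "\<And>x. x \<in> carrier V \<Longrightarrow> nrm W (T' x) \<le> B * nrm V x"
    using T T' unfolding bounded_linear_map_def by blast
  have lin: "linear_map V W T" "linear_map V W T'" using T T' by (auto simp: bounded_linear_map_def)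
  note tdiff = lin[THEN linear_map_diff[OF V.complex_module_axioms W.complex_module_axioms]]
  have c: "T y \<in> carrier W" "T' y \<in> carrier W" if "y \<in> carrier V" for y
    using lin that by (auto simp: linear_map_def)
  have "nrm W (T x \<ominus>\<^bsub>W\<^esub> T' x) \<le> 0"
  proof (rule field_le_epsilon)
    fix e :: real assume e: "e > 0"
    \<comment> \<open>The constants \<open>A\<close> and \<open>B\<close> may be negative;
      \<open>K\<close> is positive in any case and dominates \<open>A + B\<close>.\<close>
    define K where "K = \<bar>A\<bar> + \<bar>B\<bar> + 1"
    have K: "K > 0" by (simp add: K_def)
    obtain d where d: "d \<in> D" "nrm V (x \<ominus>\<^bsub>V\<^esub> d) < e / K"
      using D(2)[OF x, of "e / K"] e K by auto
    have dV: "d \<in> carrier V" using d D by auto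
    have "nrm W (T x \<ominus>\<^bsub>W\<^esub> T' x) \<le> nrm W (T x \<ominus>\<^bsub>W\<^esub> T d) + nrm W (T d \<ominus>\<^bsub>W\<^esub> T' x)"
      using c x dV by (intro W.nrm_diff_triangle)
    also have "\<dots> = nrm W (T (x \<ominus>\<^bsub>V\<^esub> d)) + nrm W (T' (x \<ominus>\<^bsub>V\<^esub> d))"
      using c[OF x] c[OF dV] W.nrm_diff_commute[of "T' d" "T' x"] x dV by (simp add: tdiff eq[OF d(1)])
    also have "\<dots> \<le> (A + B) * nrm V (x \<ominus>\<^bsub>V\<^esub> d)"
      using A[of "x \<ominus>\<^bsub>V\<^esub> d"] B[of "x \<ominus>\<^bsub>V\<^esub> d"] x dV by (simp add: algebra_simps)
    also have "\<dots> \<le> K * nrm V (x \<ominus>\<^bsub>V\<^esub> d)"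
      using x dV by (intro mult_right_mono V.nrm_nonneg) (auto simp: K_def)
    also have "\<dots> \<le> e" using d K by (simp add: pos_less_divide_eq mult.commute)
    finally show "nrm W (T x \<ominus>\<^bsub>W\<^esub> T' x) \<le> 0 + e" by simp
  qed
  then have "nrm W (T x \<ominus>\<^bsub>W\<^esub> T' x) = 0" using c[OF x] W.nrm_nonneg[of "T x \<ominus>\<^bsub>W\<^esub> T' x"] by simp
  then show ?thesis
    using c[OF x] normed_space_zero_iff[OF W] W.diff_zero_iff by simp
qed

text \<open>The operator is given by its graph \<open>\<Gamma>\<close>; contractivity makes \<open>\<Gamma>\<close> single valued.\<close>

lemma contraction_extension:
  assumes V: "normed_space V" and W: "banach_space W"
    and sub: "\<Gamma> \<subseteq> carrier V \<times> carrier W"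
    and add: "\<And>v w v' w'. (v, w) \<in> \<Gamma> \<Longrightarrow> (v', w') \<in> \<Gamma> \<Longrightarrow> (v \<oplus>\<^bsub>V\<^esub> v', w \<oplus>\<^bsub>W\<^esub> w') \<in> \<Gamma>"
    and scalar: "\<And>c v w. (v, w) \<in> \<Gamma> \<Longrightarrow> (c \<odot>\<^bsub>V\<^esub> v, c \<odot>\<^bsub>W\<^esub> w) \<in> \<Gamma>"
    and contr: "\<And>v w. (v, w) \<in> \<Gamma> \<Longrightarrow> nrm W w \<le> nrm V v"
    and dense: "\<And>x e. x \<in> carrier V \<Longrightarrow> e > 0 \<Longrightarrow> \<exists>(v, w)\<in>\<Gamma>. nrm V (x \<ominus>\<^bsub>V\<^esub> v) < e"
  obtains T where "T \<in> extensional (carrier V)" "linear_map V W T"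
    "\<And>x. x \<in> carrier V \<Longrightarrow> nrm W (T x) \<le> nrm V x" "\<And>v w. (v, w) \<in> \<Gamma> \<Longrightarrow> T v = w"
proof -
  interpret V: complex_normed V by (rule normed_space_imp_complex_normed[OF V])
  interpret W: complex_normed W by (intro normed_space_imp_complex_normed banach_imp_normed W)
  have \<Gamma>V: "v \<in> carrier V" and \<Gamma>W: "w \<in> carrier W" if "(v, w) \<in> \<Gamma>" for v w
    using sub that by auto
  have \<Gamma>diff: "(v \<ominus>\<^bsub>V\<^esub> v', w \<ominus>\<^bsub>W\<^esub> w') \<in> \<Gamma>" if "(v, w) \<in> \<Gamma>" "(v', w') \<in> \<Gamma>" for v w v' w'
    using add[OF that(1) scalar[OF that(2), of "- 1"]] that
    by (simp add: V.diff_eq_scalar W.diff_eq_scalar \<Gamma>V \<Gamma>W)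
  \<comment> \<open>\<open>R\<close> is the closure of the graph \<Gamma> in the product of
    \<open>V\<close> and \<open>W\<close>. Density and completeness make it total, contractivity
    makes it single valued, and it inherits linearity from \<Gamma>.\<close>
  define R where "R x l \<longleftrightarrow> x \<in> carrier V \<and> l \<in> carrier W \<and>
    (\<forall>e>0. \<exists>(v, w)\<in>\<Gamma>. nrm V (x \<ominus>\<^bsub>V\<^esub> v) < e \<and> nrm W (l \<ominus>\<^bsub>W\<^esub> w) < e)" for x l
  have RD: "\<exists>v w. (v, w) \<in> \<Gamma> \<and> nrm V (x \<ominus>\<^bsub>V\<^esub> v) < e \<and> nrm W (l \<ominus>\<^bsub>W\<^esub> w) < e"
    if "R x l" "e > 0" for x l e
    using that by (auto simp: R_def)
  have Rc: "x \<in> carrier V" "l \<in> carrier W" if "R x l" for x l using that by (auto simp: R_def)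
  have RI: "R x l" if "x \<in> carrier V" "l \<in> carrier W"
    "\<And>e. e > 0 \<Longrightarrow> \<exists>v w. (v, w) \<in> \<Gamma> \<and> nrm V (x \<ominus>\<^bsub>V\<^esub> v) < e \<and> nrm W (l \<ominus>\<^bsub>W\<^esub> w) < e" for x l
    unfolding R_def using that by blast
  have Radd: "R (x \<oplus>\<^bsub>V\<^esub> x') (l \<oplus>\<^bsub>W\<^esub> l')" if R: "R x l" "R x' l'" for x x' l l'
  proof (rule RI)
    fix e :: real assume "e > 0"
    then have "e / 2 > 0" by simp
    then obtain v w v' w' where *: "(v, w) \<in> \<Gamma>" "(v', w') \<in> \<Gamma>" "nrm V (x \<ominus>\<^bsub>V\<^esub> v) < e / 2"
      "nrm W (l \<ominus>\<^bsub>W\<^esub> w) < e / 2" "nrm V (x' \<ominus>\<^bsub>V\<^esub> v') < e / 2" "nrm W (l' \<ominus>\<^bsub>W\<^esub> w') < e / 2"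
      using RD[OF R(1)] RD[OF R(2)] by metis
    note c = Rc[OF R(1)] Rc[OF R(2)] \<Gamma>V[OF *(1)] \<Gamma>V[OF *(2)] \<Gamma>W[OF *(1)] \<Gamma>W[OF *(2)]
    have "nrm V ((x \<oplus>\<^bsub>V\<^esub> x') \<ominus>\<^bsub>V\<^esub> (v \<oplus>\<^bsub>V\<^esub> v')) < e"
      using * c V.nrm_add[of "x \<ominus>\<^bsub>V\<^esub> v" "x' \<ominus>\<^bsub>V\<^esub> v'"] by (simp add: V.diff_add_diff)
    moreover have "nrm W ((l \<oplus>\<^bsub>W\<^esub> l') \<ominus>\<^bsub>W\<^esub> (w \<oplus>\<^bsub>W\<^esub> w')) < e"
      using * c W.nrm_add[of "l \<ominus>\<^bsub>W\<^esub> w" "l' \<ominus>\<^bsub>W\<^esub> w'"] by (simp add: W.diff_add_diff)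
    ultimately show "\<exists>v w. (v, w) \<in> \<Gamma> \<and> nrm V ((x \<oplus>\<^bsub>V\<^esub> x') \<ominus>\<^bsub>V\<^esub> v) < e \<and> nrm W ((l \<oplus>\<^bsub>W\<^esub> l') \<ominus>\<^bsub>W\<^esub> w) < e"
      using add[OF *(1,2)] by blast
  qed (use R Rc in auto)
  have Rscalar: "R (c \<odot>\<^bsub>V\<^esub> x) (c \<odot>\<^bsub>W\<^esub> l)" if R: "R x l" for c x l
  proof (rule RI)
    fix e :: real assume "e > 0"
    then have "e / (cmod c + 1) > 0" by (simp add: add_nonneg_pos)
    then obtain v w where *: "(v, w) \<in> \<Gamma>" "nrm V (x \<ominus>\<^bsub>V\<^esub> v) < e / (cmod c + 1)"
      "nrm W (l \<ominus>\<^bsub>W\<^esub> w) < e / (cmod c + 1)"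
      using RD[OF R] by blast
    note cl = Rc[OF R] \<Gamma>V[OF *(1)] \<Gamma>W[OF *(1)]
    have less: "cmod c * a < e" if "a < e / (cmod c + 1)" "0 \<le> a" for a
    proof -
      have "cmod c * a \<le> (cmod c + 1) * a" using that by (intro mult_right_mono) auto
      also have "\<dots> < e" using that by (simp add: pos_less_divide_eq add_nonneg_pos mult.commute)
      finally show ?thesis .
    qed
    have "nrm V (c \<odot>\<^bsub>V\<^esub> x \<ominus>\<^bsub>V\<^esub> c \<odot>\<^bsub>V\<^esub> v) < e" "nrm W (c \<odot>\<^bsub>W\<^esub> l \<ominus>\<^bsub>W\<^esub> c \<odot>\<^bsub>W\<^esub> w) < e"
      using * cl
      by (simp_all flip: V.scalar_diff W.scalar_diff add: V.nrm_scalar W.nrm_scalar less V.nrm_nonneg W.nrm_nonneg)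
    then show "\<exists>v w. (v, w) \<in> \<Gamma> \<and> nrm V (c \<odot>\<^bsub>V\<^esub> x \<ominus>\<^bsub>V\<^esub> v) < e \<and> nrm W (c \<odot>\<^bsub>W\<^esub> l \<ominus>\<^bsub>W\<^esub> w) < e"
      using scalar[OF *(1), of c] by blast
  qed (use Rc[OF R] in auto)
  have Rnrm: "nrm W l \<le> nrm V x" if R: "R x l" for x l
  proof (rule field_le_epsilon)
    fix e :: real assume "e > 0"
    then have "e / 2 > 0" by simp
    then obtain v w where *: "(v, w) \<in> \<Gamma>" "nrm V (x \<ominus>\<^bsub>V\<^esub> v) < e / 2" "nrm W (l \<ominus>\<^bsub>W\<^esub> w) < e / 2"
      using RD[OF R] by blast
    then show "nrm W l \<le> nrm V x + e"
      using contr[OF *(1)] W.nrm_le_add_diff[of l w] V.nrm_le_add_diff[of v x] V.nrm_diff_commute[of x v]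
        Rc[OF R] \<Gamma>V[OF *(1)] \<Gamma>W[OF *(1)]
      by linarith
  qed
  have Runique: "l = l'" if R: "R x l" "R x l'" for x l l'
  proof -
    note c = Rc[OF R(1)] Rc[OF R(2)]
    \<comment> \<open>The difference of the two pairs is in \<open>R\<close> and lies over
      \<open>x - x = 0\<close>, so contractivity forces its second component to have norm 0.\<close>
    have "nrm W (l \<ominus>\<^bsub>W\<^esub> l') \<le> nrm V (x \<ominus>\<^bsub>V\<^esub> x)"
      using Rnrm[OF Radd[OF R(1) Rscalar[OF R(2), of "- 1"]]] c by (simp add: V.diff_eq_scalar W.diff_eq_scalar)
    then have "nrm W (l \<ominus>\<^bsub>W\<^esub> l') = 0"
      using c W.nrm_nonneg[of "l \<ominus>\<^bsub>W\<^esub> l'"] by (simp add: V.minus_eq V.r_neg)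
    then show ?thesis using c normed_space_zero_iff[OF banach_imp_normed[OF W]] W.diff_zero_iff by simp
  qed
  have R\<Gamma>: "R v w" if "(v, w) \<in> \<Gamma>" for v w
    using that \<Gamma>V[OF that] \<Gamma>W[OF that]
    by (intro RI) (auto intro!: exI[of _ v] exI[of _ w] simp: V.minus_eq V.r_neg W.minus_eq W.r_neg)
  have Rex: "\<exists>l. R x l" if x: "x \<in> carrier V" for x
  proof -
    have "\<forall>n. \<exists>v w. (v, w) \<in> \<Gamma> \<and> nrm V (x \<ominus>\<^bsub>V\<^esub> v) < inverse (real (Suc n))"
    proof
      fix n :: nat
      have "inverse (real (Suc n)) > 0" by simp
      from dense[OF x this]
      show "\<exists>v w. (v, w) \<in> \<Gamma> \<and> nrm V (x \<ominus>\<^bsub>V\<^esub> v) < inverse (real (Suc n))" by blast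
    qed
    then obtain v w where vw: "\<And>n. (v n, w n) \<in> \<Gamma>"
      and vx: "\<And>n. nrm V (x \<ominus>\<^bsub>V\<^esub> v n) < inverse (real (Suc n))" by metis
    note c = \<Gamma>V[OF vw] \<Gamma>W[OF vw]
    have lim: "(\<lambda>n. nrm V (x \<ominus>\<^bsub>V\<^esub> v n)) \<longlonglongrightarrow> 0"
      by (rule tendsto_sandwich[OF _ _ tendsto_const LIMSEQ_inverse_real_of_nat])
        (use vx c x V.nrm_nonneg in \<open>auto intro!: always_eventually less_imp_le\<close>)
    have "\<exists>l\<in>carrier W. (\<lambda>n. nrm W (w n \<ominus>\<^bsub>W\<^esub> l)) \<longlonglongrightarrow> 0"
    proof (rule banach_spaceD[OF W c(2)])
      fix e :: real assume "e > 0"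
      then have "\<forall>\<^sub>F n in sequentially. nrm V (x \<ominus>\<^bsub>V\<^esub> v n) < e / 2"
        by (intro order_tendstoD(2)[OF lim]) simp
      then obtain N where N: "\<And>n. n \<ge> N \<Longrightarrow> nrm V (x \<ominus>\<^bsub>V\<^esub> v n) < e / 2"
        by (auto simp: eventually_sequentially)
      have "nrm W (w m \<ominus>\<^bsub>W\<^esub> w n) < e" if "m \<ge> N" "n \<ge> N" for m n
        using contr[OF \<Gamma>diff[OF vw[of m] vw[of n]]] N[OF that(1)] N[OF that(2)]
          V.nrm_diff_triangle[of "v m" x "v n"] V.nrm_diff_commute[of "v m" x] c x by simp
      then show "\<exists>N. \<forall>m\<ge>N. \<forall>n\<ge>N. nrm W (w m \<ominus>\<^bsub>W\<^esub> w n) < e" by blast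
    qed
    then obtain l where l: "l \<in> carrier W" "(\<lambda>n. nrm W (w n \<ominus>\<^bsub>W\<^esub> l)) \<longlonglongrightarrow> 0" by blast
    have "R x l"
    proof (rule RI[OF x l(1)])
      fix e :: real assume "e > 0"
      then have "\<forall>\<^sub>F n in sequentially. nrm V (x \<ominus>\<^bsub>V\<^esub> v n) < e \<and> nrm W (w n \<ominus>\<^bsub>W\<^esub> l) < e"
        by (intro eventually_conj order_tendstoD(2)[OF lim] order_tendstoD(2)[OF l(2)])
      then obtain n where "nrm V (x \<ominus>\<^bsub>V\<^esub> v n) < e" "nrm W (w n \<ominus>\<^bsub>W\<^esub> l) < e"
        by (auto simp: eventually_sequentially)
      then show "\<exists>v w. (v, w) \<in> \<Gamma> \<and> nrm V (x \<ominus>\<^bsub>V\<^esub> v) < e \<and> nrm W (l \<ominus>\<^bsub>W\<^esub> w) < e"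
        using vw[of n] W.nrm_diff_commute[of "w n" l] c l by auto
    qed
    then show ?thesis by blast
  qed
  \<comment> \<open>Restricting to the carrier fixes the values elsewhere, as the extensionality
    clause of \<open>T_ext\<close> demands.\<close>
  define T where "T = restrict (\<lambda>x. SOME l. R x l) (carrier V)"
  have RT: "R x (T x)" if "x \<in> carrier V" for x
    using someI_ex[OF Rex[OF that]] that by (simp add: T_def)
  show thesis
  proof (rule that)
    show "T \<in> extensional (carrier V)" by (simp add: T_def)
    show "linear_map V W T"
      unfolding linear_map_def
    proof (intro conjI ballI allI funcsetI)
      fix x y c assume x: "x \<in> carrier V"
      show "T x \<in> carrier W" using Rc RT x by blast
      show "T (c \<odot>\<^bsub>V\<^esub> x) = c \<odot>\<^bsub>W\<^esub> T x"
        using Runique[OF RT Rscalar[OF RT[OF x]]] x by simp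
      assume y: "y \<in> carrier V"
      show "T (x \<oplus>\<^bsub>V\<^esub> y) = T x \<oplus>\<^bsub>W\<^esub> T y"
        using Runique[OF RT Radd[OF RT[OF x] RT[OF y]]] x y by simp
    qed
    show "nrm W (T x) \<le> nrm V x" if "x \<in> carrier V" for x using Rnrm RT that by blast
    show "T v = w" if "(v, w) \<in> \<Gamma>" for v w using Runique[OF RT R\<Gamma>[OF that]] \<Gamma>V that by blast
  qed
qed

section \<open>Contractive projections\<close>

text \<open>The isometry is the coset map restricted to \<open>C\<close>. It is injective because
  \<open>P\<close> is the identity on \<open>C\<close> and zero on \<open>N\<close>, so they meet
  only in 0; it is onto because \<open>x - P x\<close> lies in \<open>N\<close>, so the coset of
  \<open>x\<close> contains \<open>P x\<close>.\<close>

lemma contractive_projection_quotient: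
  fixes V :: "'a nspace"
  assumes V: "banach_space V" and C: "subspace_of V C" and W: "banach_space (V\<lparr>carrier := C\<rparr>)"
    and P: "linear_map V (V\<lparr>carrier := C\<rparr>) P"
    and contr: "\<And>x. x \<in> carrier V \<Longrightarrow> nrm V (P x) \<le> nrm V x"
    and proj: "\<And>x. x \<in> C \<Longrightarrow> P x = x"
    and N: "N = {x \<in> carrier V. P x = \<zero>\<^bsub>V\<^esub>}"
  shows "banach_space (quotient_space V N)"
    "isometrically_isomorphic (V\<lparr>carrier := C\<rparr>) (quotient_space V N)"
proof -
  let ?W = "V\<lparr>carrier := C\<rparr>"
  interpret V: complex_normed V by (intro normed_space_imp_complex_normed banach_imp_normed V)
  interpret W: complex_normed ?W by (intro normed_space_imp_complex_normed banach_imp_normed W)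
  have C': "x \<in> C \<Longrightarrow> x \<in> carrier V" for x using C by (auto simp: subspace_of_def)
  have PC: "x \<in> carrier V \<Longrightarrow> P x \<in> C" for x using P by (auto simp: linear_map_def)
  have N_iff: "n \<in> N \<longleftrightarrow> n \<in> carrier V \<and> P n = \<zero>\<^bsub>V\<^esub>" for n by (simp add: N)
  have Padd: "P (x \<oplus>\<^bsub>V\<^esub> y) = P x \<oplus>\<^bsub>V\<^esub> P y" if "x \<in> carrier V" "y \<in> carrier V" for x y
    using P that by (simp add: linear_map_def)
  have Pdiff: "P (x \<ominus>\<^bsub>V\<^esub> y) = P x \<ominus>\<^bsub>V\<^esub> P y" if "x \<in> carrier V" "y \<in> carrier V" for x y
    using linear_map_diff[OF V.complex_module_axioms W.complex_module_axioms P that]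
      V.subspace_diff_eq[OF C] PC that by simp
  have "subspace_of V N"
    using P linear_map_zero[OF V.complex_module_axioms W.complex_module_axioms P]
    by (auto simp: subspace_of_def N linear_map_def)
  then interpret quotient_module V N by unfold_locales
  let ?\<Phi> = "\<lambda>x. N +>\<^bsub>V\<^esub> x"
  have lin: "linear_map ?W Q ?\<Phi>"
    unfolding linear_map_def using C' by (auto simp: add_quotient scalar_quotient)
  have iso: "nrm Q (?\<Phi> x) = nrm ?W x" if x: "x \<in> carrier ?W" for x
  proof -
    have x: "x \<in> C" "x \<in> carrier V" using x C' by auto
    have "(INF y\<in>?\<Phi> x. nrm V y) = nrm V x"
    proof (rule antisym)
      show "(INF y\<in>?\<Phi> x. nrm V y) \<le> nrm V x"
        using x V.nrm_nonneg mem_coset_iff[OF x(2)]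
        by (intro cINF_lower bdd_belowI2[of _ 0]) (auto simp: V.minus_eq V.r_neg N_zero)
      show "nrm V x \<le> (INF y\<in>?\<Phi> x. nrm V y)"
      proof (rule cINF_greatest)
        show "?\<Phi> x \<noteq> {}" using coset_self[OF x(2)] by blast
        fix y assume "y \<in> ?\<Phi> x"
        then have y: "y \<in> carrier V" "y \<ominus>\<^bsub>V\<^esub> x \<in> N" using x mem_coset_iff by blast+
        have "P (y \<ominus>\<^bsub>V\<^esub> x) = \<zero>\<^bsub>V\<^esub>" using y(2) N_iff by blast
        with y(1) have "P y = x" using x C' PC V.diff_zero_iff[of "P y" x] by (simp add: Pdiff proj)
        then show "nrm V x \<le> nrm V y" using contr[OF y(1)] by simp
      qed
    qed
    then show ?thesis by (simp add: nrm_quotient)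
  qed
  have bij: "bij_betw ?\<Phi> (carrier ?W) (carrier Q)"
    unfolding bij_betw_def
  proof
    show "inj_on ?\<Phi> (carrier ?W)"
    proof (rule inj_onI)
      fix x y assume xy: "x \<in> carrier ?W" "y \<in> carrier ?W" "?\<Phi> x = ?\<Phi> y"
      then have "x \<in> C" "y \<in> C" "x \<ominus>\<^bsub>V\<^esub> y \<in> N" using C' by (simp_all add: coset_eq_iff)
      then show "x = y"
        using C' V.diff_zero_iff[of x y] V.subspace_diff[OF C, of x y] proj[of "x \<ominus>\<^bsub>V\<^esub> y"] N_iff
        by simp
    qed
    have "A \<in> ?\<Phi> ` C" if A: "A \<in> carrier Q" for A
    proof -
      obtain x where x: "x \<in> carrier V" "A = ?\<Phi> x" using A by (rule quotientE)
      have "P (x \<ominus>\<^bsub>V\<^esub> P x) = P x \<ominus>\<^bsub>V\<^esub> P (P x)" using x PC C' Pdiff by blast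
      then have "P (x \<ominus>\<^bsub>V\<^esub> P x) = \<zero>\<^bsub>V\<^esub>"
        using x PC C' by (simp add: proj V.minus_eq V.r_neg)
      then have "x \<ominus>\<^bsub>V\<^esub> P x \<in> N" using x PC C' N_iff by simp
      then have "A = ?\<Phi> (P x)" using x PC C' by (simp add: coset_eq_iff)
      then show ?thesis using PC x by blast
    qed
    then show "?\<Phi> ` carrier ?W = carrier Q" using C' by auto
  qed
  show "banach_space Q"
    by (rule banach_space_isometry[OF W Q.complex_module_axioms lin bij iso])
  show "isometrically_isomorphic ?W Q"
    unfolding isometrically_isomorphic_def using lin bij iso by blast
qed

section \<open>\<open>L\<^sup>p\<close> functions\<close>

text \<open>For positive \<open>u\<close> and \<open>v\<close> this is convexity of the power
  function. If one of them vanishes, it reduces to \<open>s powr p \<le> s\<close> for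
  \<open>s\<close> between 0 and 1.\<close>

lemma powr_convex_comb:
  fixes u v t p :: real
  assumes p: "1 \<le> p" and "0 \<le> u" "0 \<le> v" "0 \<le> t" "t \<le> 1"
  shows "(t * u + (1 - t) * v) powr p \<le> t * u powr p + (1 - t) * v powr p"
proof -
  have scale: "(s * w) powr p \<le> s * w powr p" if "0 \<le> s" "s \<le> 1" "0 \<le> w" for s w :: real
  proof -
    have "s powr p \<le> s"
      using that p powr_mono'[of 1 p s] by (cases "s = 0") auto
    then show ?thesis using that by (simp add: powr_mult mult_right_mono)
  qed
  consider "u = 0" | "v = 0" | "u > 0" "v > 0" using assms by linarith
  then show ?thesis
  proof cases
    case 3
    then show ?thesis
      using convex_onD[OF powr_convex[OF p], of "1 - t" u v] assms by (simp add: algebra_simps)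
  qed (use scale[of t u] scale[of "1 - t" v] assms in auto)
qed

section \<open>The \<open>L\<^sup>p\<close> seminorm and Minkowski's inequality\<close>

context
  fixes M :: "'a measure" and p :: real
  assumes p: "1 \<le> p"
begin

private abbreviation "L \<equiv> Lp_functions M p"

lemma Lp_mem_iff:
  "f \<in> carrier L \<longleftrightarrow> f \<in> borel_measurable M \<and> integrable M (\<lambda>x. cmod (f x) powr p)"
  by (simp add: Lp_functions_def)

lemma Lp_measurable [measurable_dest]: "f \<in> carrier L \<Longrightarrow> f \<in> borel_measurable M"
  by (simp add: Lp_mem_iff)

lemma Lp_nrm: "nrm L f = (\<integral>x. cmod (f x) powr p \<partial>M) powr (1 / p)"
  by (simp add: Lp_functions_def)

lemma Lp_ops [simp]: "f \<oplus>\<^bsub>L\<^esub> g = (\<lambda>x. f x + g x)" "c \<odot>\<^bsub>L\<^esub> f = (\<lambda>x. c * f x)" "\<zero>\<^bsub>L\<^esub> = (\<lambda>x. 0)"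
  by (simp_all add: Lp_functions_def)

lemma Lp_nrm_nonneg: "0 \<le> nrm L f"
  by (simp add: Lp_nrm)

lemma Lp_nrm_powr: "nrm L f powr p = (\<integral>x. cmod (f x) powr p \<partial>M)"
  using p by (simp add: Lp_nrm powr_powr)

lemma Lp_nn_integral:
  "f \<in> carrier L \<Longrightarrow> (\<integral>\<^sup>+x. ennreal (cmod (f x) powr p) \<partial>M) = ennreal (nrm L f powr p)"
  by (simp add: Lp_nrm_powr Lp_mem_iff nn_integral_eq_integral)

text \<open>An estimate of the nonnegative integral yields membership and a norm bound together,
  with no integrability known beforehand. Monotonicity, Minkowski's inequality and the Fatou
  argument for completeness all end here.\<close>

lemma Lp_of_nn_integral_le:
  assumes [measurable]: "f \<in> borel_measurable M" and c: "0 \<le> c"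
    and le: "(\<integral>\<^sup>+x. ennreal (cmod (f x) powr p) \<partial>M) \<le> ennreal (c powr p)"
  shows "f \<in> carrier L" "nrm L f \<le> c"
proof -
  show f: "f \<in> carrier L"
    using le by (auto simp: Lp_mem_iff integrable_iff_bounded intro: le_less_trans)
  have "nrm L f powr p \<le> c powr p" using le by (simp add: Lp_nn_integral[OF f])
  then show "nrm L f \<le> c"
    using p c powr_less_mono2[of p c "nrm L f"] by (meson linorder_not_le less_le_trans zero_less_one)
qed

lemma Lp_mono:
  assumes g: "g \<in> carrier L" and f [measurable]: "f \<in> borel_measurable M"
    and le: "AE x in M. cmod (f x) \<le> cmod (g x)"
  shows "f \<in> carrier L" "nrm L f \<le> nrm L g"
proof -
  have "(\<integral>\<^sup>+x. ennreal (cmod (f x) powr p) \<partial>M) \<le> (\<integral>\<^sup>+x. ennreal (cmod (g x) powr p) \<partial>M)"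
    using le p by (intro nn_integral_mono_AE) (auto elim!: eventually_mono intro!: ennreal_leI powr_mono2)
  also have "\<dots> = ennreal (nrm L g powr p)" by (rule Lp_nn_integral[OF g])
  finally show "f \<in> carrier L" "nrm L f \<le> nrm L g"
    using Lp_of_nn_integral_le[OF f Lp_nrm_nonneg] by blast+
qed

lemma Lp_cong_AE:
  assumes "f \<in> carrier L" "g \<in> borel_measurable M" "AE x in M. f x = g x"
  shows "nrm L f = nrm L g"
proof (rule antisym)
  have "AE x in M. cmod (f x) \<le> cmod (g x)" "AE x in M. cmod (g x) \<le> cmod (f x)"
    using assms(3) by (auto elim: eventually_mono)
  then show "nrm L f \<le> nrm L g" "nrm L g \<le> nrm L f"
    using Lp_mono[of f g] Lp_mono[of g f] assms Lp_measurable by blast+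
qed

text \<open>Convexity replaces Hoelder's inequality: \<open>f + g\<close> is \<open>a + b\<close>
  times the convex combination of \<open>f / a\<close> and \<open>g / b\<close> with weight
  \<open>t = a / (a + b)\<close>. Positive upper bounds \<open>a\<close> and \<open>b\<close> stand
  in for the norms themselves, which may vanish; a final \<epsilon> removes the excess.\<close>

lemma Lp_minkowski:
  assumes f: "f \<in> carrier L" and g: "g \<in> carrier L"
  shows "(\<lambda>x. f x + g x) \<in> carrier L" "nrm L (\<lambda>x. f x + g x) \<le> nrm L f + nrm L g"
proof -
  note [measurable] = Lp_measurable[OF f] Lp_measurable[OF g]
  have main: "(\<lambda>x. f x + g x) \<in> carrier L \<and> nrm L (\<lambda>x. f x + g x) \<le> a + b"
    if a: "nrm L f \<le> a" "0 < a" and b: "nrm L g \<le> b" "0 < b" for a b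
  proof -
    define t where "t = a / (a + b)"
    have t: "0 \<le> t" "t \<le> 1" "1 - t = b / (a + b)" using a b by (auto simp: t_def field_simps)
    have pt: "cmod (f x + g x) powr p \<le> (a + b) powr p *
        (t * (cmod (f x) powr p / a powr p) + (1 - t) * (cmod (g x) powr p / b powr p))" for x
    proof -
      have eq: "cmod (f x) + cmod (g x) = (a + b) * (t * (cmod (f x) / a) + (1 - t) * (cmod (g x) / b))"
      proof -
        have "(a + b) * (t * (cmod (f x) / a)) = cmod (f x)" "(a + b) * ((1 - t) * (cmod (g x) / b)) = cmod (g x)"
          unfolding t(3) using a b by (simp_all add: t_def)
        then show ?thesis by (simp only: distrib_left)
      qed
      have "cmod (f x + g x) powr p \<le> (cmod (f x) + cmod (g x)) powr p"
        using p by (intro powr_mono2 norm_triangle_ineq) auto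
      also have "\<dots> = (a + b) powr p * (t * (cmod (f x) / a) + (1 - t) * (cmod (g x) / b)) powr p"
        unfolding eq using a b t by (intro powr_mult)
      also have "\<dots> \<le> (a + b) powr p *
        (t * (cmod (f x) / a) powr p + (1 - t) * (cmod (g x) / b) powr p)"
        using a b t by (intro mult_left_mono powr_convex_comb[OF p]) auto
      finally show ?thesis using a b by (simp add: powr_divide)
    qed
    have "(\<integral>\<^sup>+x. ennreal (cmod (f x + g x) powr p) \<partial>M) \<le> (\<integral>\<^sup>+x. ennreal ((a + b) powr p *
        (t * (cmod (f x) powr p / a powr p) + (1 - t) * (cmod (g x) powr p / b powr p))) \<partial>M)"
      by (intro nn_integral_mono ennreal_leI pt)
    also have "\<dots> = ennreal (\<integral>x. (a + b) powr p *
        (t * (cmod (f x) powr p / a powr p) + (1 - t) * (cmod (g x) powr p / b powr p)) \<partial>M)"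
      using f g t(1,2) by (intro nn_integral_eq_integral) (auto simp: Lp_mem_iff)
    also have "\<dots> \<le> ennreal ((a + b) powr p)"
    proof (rule ennreal_leI)
      have "(\<integral>x. (a + b) powr p *
          (t * (cmod (f x) powr p / a powr p) + (1 - t) * (cmod (g x) powr p / b powr p)) \<partial>M)
          = (a + b) powr p * (t * (nrm L f powr p / a powr p) + (1 - t) * (nrm L g powr p / b powr p))"
        using f g by (simp add: Lp_mem_iff Lp_nrm_powr)
      also have "\<dots> \<le> (a + b) powr p * (t * 1 + (1 - t) * 1)"
        using a b p t(1,2)
        by (intro mult_left_mono add_mono) (auto intro!: powr_mono2 simp: Lp_nrm_nonneg)
      finally show "(\<integral>x. (a + b) powr p *
          (t * (cmod (f x) powr p / a powr p) + (1 - t) * (cmod (g x) powr p / b powr p)) \<partial>M)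
          \<le> (a + b) powr p" by simp
    qed
    finally have "(\<integral>\<^sup>+x. ennreal (cmod (f x + g x) powr p) \<partial>M) \<le> ennreal ((a + b) powr p)" .
    then show ?thesis using Lp_of_nn_integral_le[of "\<lambda>x. f x + g x" "a + b"] a b by simp
  qed
  show "(\<lambda>x. f x + g x) \<in> carrier L"
    using main[of "nrm L f + 1" "nrm L g + 1"] Lp_nrm_nonneg by (simp add: add_nonneg_pos)
  show "nrm L (\<lambda>x. f x + g x) \<le> nrm L f + nrm L g"
  proof (rule field_le_epsilon)
    fix e :: real assume "e > 0"
    then show "nrm L (\<lambda>x. f x + g x) \<le> nrm L f + nrm L g + e"
      using main[of "nrm L f + e / 2" "nrm L g + e / 2"] Lp_nrm_nonneg[of f] Lp_nrm_nonneg[of g] by simp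
  qed
qed

lemma Lp_scalar:
  assumes f: "f \<in> carrier L"
  shows "(\<lambda>x. c * f x) \<in> carrier L" "nrm L (\<lambda>x. c * f x) = cmod c * nrm L f"
proof -
  show "(\<lambda>x. c * f x) \<in> carrier L" using f Lp_measurable[OF f] by (auto simp: Lp_mem_iff norm_mult powr_mult)
  show "nrm L (\<lambda>x. c * f x) = cmod c * nrm L f"
    using p by (simp add: Lp_nrm norm_mult powr_mult powr_powr)
qed

lemma Lp_zero: "(\<lambda>x. 0) \<in> carrier L" "nrm L (\<lambda>x. 0) = 0"
  using p by (simp_all add: Lp_mem_iff Lp_nrm)

lemma Lp_diff:
  assumes "f \<in> carrier L" "g \<in> carrier L"
  shows "(\<lambda>x. f x - g x) \<in> carrier L"
  using Lp_minkowski(1)[OF assms(1) Lp_scalar(1)[OF assms(2), of "- 1"]] by simp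

lemma Lp_sum:
  assumes "finite S" "\<And>s. s \<in> S \<Longrightarrow> f s \<in> carrier L"
  shows "(\<lambda>x. \<Sum>s\<in>S. f s x) \<in> carrier L" "nrm L (\<lambda>x. \<Sum>s\<in>S. f s x) \<le> (\<Sum>s\<in>S. nrm L (f s))"
  using assms
proof (induction S)
  case (insert a S)
  { case 1 then show ?case using insert Lp_minkowski(1)[of "f a" "\<lambda>x. \<Sum>s\<in>S. f s x"] by simp }
  { case 2 then show ?case using insert Lp_minkowski(2)[of "f a" "\<lambda>x. \<Sum>s\<in>S. f s x"] by simp }
qed (auto simp: Lp_zero)

lemma Lp_nrm_eq_0_iff:
  assumes f: "f \<in> carrier L" shows "nrm L f = 0 \<longleftrightarrow> (AE x in M. f x = 0)"
proof -
  have "nrm L f = 0 \<longleftrightarrow> (\<integral>x. cmod (f x) powr p \<partial>M) = 0" by (simp add: Lp_nrm)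
  also have "\<dots> \<longleftrightarrow> (AE x in M. cmod (f x) powr p = 0)"
    using f by (intro integral_nonneg_eq_0_iff_AE) (auto simp: Lp_mem_iff)
  finally show ?thesis by simp
qed

lemma Lp_indicator:
  assumes "A \<in> sets M" "emeasure M A < \<infinity>"
  shows "indicator A \<in> carrier L" "nrm L (indicator A) = measure M A powr (1 / p)"
proof -
  have *: "(\<lambda>x. cmod (indicator A x) powr p) = indicator A"
    using p by (auto simp: indicator_def)
  show "indicator A \<in> carrier L" unfolding Lp_mem_iff * using assms by auto
  show "nrm L (indicator A) = measure M A powr (1 / p)"
    unfolding Lp_nrm * using assms sets.sets_into_space[OF assms(1)] by (simp add: Int_absorb2)
qed

section \<open>Completeness of \<open>L\<^sup>p\<close> (Riesz-Fischer)\<close>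

lemma Lp_fast_cauchy_converges_AE:
  assumes s: "\<And>n::nat. s n \<in> carrier L"
    and fast: "\<And>n. nrm L (\<lambda>x. s (Suc n) x - s n x) \<le> (1/2) ^ n"
  shows "AE x in M. convergent (\<lambda>n. s n x)"
proof -
  note [measurable] = Lp_measurable[OF s]
  \<comment> \<open>The absolute increments are embedded in the complex numbers, because the
    \<open>L\<^sup>p\<close> lemmas are about complex functions.\<close>
  define d where "d n x = complex_of_real (cmod (s (Suc n) x - s n x))" for n x
  define g where "g n x = (\<Sum>k<n. d k x)" for n x
  have dm [measurable]: "d n \<in> borel_measurable M" for n unfolding d_def by measurable
  have d: "d n \<in> carrier L" "nrm L (d n) \<le> (1/2) ^ n" for n
    using Lp_mono[OF Lp_diff[OF s[of "Suc n"] s[of n]] dm[of n]] fast[of n] by (auto simp: d_def)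
  have g: "g n \<in> carrier L" for n unfolding g_def using d by (intro Lp_sum) auto
  have "nrm L (g n) \<le> 2" for n
  proof -
    have "nrm L (g n) \<le> (\<Sum>k<n. nrm L (d k))" unfolding g_def using d by (intro Lp_sum) auto
    also have "\<dots> \<le> (\<Sum>k<n. (1/2) ^ k)" by (intro sum_mono d)
    also have "\<dots> \<le> (\<Sum>k. (1/2::real) ^ k)" by (intro sum_le_suminf) auto
    finally show ?thesis by (simp add: suminf_geometric)
  qed
  then have gn: "(\<integral>\<^sup>+x. ennreal (cmod (g n x) powr p) \<partial>M) \<le> ennreal (2 powr p)" for n
    unfolding Lp_nn_integral[OF g] using p by (intro ennreal_leI powr_mono2 Lp_nrm_nonneg) auto
  have g_eq: "cmod (g n x) = (\<Sum>k<n. cmod (s (Suc k) x - s k x))" for n x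
    by (simp add: g_def d_def flip: of_real_sum) (simp add: sum_nonneg)
  have inc: "incseq (\<lambda>n x. ennreal (cmod (g n x) powr p))"
    using p by (intro monoI le_funI ennreal_leI powr_mono2) (auto simp: g_eq intro!: sum_mono2 sum_nonneg)
  have [measurable]: "g n \<in> borel_measurable M" for n using g Lp_measurable by blast
  \<comment> \<open>The sums \<open>g n\<close> increase in modulus and have norm at most 2, the sum
    of the powers of 1/2. Monotone convergence makes them bounded almost everywhere, so the
    telescoping series of \<open>s\<close> converges absolutely there.\<close>
  have "(\<integral>\<^sup>+x. (SUP n. ennreal (cmod (g n x) powr p)) \<partial>M) = (SUP n. \<integral>\<^sup>+x. ennreal (cmod (g n x) powr p) \<partial>M)"
    by (rule nn_integral_monotone_convergence_SUP[OF inc]) simp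
  also have "\<dots> \<le> ennreal (2 powr p)" using gn by (intro SUP_least)
  also have "\<dots> < \<infinity>" by simp
  finally have "AE x in M. (SUP n. ennreal (cmod (g n x) powr p)) \<noteq> \<infinity>"
    by (intro nn_integral_PInf_AE) auto
  then show ?thesis
  proof eventually_elim
    case (elim x)
    then obtain c where c: "0 \<le> c" "(SUP n. ennreal (cmod (g n x) powr p)) = ennreal c"
      by (cases "SUP n. ennreal (cmod (g n x) powr p)") auto
    have "cmod (g n x) \<le> c powr (1 / p)" for n
    proof -
      have "ennreal (cmod (g n x) powr p) \<le> ennreal c" unfolding c(2)[symmetric] by (rule SUP_upper) simp
      then have "(cmod (g n x) powr p) powr (1 / p) \<le> c powr (1 / p)"
        using p c by (intro powr_mono2) auto
      then show ?thesis using p by (simp add: powr_powr)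
    qed
    then have "summable (\<lambda>k. cmod (s (Suc k) x - s k x))"
      unfolding g_eq by (intro summableI_nonneg_bounded) auto
    then have "summable (\<lambda>k. s (Suc k) x - s k x)" by (rule summable_norm_cancel)
    then have "convergent (\<lambda>n. \<Sum>k<n. s (Suc k) x - s k x)" by (simp add: summable_iff_convergent)
    then have "convergent (\<lambda>n. s n x - s 0 x)" 
      using sum_lessThan_telescope[of "\<lambda>n. s n x"] by simp
    then have "convergent (\<lambda>n. (s n x - s 0 x) + s 0 x)" by (intro convergent_add convergent_const)
    then show "convergent (\<lambda>n. s n x)" by simp
  qed
qed

lemma Lp_complete:
  assumes s: "\<And>n::nat. s n \<in> carrier L"
    and cauchy: "\<And>e. e > 0 \<Longrightarrow> \<exists>N. \<forall>m\<ge>N. \<forall>n\<ge>N. nrm L (\<lambda>x. s m x - s n x) < e"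
  shows "\<exists>l\<in>carrier L. (\<lambda>n. nrm L (\<lambda>x. s n x - l x)) \<longlonglongrightarrow> 0"
proof -
  note [measurable] = Lp_measurable[OF s]
  have "\<forall>k. \<exists>N. \<forall>m\<ge>N. \<forall>n\<ge>N. nrm L (\<lambda>x. s m x - s n x) < (1/2) ^ k" using cauchy by simp
  then obtain N where N: "\<And>k m n. m \<ge> N k \<Longrightarrow> n \<ge> N k \<Longrightarrow> nrm L (\<lambda>x. s m x - s n x) < (1/2) ^ k"
    by metis
  \<comment> \<open>Summing the thresholds makes \<open>r\<close> increasing and at least
    \<open>N k\<close>; the added \<open>k\<close> makes it tend to infinity even if all thresholds
    vanish.\<close>
  define r where "r k = (\<Sum>j\<le>k. N j) + k" for k
  have rN: "r k \<ge> N k" "r (Suc k) \<ge> r k" "r k \<ge> k" for k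
    using member_le_sum[of k "{..k}" N] by (auto simp: r_def)
  define l where "l x = lim (\<lambda>n. s (r n) x)" for x
  have [measurable]: "l \<in> borel_measurable M" unfolding l_def by measurable
  have "AE x in M. convergent (\<lambda>n. s (r n) x)"
  proof (rule Lp_fast_cauchy_converges_AE)
    show "nrm L (\<lambda>x. s (r (Suc n)) x - s (r n) x) \<le> (1/2) ^ n" for n
      using N[of n "r (Suc n)" "r n"] rN[of n] by simp
  qed (rule s)
  then have conv: "AE x in M. (\<lambda>n. s (r n) x) \<longlonglongrightarrow> l x"
    by eventually_elim (simp add: l_def convergent_LIMSEQ_iff)
  \<comment> \<open>Fatou's lemma along the subsequence \<open>r\<close> bounds the distance from
    \<open>s n\<close> to the pointwise limit for every index \<open>n\<close>, not only for those
    in the subsequence. It also gives membership, from which \<open>l\<close> itself is seen to lie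
    in the space.\<close>
  have key: "(\<lambda>x. s n x - l x) \<in> carrier L \<and> nrm L (\<lambda>x. s n x - l x) \<le> e"
    if e: "e > 0" and n: "\<And>m. m \<ge> n \<Longrightarrow> nrm L (\<lambda>x. s n x - s m x) \<le> e" for n e
  proof -
    have "(\<integral>\<^sup>+x. ennreal (cmod (s n x - l x) powr p) \<partial>M) =
        (\<integral>\<^sup>+x. liminf (\<lambda>k. ennreal (cmod (s n x - s (r k) x) powr p)) \<partial>M)"
    proof (rule nn_integral_cong_AE)
      show "AE x in M. ennreal (cmod (s n x - l x) powr p) =
          liminf (\<lambda>k. ennreal (cmod (s n x - s (r k) x) powr p))"
        using conv
      proof eventually_elim
        case (elim x)
        then have "(\<lambda>k. cmod (s n x - s (r k) x) powr p) \<longlonglongrightarrow> cmod (s n x - l x) powr p"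
          using p by (intro tendsto_powr' tendsto_intros) auto
        then have "(\<lambda>k. ennreal (cmod (s n x - s (r k) x) powr p)) \<longlonglongrightarrow> ennreal (cmod (s n x - l x) powr p)"
          by (rule tendsto_ennrealI)
        then show ?case by (intro lim_imp_Liminf[symmetric]) auto
      qed
    qed
    also have "\<dots> \<le> liminf (\<lambda>k. \<integral>\<^sup>+x. ennreal (cmod (s n x - s (r k) x) powr p) \<partial>M)"
      by (rule nn_integral_liminf) simp
    also have "\<dots> \<le> ennreal (e powr p)"
    proof -
      have "\<forall>\<^sub>F k in sequentially. (\<integral>\<^sup>+x. ennreal (cmod (s n x - s (r k) x) powr p) \<partial>M) \<le> ennreal (e powr p)"
        using eventually_ge_at_top[of n]
      proof eventually_elim
        case (elim k)
        then have "n \<le> r k" using rN(3)[of k] by simp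
        then show ?case
          unfolding Lp_nn_integral[OF Lp_diff[OF s s]] using p n
          by (intro ennreal_leI powr_mono2) (auto simp: Lp_nrm_nonneg)
      qed
      then show ?thesis by (intro Liminf_le) auto
    qed
    finally show ?thesis using e Lp_of_nn_integral_le[of "\<lambda>x. s n x - l x" e] by simp
  qed
  obtain N1 where "\<And>m n. m \<ge> N1 \<Longrightarrow> n \<ge> N1 \<Longrightarrow> nrm L (\<lambda>x. s m x - s n x) < 1"
    using cauchy[of 1] by auto
  then have "(\<lambda>x. s N1 x - l x) \<in> carrier L" using key[of 1 N1] by (simp add: less_imp_le)
  from Lp_diff[OF s[of N1] this] have l: "l \<in> carrier L" by simp
  have "(\<lambda>n. nrm L (\<lambda>x. s n x - l x)) \<longlonglongrightarrow> 0"
  proof (rule LIMSEQ_I)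
    fix e :: real assume e: "0 < e"
    then obtain N2 where N2: "\<And>m n. m \<ge> N2 \<Longrightarrow> n \<ge> N2 \<Longrightarrow> nrm L (\<lambda>x. s m x - s n x) < e / 2"
      using cauchy[of "e / 2"] by auto
    have "norm (nrm L (\<lambda>x. s n x - l x) - 0) < e" if "n \<ge> N2" for n
      using key[of "e / 2" n] N2[of n] that e Lp_nrm_nonneg[of "\<lambda>x. s n x - l x"] by (auto simp: less_imp_le)
    then show "\<exists>N. \<forall>n\<ge>N. norm (nrm L (\<lambda>x. s n x - l x) - 0) < e" by blast
  qed
  then show ?thesis using l by blast
qed

section \<open>From approximation of indicators to density in \<open>L\<^sup>p\<close>\<close>

lemma Lp_approx_by_subspace:
  assumes D: "D \<subseteq> carrier L" "(\<lambda>x. 0) \<in> D"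
    and D_add: "\<And>f g. f \<in> D \<Longrightarrow> g \<in> D \<Longrightarrow> (\<lambda>x. f x + g x) \<in> D"
    and D_scalar: "\<And>c f. f \<in> D \<Longrightarrow> (\<lambda>x. c * f x) \<in> D"
    and ind: "\<And>A e. A \<in> sets M \<Longrightarrow> emeasure M A < \<infinity> \<Longrightarrow> e > 0 \<Longrightarrow>
      \<exists>g\<in>D. nrm L (\<lambda>x. indicator A x - g x) < e"
    and f: "f \<in> carrier L" and e: "e > 0"
  shows "\<exists>g\<in>D. nrm L (\<lambda>x. f x - g x) < e"
proof -
  define ap where "ap f \<longleftrightarrow> f \<in> carrier L \<and> (\<forall>e>0. \<exists>g\<in>D. nrm L (\<lambda>x. f x - g x) < e)" for f
  have D': "g \<in> D \<Longrightarrow> g \<in> carrier L" for g using D by auto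
  have ap_add: "ap (\<lambda>x. f x + g x)" if f: "ap f" and g: "ap g" for f g
    unfolding ap_def
  proof (intro conjI allI impI)
    show "(\<lambda>x. f x + g x) \<in> carrier L" using f g Lp_minkowski by (simp add: ap_def)
    fix e :: real assume "e > 0"
    then have "e / 2 > 0" by simp
    then obtain u v where u: "u \<in> D" "nrm L (\<lambda>x. f x - u x) < e / 2"
      and v: "v \<in> D" "nrm L (\<lambda>x. g x - v x) < e / 2" using f g unfolding ap_def by blast
    have "nrm L (\<lambda>x. (f x - u x) + (g x - v x)) < e"
      using u v f g Lp_minkowski(2)[of "\<lambda>x. f x - u x" "\<lambda>x. g x - v x"] Lp_diff D'
      by (fastforce simp: ap_def)
    then have "nrm L (\<lambda>x. f x + g x - (u x + v x)) < e" by (simp add: algebra_simps)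
    then show "\<exists>h\<in>D. nrm L (\<lambda>x. f x + g x - h x) < e" using D_add[OF u(1) v(1)]
      by (intro bexI[of _ "\<lambda>x. u x + v x"])
  qed
  have ap_scalar: "ap (\<lambda>x. c * f x)" if f: "ap f" for c f
    unfolding ap_def
  proof (intro conjI allI impI)
    show "(\<lambda>x. c * f x) \<in> carrier L" using f Lp_scalar by (simp add: ap_def)
    fix e :: real assume "e > 0"
    then have "e / (cmod c + 1) > 0" by (simp add: add_nonneg_pos)
    then obtain u where u: "u \<in> D" "nrm L (\<lambda>x. f x - u x) < e / (cmod c + 1)"
      using f unfolding ap_def by blast
    have "nrm L (\<lambda>x. c * f x - c * u x) = cmod c * nrm L (\<lambda>x. f x - u x)"
      using Lp_scalar(2)[OF Lp_diff, of f u c] f D'[OF u(1)] by (simp add: ap_def algebra_simps)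
    also have "\<dots> \<le> (cmod c + 1) * nrm L (\<lambda>x. f x - u x)"
      by (intro mult_right_mono Lp_nrm_nonneg) auto
    also have "\<dots> < e" using u by (simp add: pos_less_divide_eq add_nonneg_pos mult.commute)
    finally show "\<exists>h\<in>D. nrm L (\<lambda>x. c * f x - h x) < e" using D_scalar[OF u(1)]
      by (intro bexI[of _ "\<lambda>x. c * u x"])
  qed
  have ap_ind: "ap (indicator A)" if "A \<in> sets M" "emeasure M A < \<infinity>" for A
    unfolding ap_def using Lp_indicator(1)[OF that] ind[OF that] by blast
  have ap_sum: "ap (\<lambda>x. \<Sum>s\<in>S. h s x)" if "finite S" "\<And>s. s \<in> S \<Longrightarrow> ap (h s)"
    for S :: "complex set" and h
    using that
  proof (induction S)
    case empty
    show ?case using D(2) Lp_zero unfolding ap_def by (auto intro!: bexI[of _ "\<lambda>x. 0"])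
  qed (simp add: ap_add)
  note fm [measurable] = Lp_measurable[OF f]
  obtain F where F: "\<And>i. simple_function M (F i)" "\<And>x. x \<in> space M \<Longrightarrow> (\<lambda>i. F i x) \<longlonglongrightarrow> f x"
    "\<And>i x. x \<in> space M \<Longrightarrow> cmod (F i x) \<le> 2 * cmod (f x)"
    using borel_measurable_implies_sequence_metric[OF fm, of 0] unfolding dist_norm diff_zero by blast
  have Fm [measurable]: "F i \<in> borel_measurable M" for i
    using F(1) by (rule borel_measurable_simple_function)
  have FL: "F i \<in> carrier L" for i
    by (rule Lp_mono[OF Lp_scalar(1)[OF f, of 2] Fm]) (use F(3) in \<open>auto simp: norm_mult\<close>)
  \<comment> \<open>The factor 3 in the dominating function comes from
    \<open>cmod (F i x) \<le> 2 * cmod (f x)\<close> and the triangle inequality.\<close>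
  have "(\<lambda>i. \<integral>x. cmod (f x - F i x) powr p \<partial>M) \<longlonglongrightarrow> (\<integral>x. 0 \<partial>M)"
  proof (rule integral_dominated_convergence)
    show "integrable M (\<lambda>x. cmod (3 * f x) powr p)" using Lp_scalar(1)[OF f, of 3] by (simp add: Lp_mem_iff)
    show "AE x in M. (\<lambda>i. cmod (f x - F i x) powr p) \<longlonglongrightarrow> 0"
    proof (rule AE_I2)
      fix x assume "x \<in> space M"
      have "(\<lambda>i. cmod (f x - F i x) powr p) \<longlonglongrightarrow> cmod (f x - f x) powr p"
        using p F(2)[OF \<open>x \<in> space M\<close>] by (intro tendsto_powr' tendsto_intros) auto
      then show "(\<lambda>i. cmod (f x - F i x) powr p) \<longlonglongrightarrow> 0" using p by simp
    qed
    show "AE x in M. norm (cmod (f x - F i x) powr p) \<le> cmod (3 * f x) powr p" for i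
    proof (rule AE_I2)
      fix x assume "x \<in> space M"
      then have "cmod (f x - F i x) \<le> cmod (3 * f x)"
        using F(3)[of x i] norm_triangle_ineq4[of "f x" "F i x"] by (simp add: norm_mult)
      then show "norm (cmod (f x - F i x) powr p) \<le> cmod (3 * f x) powr p"
        using p by (simp add: powr_mono2)
    qed
  qed simp_all
  then have "(\<lambda>i. (\<integral>x. cmod (f x - F i x) powr p \<partial>M) powr (1 / p)) \<longlonglongrightarrow> 0 powr (1 / p)"
    using p by (intro tendsto_powr' tendsto_const) (auto intro!: always_eventually)
  then have "(\<lambda>i. nrm L (\<lambda>x. f x - F i x)) \<longlonglongrightarrow> 0" by (simp add: Lp_nrm)
  then have "\<forall>\<^sub>F i in sequentially. nrm L (\<lambda>x. f x - F i x) < e / 2"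
    using e by (intro order_tendstoD(2)) auto
  then obtain i where i: "nrm L (\<lambda>x. f x - F i x) < e / 2" by (auto simp: eventually_sequentially)
  \<comment> \<open>The value 0 is dropped because its level set may have infinite measure.\<close>
  define S where "S = F i ` space M - {0}"
  define h where "h y x = y * indicator (F i -` {y} \<inter> space M) x" for y x
  have S: "finite S" using F(1)[of i] by (simp add: S_def simple_function_def)
  have "ap (h y)" if y: "y \<in> S" for y
  proof -
    have meas: "F i -` {y} \<inter> space M \<in> sets M" by measurable
    \<comment> \<open>Markov's inequality bounds the level set of a nonzero value, so its indicator
      lies in the space even when \<open>M\<close> is not sigma-finite.\<close>
    have "emeasure M (F i -` {y} \<inter> space M) \<le> emeasure M {x\<in>space M. cmod y powr p \<le> cmod (F i x) powr p}"
      by (intro emeasure_mono) auto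
    also have "\<dots> \<le> ennreal (1 / cmod y powr p * (\<integral>x. cmod (F i x) powr p \<partial>M))"
      using y FL[of i] by (intro integral_Markov_inequality) (auto simp: Lp_mem_iff S_def)
    also have "\<dots> < \<infinity>" by simp
    finally show ?thesis using ap_scalar[OF ap_ind[OF meas]] unfolding h_def by simp
  qed
  then have aph: "ap (\<lambda>x. \<Sum>y\<in>S. h y x)" using ap_sum[OF S] by blast
  have eq: "F i x = (\<Sum>y\<in>S. h y x)" if x: "x \<in> space M" for x
  proof -
    have "(\<Sum>y\<in>S. h y x) = (\<Sum>y\<in>S. if y = F i x then F i x else 0)"
      using x by (intro sum.cong) (auto simp: h_def indicator_def)
    also have "\<dots> = F i x" using x S by (auto simp: S_def)
    finally show ?thesis by simp
  qed
  obtain g where g: "g \<in> D" "nrm L (\<lambda>x. (\<Sum>y\<in>S. h y x) - g x) < e / 2"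
    using aph e unfolding ap_def by (meson half_gt_zero)
  have gm [measurable]: "g \<in> borel_measurable M" using g(1) D' Lp_measurable by blast
  have "nrm L (\<lambda>x. F i x - g x) = nrm L (\<lambda>x. (\<Sum>y\<in>S. h y x) - g x)"
    by (rule Lp_cong_AE[OF Lp_diff[OF FL D'[OF g(1)]]])
      (use eq aph gm in \<open>auto simp: ap_def Lp_mem_iff\<close>)
  then have "nrm L (\<lambda>x. F i x - g x) < e / 2" using g by simp
  moreover have "nrm L (\<lambda>x. f x - g x) \<le> nrm L (\<lambda>x. f x - F i x) + nrm L (\<lambda>x. F i x - g x)"
    using Lp_minkowski(2)[OF Lp_diff[OF f FL[of i]] Lp_diff[OF FL[of i] D'[OF g(1)]]] by simp
  ultimately have "nrm L (\<lambda>x. f x - g x) < e" using i by linarith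
  then show ?thesis using g by blast
qed

end

section \<open>Continuous functions of compact support\<close>

text \<open>Vanishing outside some compact set passes to sums, translates and averages more directly
  than compactness of the closed support; in a Hausdorff space the two agree. The codomain is
  general because real bump functions occur next to complex functions.\<close>

definition ccont :: "('g::topological_space \<Rightarrow> 'b::real_normed_vector) \<Rightarrow> bool" where
  "ccont f \<longleftrightarrow> continuous_on UNIV f \<and> (\<exists>K. compact K \<and> (\<forall>x. f x \<noteq> 0 \<longrightarrow> x \<in> K))"

lemma Cc_iff_ccont:
  fixes f :: "'g::t2_space \<Rightarrow> complex"
  shows "f \<in> Cc \<longleftrightarrow> ccont f"
proof
  assume "f \<in> Cc"
  then show "ccont f"
    using closure_subset[of "{x. f x \<noteq> 0}"] by (auto simp: Cc_def ccont_def supp_def)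
next
  assume f: "ccont f"
  then obtain K where K: "compact K" "{x. f x \<noteq> 0} \<subseteq> K" by (auto simp: ccont_def)
  have "supp f \<subseteq> K" unfolding supp_def by (rule closure_minimal[OF K(2) compact_imp_closed[OF K(1)]])
  then have "compact (supp f)"
    using compact_Int_closed[OF K(1), of "supp f"] by (simp add: supp_def Int_absorb1)
  then show "f \<in> Cc" using f by (simp add: Cc_def ccont_def)
qed

lemma ccont_bounded:
  assumes "ccont f" obtains B where "0 \<le> B" "\<And>x. norm (f x) \<le> B"
proof -
  obtain K where K: "compact K" "\<And>x. f x \<noteq> 0 \<Longrightarrow> x \<in> K" and c: "continuous_on UNIV f"
    using assms by (auto simp: ccont_def)
  have "bounded (f ` K)"
    by (intro compact_imp_bounded compact_continuous_image K continuous_on_subset[OF c]) auto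
  then obtain B where B: "B > 0" "\<And>x. x \<in> K \<Longrightarrow> norm (f x) \<le> B" by (auto simp: bounded_pos)
  have "norm (f x) \<le> B" for x using B K(2)[of x] by (cases "f x = 0") auto
  then show thesis using B(1) by (intro that[of B]) auto
qed

definition sumset :: "'g::plus set \<Rightarrow> 'g set \<Rightarrow> 'g set" where
  "sumset A B = (\<lambda>(a, b). a + b) ` (A \<times> B)"

lemma mem_sumset: "a \<in> A \<Longrightarrow> b \<in> B \<Longrightarrow> a + b \<in> sumset A B"
  by (auto simp: sumset_def)

lemma compact_sumset:
  fixes A B :: "'g::topological_monoid_add set"
  assumes "compact A" "compact B" shows "compact (sumset A B)"
  unfolding sumset_def case_prod_unfold
  by (intro compact_continuous_image continuous_intros compact_Times assms)

lemma ccont_translate: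
  fixes f :: "'g::topological_group_add \<Rightarrow> 'b::real_normed_vector"
  assumes "ccont f" shows "ccont (\<lambda>x. f (a + x + b))"
proof -
  obtain K where K: "compact K" "\<And>x. f x \<noteq> 0 \<Longrightarrow> x \<in> K" and c: "continuous_on UNIV f"
    using assms by (auto simp: ccont_def)
  have "compact ((\<lambda>x. - a + x - b) ` K)"
    by (intro compact_continuous_image continuous_intros K)
  moreover have "x \<in> (\<lambda>x. - a + x - b) ` K" if "f (a + x + b) \<noteq> 0" for x
    using K(2)[OF that] by (intro image_eqI[of _ _ "a + x + b"]) (simp_all add: add.assoc)
  moreover have "continuous_on UNIV (\<lambda>x. f (a + x + b))"
    by (intro continuous_on_compose2[OF c] continuous_intros) auto
  ultimately show ?thesis unfolding ccont_def by blast
qed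

text \<open>The premise \<open>lin\<close> says exactly that \<open>h 0 0 = 0\<close>, so the
  combination vanishes outside the union of the two compact sets.\<close>

lemma ccont_combine:
  assumes f: "ccont f" and g: "ccont g" and lin: "\<And>a b. h a b = (0::'c::real_normed_vector) \<or> a \<noteq> 0 \<or> b \<noteq> 0"
    and cont: "continuous_on UNIV (\<lambda>x. h (f x) (g x))"
  shows "ccont (\<lambda>x. h (f x) (g x))"
proof -
  obtain K K' where K: "compact K" "\<And>x. f x \<noteq> 0 \<Longrightarrow> x \<in> K"
    and K': "compact K'" "\<And>x. g x \<noteq> 0 \<Longrightarrow> x \<in> K'"
    using f g by (auto simp: ccont_def)
  have "compact (K \<union> K')" using K K' by blast
  moreover have "x \<in> K \<union> K'" if "h (f x) (g x) \<noteq> 0" for x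
    using lin[of "f x" "g x"] that K(2) K'(2) by blast
  ultimately show ?thesis using cont unfolding ccont_def by blast
qed

lemma ccont_add:
  assumes "ccont f" "ccont g" shows "ccont (\<lambda>x. f x + g x)"
proof (rule ccont_combine[OF assms])
  show "continuous_on UNIV (\<lambda>x. f x + g x)"
    using assms by (intro continuous_intros) (auto simp: ccont_def)
qed auto

lemma ccont_diff:
  assumes "ccont f" "ccont g" shows "ccont (\<lambda>x. f x - g x)"
proof (rule ccont_combine[OF assms])
  show "continuous_on UNIV (\<lambda>x. f x - g x)"
    using assms by (intro continuous_intros) (auto simp: ccont_def)
qed auto

lemma ccont_mult_left:
  fixes f :: "_ \<Rightarrow> 'b::real_normed_algebra"
  assumes "ccont f" shows "ccont (\<lambda>x. c * f x)"
proof (rule ccont_combine[OF assms assms])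
  show "continuous_on UNIV (\<lambda>x. c * f x)"
    using assms by (intro continuous_intros) (auto simp: ccont_def)
qed auto

lemma ccont_zero: "ccont (\<lambda>x. 0)"
  by (auto simp: ccont_def)

lemma ccont_sum:
  assumes "\<And>s. s \<in> S \<Longrightarrow> ccont (f s)" shows "ccont (\<lambda>x. \<Sum>s\<in>S. f s x)"
  using assms by (induction S rule: infinite_finite_induct) (simp_all add: ccont_zero ccont_add)

section \<open>Neighbourhoods of the identity, uniform continuity and bump functions\<close>

lemma open_vimage_uminus:
  fixes U :: "'g::topological_group_add set"
  assumes "open U" shows "open (uminus -` U)"
  by (intro open_vimage assms continuous_intros)

lemma open_translate:
  fixes U :: "'g::topological_group_add set"
  assumes "open U" shows "open {x. a + x \<in> U}" "open {x. x + a \<in> U}" "open {x. - x + a \<in> U}"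
proof -
  have "open ((\<lambda>x. a + x) -` U)" "open ((\<lambda>x. x + a) -` U)" "open ((\<lambda>x. - x + a) -` U)"
    by (intro open_vimage assms continuous_intros)+
  then show "open {x. a + x \<in> U}" "open {x. x + a \<in> U}" "open {x. - x + a \<in> U}"
    by (simp_all add: vimage_def)
qed

text \<open>Compactness of \<open>K\<close> gives one neighbourhood that works for all
  \<open>x\<close> in \<open>K\<close>; outside \<open>K\<close> the only danger is that
  \<open>x + u\<close> falls into \<open>K\<close>.\<close>

lemma ccont_uniform_right:
  fixes f :: "'g::topological_group_add \<Rightarrow> 'b::real_normed_vector"
  assumes "ccont f" "e > 0"
  obtains U where "open U" "0 \<in> U" "\<And>u x. u \<in> U \<Longrightarrow> norm (f (x + u) - f x) \<le> e"
proof -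
  obtain K where K: "compact K" "\<And>x. f x \<noteq> 0 \<Longrightarrow> x \<in> K" and c: "continuous_on UNIV f"
    using assms by (auto simp: ccont_def)
  have "continuous_on (UNIV \<times> K) (\<lambda>(u, x). f (x + u))"
    unfolding case_prod_unfold by (intro continuous_on_compose2[OF c] continuous_intros) auto
  from continuous_on_prod_compactE[OF this K(1) UNIV_I \<open>e > 0\<close>, of 0]
  obtain Y where Y: "0 \<in> Y" "open Y" "\<forall>u\<in>Y. \<forall>x\<in>K. norm (f (x + u) - f x) \<le> e"
    by (auto simp: dist_norm)
  show thesis
  \<comment> \<open>The neighbourhood is made symmetric so that, when only \<open>x + u\<close> is
    known to lie in \<open>K\<close>, the estimate can be read backwards with the shift
    \<open>- u\<close>.\<close>
  proof (rule that[of "Y \<inter> uminus -` Y"])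
    show "open (Y \<inter> uminus -` Y)" "0 \<in> Y \<inter> uminus -` Y" using Y open_vimage_uminus by auto
    fix u x assume u: "u \<in> Y \<inter> uminus -` Y"
    consider "x \<in> K" | "x + u \<in> K" | "x \<notin> K" "x + u \<notin> K" by blast
    then show "norm (f (x + u) - f x) \<le> e"
    proof cases
      case 1 then show ?thesis using u Y by auto
    next
      case 2
      then have "norm (f ((x + u) + (- u)) - f (x + u)) \<le> e" using u Y by blast
      then show ?thesis by (simp add: norm_minus_commute add.assoc)
    next
      case 3
      then have "f x = 0" "f (x + u) = 0" using K(2) by blast+
      then show ?thesis using \<open>e > 0\<close> by simp
    qed
  qed
qed

lemma ccont_compose_uminus:
  fixes f :: "'g::topological_group_add \<Rightarrow> 'b::real_normed_vector"
  assumes "ccont f" shows "ccont (\<lambda>x. f (- x))"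
proof -
  obtain K where K: "compact K" "\<And>x. f x \<noteq> 0 \<Longrightarrow> x \<in> K" and c: "continuous_on UNIV f"
    using assms by (auto simp: ccont_def)
  have "compact (uminus ` K)" by (intro compact_continuous_image continuous_intros K)
  moreover have "x \<in> uminus ` K" if "f (- x) \<noteq> 0" for x
    using K(2)[OF that] by (intro image_eqI[of _ _ "- x"]) simp_all
  moreover have "continuous_on UNIV (\<lambda>x. f (- x))"
    by (intro continuous_on_compose2[OF c] continuous_intros) auto
  ultimately show ?thesis unfolding ccont_def by blast
qed

text \<open>In a noncommutative group left and right uniform continuity are different statements;
  inversion exchanges them. Both occur in the proof that right translation by \<open>H\<close>
  preserves the integral.\<close>

lemma ccont_uniform_left:
  fixes f :: "'g::topological_group_add \<Rightarrow> 'b::real_normed_vector"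
  assumes "ccont f" "e > 0"
  obtains U where "open U" "0 \<in> U" "\<And>u x. u \<in> U \<Longrightarrow> norm (f (u + x) - f x) \<le> e"
proof -
  obtain U where U: "open U" "0 \<in> U" "\<And>u x. u \<in> U \<Longrightarrow> norm (f (- (x + u)) - f (- x)) \<le> e"
    using ccont_uniform_right[OF ccont_compose_uminus[OF assms(1)] assms(2)] by metis
  show thesis
  proof (rule that[of "uminus -` U"])
    show "open (uminus -` U)" "0 \<in> uminus -` U" using U open_vimage_uminus by auto
    fix u x assume "u \<in> uminus -` U"
    then show "norm (f (u + x) - f x) \<le> e"
      using U(3)[of "- u" "- x"] by (simp add: minus_add)
  qed
qed

lemma locally_compactE:
  assumes "locally_compact_space (euclidean :: 'g::topological_space topology)"
  obtains U K where "open U" "compact K" "(x::'g) \<in> U" "U \<subseteq> K"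
  using assms[unfolded locally_compact_space_def, THEN bspec, of x] that by auto

lemma urysohn_ccont:
  fixes K U :: "'g::t2_space set"
  assumes lc: "locally_compact_space (euclidean :: 'g topology)"
    and K: "compact K" and U: "open U" "K \<subseteq> U"
  obtains f :: "'g \<Rightarrow> real" where "ccont f" "\<And>x. 0 \<le> f x" "\<And>x. f x \<le> 1" "\<And>x. x \<in> K \<Longrightarrow> f x = 1"
    "\<And>x. f x \<noteq> 0 \<Longrightarrow> x \<in> U"
proof -
  have "\<forall>x::'g. \<exists>W C. open W \<and> compact C \<and> x \<in> W \<and> W \<subseteq> C" using locally_compactE[OF lc] by metis
  then obtain W C where WC: "\<And>x::'g. open (W x)" "\<And>x. compact (C x)" "\<And>x. x \<in> W x" "\<And>x. W x \<subseteq> C x"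
    by metis
  obtain F where F: "F \<subseteq> K" "finite F" "K \<subseteq> (\<Union>x\<in>F. W x)"
    by (rule compactE_image[OF K, of K W]) (use WC in auto)
  \<comment> \<open>Cutting \<open>U\<close> down to a neighbourhood of \<open>K\<close> that lies
    in a finite union of compact sets forces the Urysohn function to have compact support.\<close>
  define V where "V = U \<inter> (\<Union>x\<in>F. W x)"
  have V: "open V" "K \<subseteq> V" using WC F U by (auto simp: V_def)
  have "Hausdorff_space (euclidean :: 'g topology)"
    unfolding Hausdorff_space_def by (auto simp: disjnt_def) (meson hausdorff)
  then have "completely_regular_space (euclidean :: 'g topology)"
    using lc locally_compact_regular_imp_completely_regular_space by blast
  then obtain f where f: "continuous_map euclidean (top_of_set {0..1::real}) f" "f ` (- V) \<subseteq> {0}" "f ` K \<subseteq> {1}"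
    using Urysohn_completely_regular_compact_closed[of 0 1 "euclidean :: 'g topology" K "- V"] V K
    by (auto simp: disjnt_def)
  have "continuous_on UNIV f" "\<And>x. 0 \<le> f x" "\<And>x. f x \<le> 1"
    using f(1) by (auto simp: continuous_map_in_subtopology)
  moreover have supp: "x \<in> V" if "f x \<noteq> 0" for x using f(2) that by auto
  moreover have "compact (\<Union>x\<in>F. C x)" using F WC by auto
  moreover have "V \<subseteq> (\<Union>x\<in>F. C x)" using WC(4) unfolding V_def by blast
  ultimately have "ccont f" unfolding ccont_def by blast
  show thesis
    by (rule that[of f]) (use \<open>ccont f\<close> \<open>\<And>x. 0 \<le> f x\<close> \<open>\<And>x. f x \<le> 1\<close> f(3) supp in \<open>auto simp: V_def\<close>)
qed

section \<open>Approximation of integrals by Riemann sums\<close>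

text \<open>The nodes \<open>S\<close> and the weights \<open>w\<close> do not depend on the
  parameter \<open>x\<close>, because the oscillation bound \<open>near\<close> is uniform in
  \<open>x\<close>. An integral depending on \<open>x\<close> is thus replaced, uniformly, by one
  finite sum, through which a further integral or norm can be taken. Weights are measures of pieces
  of \<open>C\<close>; total mass 1 therefore gives a convex combination.\<close>

lemma riemann_sum:
  fixes M :: "'a::topological_space measure" and F :: "'x \<Rightarrow> 'a \<Rightarrow> complex"
  assumes C: "compact C" "C \<in> sets M" "emeasure M C < \<infinity>"
    and op: "\<And>U. open U \<Longrightarrow> U \<inter> C \<in> sets M"
    and int: "\<And>x. set_integrable M C (F x)"
    and near: "\<And>a. a \<in> C \<Longrightarrow> \<exists>U. open U \<and> a \<in> U \<and> (\<forall>s\<in>U \<inter> C. \<forall>x. cmod (F x s - F x a) \<le> e)"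
  obtains S and w :: "'a \<Rightarrow> real" where "finite S" "S \<subseteq> C" "\<And>s. 0 \<le> w s" "sum w S = measure M C"
    "\<And>x. cmod ((LINT s:C|M. F x s) - (\<Sum>s\<in>S. of_real (w s) * F x s)) \<le> e * measure M C"
proof -
  obtain N where N: "\<And>a. a \<in> C \<Longrightarrow> open (N a)" "\<And>a. a \<in> C \<Longrightarrow> a \<in> N a"
    "\<And>a s x. a \<in> C \<Longrightarrow> s \<in> N a \<Longrightarrow> s \<in> C \<Longrightarrow> cmod (F x s - F x a) \<le> e"
    using near by (metis IntI)
  obtain S where S: "S \<subseteq> C" "finite S" "C \<subseteq> (\<Union>a\<in>S. N a)"
    by (rule compactE_image[OF C(1), of C N]) (use N in auto)
  have fin: "emeasure M B \<noteq> \<infinity>" if "B \<in> sets M" "B \<subseteq> C" for B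
    using emeasure_mono[OF that(2) C(2)] C(3) by (auto simp: top_unique)
  \<comment> \<open>Generalising from \<open>C\<close> to any measurable \<open>B\<close> covered by
    the chosen neighbourhoods lets the induction split off one neighbourhood at a time, which turns
    the cover into a partition.\<close>
  have gen: "\<exists>w. (\<forall>s. 0 \<le> w s) \<and> sum w S = measure M B \<and>
      (\<forall>x. cmod ((LINT s:B|M. F x s) - (\<Sum>s\<in>S. of_real (w s) * F x s)) \<le> e * measure M B)"
    if "finite S" "S \<subseteq> C" "B \<in> sets M" "B \<subseteq> C" "B \<subseteq> (\<Union>a\<in>S. N a)" for S B
    using that
  proof (induction S arbitrary: B)
    case empty
    then show ?case by (intro exI[of _ "\<lambda>_. 0"]) (simp add: set_lebesgue_integral_def)
  next
    case (insert a S)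
    \<comment> \<open>\<open>B1\<close> is the piece assigned to the node \<open>a\<close>. What
      remains is covered by the other neighbourhoods; since \<open>a\<close> is not in
      \<open>S\<close>, giving it the weight of \<open>B1\<close> leaves their weights
      unchanged.\<close>
    define B1 where "B1 = B \<inter> (N a \<inter> C)"
    define B2 where "B2 = B - B1"
    have B1: "B1 \<in> sets M" "B1 \<subseteq> C" using insert.prems op[OF N(1)] by (auto simp: B1_def)
    have B2: "B2 \<in> sets M" "B2 \<subseteq> C" "B2 \<subseteq> (\<Union>a\<in>S. N a)"
      using insert.prems B1 by (auto simp: B2_def B1_def)
    from insert.IH[OF _ B2] insert.prems obtain w where w: "\<And>s. 0 \<le> w s" "sum w S = measure M B2"
      "\<And>x. cmod ((LINT s:B2|M. F x s) - (\<Sum>s\<in>S. of_real (w s) * F x s)) \<le> e * measure M B2" by auto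
    have BB: "B = B1 \<union> B2" "B1 \<inter> B2 = {}" by (auto simp: B1_def B2_def)
    have mB: "measure M B = measure M B1 + measure M B2"
      unfolding BB(1) using fin[OF B1] fin[OF B2(1,2)] B1 B2 BB(2)
      by (intro measure_Union) auto
    have aC: "a \<in> C" using insert.prems by auto
    have int1: "set_integrable M B1 (F x)" "set_integrable M B2 (F x)" for x
      by (rule set_integrable_subset[OF int]; use B1 B2 in simp)+
    have intc: "set_integrable M B1 (\<lambda>_. c)" for c :: complex
      unfolding set_integrable_def using fin[OF B1] B1 by (simp add: less_top)
    have intr: "set_integrable M B1 (\<lambda>_. c)" for c :: real
      unfolding set_integrable_def using fin[OF B1] B1 by (simp add: less_top)
    have est: "cmod ((LINT s:B1|M. F x s) - of_real (measure M B1) * F x a) \<le> e * measure M B1" for x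
    proof -
      have "(LINT s:B1|M. F x s) - of_real (measure M B1) * F x a = (LINT s:B1|M. F x s - F x a)"
        using set_integral_diff(2)[OF int1(1) intc] set_integral_const[OF B1(1) fin[OF B1], of "F x a"]
        by (simp add: scaleR_conv_of_real)
      also have "cmod \<dots> \<le> (LINT s:B1|M. cmod (F x s - F x a))"
        by (rule set_integral_norm_bound[OF set_integral_diff(1)[OF int1(1) intc]])
      also have "\<dots> \<le> (LINT s:B1|M. e)"
        by (rule set_integral_mono[OF set_integrable_norm[OF set_integral_diff(1)[OF int1(1) intc]] intr])
          (use N(3)[OF aC] in \<open>auto simp: B1_def\<close>)
      also have "\<dots> = e * measure M B1" using set_integral_const[OF B1(1) fin[OF B1], of e] by simp
      finally show ?thesis .
    qed
    let ?w = "w(a := measure M B1)"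
    have sw: "(\<Sum>s\<in>insert a S. of_real (?w s) * F x s) = of_real (measure M B1) * F x a + (\<Sum>s\<in>S. of_real (w s) * F x s)" for x
    proof -
      have "(\<Sum>s\<in>S. of_real (?w s) * F x s) = (\<Sum>s\<in>S. of_real (w s) * F x s)"
        by (rule sum.cong) (use insert.hyps in auto)
      then show ?thesis using insert.hyps by simp
    qed
    have "cmod ((LINT s:B|M. F x s) - (\<Sum>s\<in>insert a S. of_real (?w s) * F x s)) \<le> e * measure M B" for x
    proof -
      have "(LINT s:B|M. F x s) = (LINT s:B1|M. F x s) + (LINT s:B2|M. F x s)"
        unfolding BB(1) by (rule set_integral_Un[OF BB(2) int1])
      then have "(LINT s:B|M. F x s) - (\<Sum>s\<in>insert a S. of_real (?w s) * F x s) =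
          ((LINT s:B1|M. F x s) - of_real (measure M B1) * F x a) +
          ((LINT s:B2|M. F x s) - (\<Sum>s\<in>S. of_real (w s) * F x s))"
        unfolding sw by simp
      also have "cmod \<dots> \<le> e * measure M B1 + e * measure M B2"
        by (intro order_trans[OF norm_triangle_ineq] add_mono est w)
      finally show ?thesis by (simp add: mB distrib_left)
    qed
    moreover have "sum ?w (insert a S) = measure M B"
    proof -
      have "sum ?w S = sum w S" by (rule sum.cong) (use insert.hyps in auto)
      then show ?thesis using insert.hyps w(2) mB by simp
    qed
    moreover have "\<forall>s. 0 \<le> ?w s" using w(1) by simp
    ultimately show ?case by blast
  qed
  from gen[OF S(2,1) C(2) order_refl S(3)] show thesis using that S by blast
qed

section \<open>Haar measures\<close>

locale haar_group =
  fixes \<mu> :: "'g::{topological_group_add, t2_space} measure"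
  assumes lc: "locally_compact_space (euclidean :: 'g topology)"
    and haar: "left_haar_measure_on UNIV \<mu>"
begin

lemma sets_mu [measurable_cong]: "sets \<mu> = sets borel" and space_mu: "space \<mu> = UNIV"
  using haar by (auto simp: left_haar_measure_on_def radon_measure_on_def sets_restrict_space)

lemma emeasure_compact_finite: "compact K \<Longrightarrow> emeasure \<mu> K < \<infinity>"
  using haar by (auto simp: left_haar_measure_on_def radon_measure_on_def)

lemma compact_in_sets: "compact K \<Longrightarrow> K \<in> sets \<mu>"
  by (simp add: sets_mu borel_compact)

lemma emeasure_outer: "A \<in> sets \<mu> \<Longrightarrow> emeasure \<mu> A = (INF U\<in>{U. open U \<and> A \<subseteq> U}. emeasure \<mu> U)"
  using haar by (auto simp: left_haar_measure_on_def radon_measure_on_def)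

lemma emeasure_inner: "open U \<Longrightarrow> emeasure \<mu> U = (SUP K\<in>{K. compact K \<and> K \<subseteq> U}. emeasure \<mu> K)"
  using haar by (auto simp: left_haar_measure_on_def radon_measure_on_def)

lemma emeasure_translate: "A \<in> sets \<mu> \<Longrightarrow> emeasure \<mu> ((+) x ` A) = emeasure \<mu> A"
  using haar by (auto simp: left_haar_measure_on_def)

lemma ccont_measurable:
  fixes f :: "'g \<Rightarrow> 'b::real_normed_vector"
  assumes "ccont f" shows "f \<in> borel_measurable \<mu>"
proof -
  have "f \<in> borel_measurable borel"
    using assms by (intro borel_measurable_continuous_onI) (auto simp: ccont_def)
  then show ?thesis by measurable
qed

lemma ccont_integrable:
  fixes f :: "'g \<Rightarrow> 'b::{banach, second_countable_topology}"
  assumes "ccont f" shows "integrable \<mu> f"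
proof -
  obtain K where K: "compact K" "\<And>x. f x \<noteq> 0 \<Longrightarrow> x \<in> K" using assms by (auto simp: ccont_def)
  obtain B where "\<And>x. norm (f x) \<le> B" using ccont_bounded[OF assms] by blast
  then show ?thesis
    using K by (intro integrableI_bounded_set[of K _ _ B] compact_in_sets emeasure_compact_finite
        ccont_measurable assms) auto
qed

lemma norm_integral_le:
  fixes f :: "'g \<Rightarrow> 'b::{banach, second_countable_topology}"
  assumes f: "ccont f" and K: "compact K" "\<And>x. x \<notin> K \<Longrightarrow> f x = 0" and b: "\<And>x. norm (f x) \<le> b"
  shows "norm (\<integral>x. f x \<partial>\<mu>) \<le> b * measure \<mu> K"
proof -
  have "norm (\<integral>x. f x \<partial>\<mu>) \<le> (\<integral>x. norm (f x) \<partial>\<mu>)" by (rule integral_norm_bound)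
  also have "\<dots> \<le> (\<integral>x. b * indicator K x \<partial>\<mu>)"
  proof (rule integral_mono)
    show "integrable \<mu> (\<lambda>x. b * indicator K x)"
      using emeasure_compact_finite[OF K(1)] compact_in_sets[OF K(1)] by simp
    show "norm (f x) \<le> b * indicator K x" for x
      using K(2)[of x] b[of x] by (simp add: indicator_def)
  qed (intro integrable_norm ccont_integrable f)
  also have "\<dots> = b * measure \<mu> K" using compact_in_sets[OF K(1)] by (simp add: space_mu)
  finally show ?thesis .
qed

lemma distr_translate: "distr \<mu> \<mu> ((+) a) = \<mu>"
proof (rule measure_eqI)
  have m: "(+) a \<in> measurable \<mu> \<mu>"
  proof -
    have "(+) a \<in> measurable borel borel"
      by (intro borel_measurable_continuous_onI continuous_intros)
    then show ?thesis by measurable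
  qed
  fix A assume "A \<in> sets (distr \<mu> \<mu> ((+) a))"
  then have A: "A \<in> sets \<mu>" by simp
  have "(+) a -` A \<inter> space \<mu> = (+) (- a) ` A"
    by (auto simp: space_mu image_iff intro!: bexI[of _ "a + _"] simp flip: add.assoc)
  then show "emeasure (distr \<mu> \<mu> ((+) a)) A = emeasure \<mu> A"
    using m A by (simp add: emeasure_distr emeasure_translate)
qed simp

lemma integral_translate:
  fixes f :: "'g \<Rightarrow> 'b::{banach, second_countable_topology}"
  assumes "ccont f" shows "(\<integral>x. f (a + x) \<partial>\<mu>) = (\<integral>x. f x \<partial>\<mu>)"
proof -
  have "(+) a \<in> measurable borel borel"
    by (intro borel_measurable_continuous_onI continuous_intros)
  then have m: "(+) a \<in> measurable \<mu> \<mu>" by measurable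
  have "(\<integral>x. f x \<partial>\<mu>) = (\<integral>x. f x \<partial>(distr \<mu> \<mu> ((+) a)))" by (simp add: distr_translate)
  also have "\<dots> = (\<integral>x. f (a + x) \<partial>\<mu>)"
    by (rule integral_distr[OF m ccont_measurable[OF assms]])
  finally show ?thesis by simp
qed

text \<open>If a nonempty open set were null, every compact set would be covered by finitely many
  null translates of it, and inner regularity on the whole group would make the measure
  zero.\<close>

lemma emeasure_open_pos:
  assumes U: "open U" "a \<in> U" shows "emeasure \<mu> U > 0"
proof (rule ccontr)
  assume "\<not> ?thesis"
  then have z: "emeasure \<mu> U = 0" by simp
  have Us: "(+) x ` U \<in> null_sets \<mu>" for x
  proof -
    have "(+) x ` U = {y. - x + y \<in> U}"
      by (auto simp: image_iff intro!: bexI[of _ "- x + _"] simp flip: add.assoc)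
    then have "(+) x ` U \<in> sets \<mu>" using open_translate(1)[OF U(1)] by (simp add: sets_mu)
    moreover have "U \<in> sets \<mu>" using U by (simp add: sets_mu)
    ultimately show ?thesis using emeasure_translate z by auto
  qed
  have "emeasure \<mu> K = 0" if K: "compact K" for K
  proof -
    have op: "open ((+) x ` U)" for x
    proof -
      have "(+) x ` U = {y. - x + y \<in> U}"
        by (auto simp: image_iff intro!: bexI[of _ "- x + _"] simp flip: add.assoc)
      then show ?thesis using open_translate(1)[OF U(1)] by simp
    qed
    have "K \<subseteq> (\<Union>x\<in>UNIV. (+) x ` U)"
    proof
      fix y assume "y \<in> K"
      have "y = (y - a) + a" by simp
      then show "y \<in> (\<Union>x\<in>UNIV. (+) x ` U)" using U(2) by blast
    qed
    from compactE_image[OF K op this]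
    obtain F where F: "finite F" "K \<subseteq> (\<Union>x\<in>F. (+) x ` U)" .
    have "(\<Union>x\<in>F. (+) x ` U) \<in> null_sets \<mu>" using F(1) Us by (intro null_sets.finite_UN) auto
    then show ?thesis
      using emeasure_mono[OF F(2)] by (metis null_setsD1 null_setsD2 le_zero_eq)
  qed
  then have "(SUP K\<in>{K. compact K \<and> K \<subseteq> UNIV}. emeasure \<mu> K) \<le> 0" by (intro SUP_least) auto
  then have "emeasure \<mu> UNIV = 0" using emeasure_inner[of UNIV] by simp
  then show False using haar by (simp add: left_haar_measure_on_def)
qed

lemma integral_pos:
  fixes f :: "'g \<Rightarrow> real"
  assumes f: "ccont f" "\<And>x. 0 \<le> f x" and a: "f a > 0"
  shows "(\<integral>x. f x \<partial>\<mu>) > 0"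
proof -
  have "(\<integral>x. f x \<partial>\<mu>) \<noteq> 0"
  proof
    assume "(\<integral>x. f x \<partial>\<mu>) = 0"
    then have "AE x in \<mu>. f x = 0"
      using integral_nonneg_eq_0_iff_AE[OF ccont_integrable[OF f(1)]] f(2) by simp
    moreover have "open {x. f x \<noteq> 0}"
    proof -
      have "open (f -` (- {0}))" using f(1) by (intro open_vimage) (auto simp: ccont_def)
      then show ?thesis by (simp add: vimage_def)
    qed
    ultimately have "emeasure \<mu> {x. f x \<noteq> 0} = 0"
      by (subst (asm) AE_iff_measurable[OF _ refl]) (auto simp: space_mu sets_mu)
    then show False using emeasure_open_pos[OF \<open>open _\<close>, of a] a by simp
  qed
  moreover have "(\<integral>x. f x \<partial>\<mu>) \<ge> 0" using f by simp
  ultimately show ?thesis by simp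
qed

text \<open>Inner regularity is available for open sets only, so \<open>A\<close> is first enclosed
  in an open \<open>U\<close>, and then \<open>U\<close> is approximated by a compact
  \<open>K\<close>, which need not lie in \<open>A\<close>. A bump function that is 1 on
  \<open>K\<close> and vanishes off \<open>U\<close> differs from the indicator of \<open>A\<close>
  only on \<open>U - A\<close> and \<open>U - K\<close>.\<close>

lemma Cc_dense_indicator:
  assumes p: "1 \<le> p" and A: "A \<in> sets \<mu>" "emeasure \<mu> A < \<infinity>" and e: "e > 0"
  shows "\<exists>g\<in>Cc. nrm (Lp_functions \<mu> p) (\<lambda>x. indicator A x - g x) < e"
proof -
  \<comment> \<open>With this \<open>d\<close> each of the two exceptional sets contributes at most
    \<open>e / 3\<close> to the norm, which leaves room for a strict inequality.\<close>
  define d where "d = (e / 3) powr p"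
  have d: "d > 0" "d powr (1 / p) = e / 3" using e p by (auto simp: d_def powr_powr)
  have "emeasure \<mu> A < emeasure \<mu> A + ennreal d" using A d by (simp add: ennreal_add_left_cancel_less less_top)
  then obtain U where U: "open U" "A \<subseteq> U" "emeasure \<mu> U < emeasure \<mu> A + ennreal d"
    using emeasure_outer[OF A(1)] by (auto simp: INF_less_iff)
  have Ufin: "emeasure \<mu> U < \<infinity>" using U(3) A(2) by (auto simp: less_top intro: order.strict_trans)
  have Us: "U \<in> sets \<mu>" using U by (simp add: sets_mu)
  have "\<exists>K. compact K \<and> K \<subseteq> U \<and> emeasure \<mu> U < emeasure \<mu> K + ennreal d"
  proof (rule ccontr)
    assume "\<not> ?thesis"
    then have "(SUP K\<in>{K. compact K \<and> K \<subseteq> U}. emeasure \<mu> K + ennreal d) \<le> emeasure \<mu> U"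
      by (intro SUP_least) (auto simp: not_less)
    also have "(SUP K\<in>{K. compact K \<and> K \<subseteq> U}. emeasure \<mu> K + ennreal d) = emeasure \<mu> U + ennreal d"
      unfolding emeasure_inner[OF U(1)] by (rule ennreal_SUP_add_left) auto
    moreover have "emeasure \<mu> U < emeasure \<mu> U + ennreal d"
      using Ufin d by (simp add: ennreal_add_left_cancel_less less_top)
    ultimately show False by simp
  qed
  then obtain K where K: "compact K" "K \<subseteq> U" "emeasure \<mu> U < emeasure \<mu> K + ennreal d" by blast
  obtain f :: "'g \<Rightarrow> real" where f: "ccont f" "\<And>x. 0 \<le> f x" "\<And>x. f x \<le> 1" "\<And>x. x \<in> K \<Longrightarrow> f x = 1"
    "\<And>x. f x \<noteq> 0 \<Longrightarrow> x \<in> U"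
    using urysohn_ccont[OF lc K(1) U(1) K(2)] by blast
  define g where "g x = complex_of_real (f x)" for x
  have g: "ccont g"
    using f(1) unfolding ccont_def g_def by (auto intro!: continuous_intros)
  have diff: "measure \<mu> (U - B) \<le> d" "U - B \<in> sets \<mu>" "emeasure \<mu> (U - B) < \<infinity>"
    if "B \<in> sets \<mu>" "B \<subseteq> U" "emeasure \<mu> U < emeasure \<mu> B + ennreal d" for B
  proof -
    have Bf: "emeasure \<mu> B < \<infinity>" using emeasure_mono[OF that(2) Us] Ufin by (rule le_less_trans)
    have "emeasure \<mu> (U - B) = emeasure \<mu> U - emeasure \<mu> B"
      using Bf that Us by (intro emeasure_Diff) auto
    also have "\<dots> \<le> ennreal d" using that(3) Ufin by (auto simp: ennreal_minus_le_iff less_imp_le)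
    finally have le: "emeasure \<mu> (U - B) \<le> ennreal d" .
    then show "measure \<mu> (U - B) \<le> d"
      using d(1) unfolding measure_def by (metis enn2real_ennreal enn2real_mono ennreal_less_top less_imp_le)
    show "emeasure \<mu> (U - B) < \<infinity>" using le by (rule le_less_trans) simp
    show "U - B \<in> sets \<mu>" using that Us by auto
  qed
  note dA = diff[OF A(1) U(2,3)] and dK = diff[OF compact_in_sets[OF K(1)] K(2,3)]
  let ?h = "\<lambda>x. indicator (U - A) x + indicator (U - K) x :: complex"
  let ?n = "nrm (Lp_functions \<mu> p)"
  note ind = Lp_indicator[OF p dA(2,3)] Lp_indicator[OF p dK(2,3)]
  have [measurable]: "g \<in> borel_measurable \<mu>" "A \<in> sets \<mu>" using ccont_measurable[OF g] A by auto
  have pt: "cmod (indicator A x - g x) \<le> cmod (?h x)" for x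
  proof -
    have *: "cmod (indicator A x - g x) = \<bar>indicator A x - f x\<bar>"
    proof -
      have "indicator A x - g x = complex_of_real (indicator A x - f x)"
        by (simp add: g_def indicator_def)
      then show ?thesis by (simp only: norm_of_real)
    qed
    have **: "?h x = complex_of_real (indicator (U - A) x + indicator (U - K) x)"
      by (simp add: indicator_def)
    show ?thesis unfolding * ** norm_of_real
      using f(2-5)[of x] U(2) K(2) by (auto simp: indicator_def abs_if)
  qed
  have "?n (\<lambda>x. indicator A x - g x) \<le> ?n ?h"
    by (rule Lp_mono[OF p Lp_minkowski(1)[OF p ind(1) ind(3)]]) (use pt in auto)
  also have "\<dots> \<le> ?n (indicator (U - A)) + ?n (indicator (U - K))"
    by (rule Lp_minkowski(2)[OF p ind(1) ind(3)])
  also have "\<dots> \<le> e / 3 + e / 3"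
    unfolding ind(2) ind(4) d(2)[symmetric] using dA dK p by (intro add_mono powr_mono2) auto
  also have "\<dots> < e" using e by simp
  finally show ?thesis using g Cc_iff_ccont by blast
qed

lemma Lp_ccont:
  assumes p: "1 \<le> p" and f: "ccont f"
  shows "f \<in> carrier (Lp_functions \<mu> p)"
proof -
  obtain K where K: "compact K" "\<And>x. f x \<noteq> 0 \<Longrightarrow> x \<in> K" using f by (auto simp: ccont_def)
  obtain B where B: "0 \<le> B" "\<And>x. norm (f x) \<le> B" using ccont_bounded[OF f] by blast
  have ind: "indicator K \<in> carrier (Lp_functions \<mu> p)"
    using Lp_indicator(1)[OF p compact_in_sets emeasure_compact_finite] K by blast
  show ?thesis
    by (rule Lp_mono(1)[OF p Lp_scalar(1)[OF p ind, of "of_real B"] ccont_measurable[OF f]])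
      (use K B in \<open>auto simp: indicator_def norm_mult\<close>)
qed

lemma Lp_sup_bound:
  assumes p: "1 \<le> p" and f: "ccont f" and K: "compact K" "\<And>x. x \<notin> K \<Longrightarrow> f x = 0"
    and b: "0 \<le> b" "\<And>x. cmod (f x) \<le> b"
  shows "nrm (Lp_functions \<mu> p) f \<le> b * measure \<mu> K powr (1 / p)"
proof -
  note ind = Lp_indicator[OF p compact_in_sets[OF K(1)] emeasure_compact_finite[OF K(1)]]
  have "nrm (Lp_functions \<mu> p) f \<le> nrm (Lp_functions \<mu> p) (\<lambda>x. of_real b * indicator K x)"
    by (rule Lp_mono(2)[OF p Lp_scalar(1)[OF p ind(1)] ccont_measurable[OF f]])
      (use K b in \<open>auto simp: indicator_def norm_mult\<close>)
  also have "\<dots> = b * measure \<mu> K powr (1 / p)"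
    using b by (simp add: Lp_scalar(2)[OF p ind(1)] ind(2))
  finally show ?thesis .
qed

lemma Cc_dense:
  assumes p: "1 \<le> p" and f: "f \<in> carrier (Lp_functions \<mu> p)" and e: "e > 0"
  shows "\<exists>g\<in>Cc. nrm (Lp_functions \<mu> p) (\<lambda>x. f x - g x) < e"
proof (rule Lp_approx_by_subspace[OF p _ _ _ _ _ f e])
  show "Cc \<subseteq> carrier (Lp_functions \<mu> p)" using Lp_ccont[OF p] Cc_iff_ccont by blast
qed (use Cc_dense_indicator[OF p] in \<open>auto simp: Cc_iff_ccont ccont_zero ccont_add ccont_mult_left\<close>)

end

section \<open>A compact subgroup, its probability Haar measure and right translations\<close>

locale haar_pair = haar_group \<mu> for \<mu> :: "'g::{topological_group_add, t2_space} measure" +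
  fixes H :: "'g set" and \<nu> :: "'g measure"
  assumes subgroup: "is_subgroup H" and compact_H: "compact H"
    and haar_H: "left_haar_measure_on H \<nu>" and prob_H: "prob_space \<nu>"
begin

lemma H_zero: "0 \<in> H" and H_add: "x \<in> H \<Longrightarrow> y \<in> H \<Longrightarrow> x + y \<in> H" and H_uminus: "x \<in> H \<Longrightarrow> - x \<in> H"
  using subgroup by (auto simp: is_subgroup_def)

lemma space_nu: "space \<nu> = H" and sets_nu [measurable_cong]: "sets \<nu> = sets (restrict_space borel H)"
  using haar_H by (auto simp: left_haar_measure_on_def radon_measure_on_def)

sublocale \<nu>: prob_space \<nu> by (rule prob_H)

lemma measurable_nu:
  fixes f :: "'g \<Rightarrow> 'b::topological_space"
  assumes "continuous_on H f" shows "f \<in> borel_measurable \<nu>"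
  using borel_measurable_continuous_on_restrict[OF assms]
  by (simp add: measurable_cong_sets[OF sets_nu refl])

lemma integrable_nu:
  fixes f :: "'g \<Rightarrow> 'b::{banach, second_countable_topology}"
  assumes "continuous_on H f" shows "integrable \<nu> f"
proof -
  have "bounded (f ` H)" by (intro compact_imp_bounded compact_continuous_image assms compact_H)
  then obtain B where "\<And>x. x \<in> H \<Longrightarrow> norm (f x) \<le> B" by (auto simp: bounded_iff)
  then show ?thesis
    by (intro \<nu>.integrable_const_bound[of _ B] measurable_nu assms AE_I2) (simp add: space_nu)
qed

lemma integral_nu_translate:
  fixes f :: "'g \<Rightarrow> 'b::{banach, second_countable_topology}"
  assumes h: "h \<in> H" and f: "continuous_on H f"
  shows "(\<integral>s. f (h + s) \<partial>\<nu>) = (\<integral>s. f s \<partial>\<nu>)"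
proof -
  have "(+) h \<in> measurable (restrict_space borel H) (restrict_space borel H)"
    using H_add[OF h]
    by (intro measurable_restrict_space3 borel_measurable_continuous_onI continuous_intros) auto
  then have m: "(+) h \<in> measurable \<nu> \<nu>" by (simp add: measurable_cong_sets[OF sets_nu sets_nu])
  have "distr \<nu> \<nu> ((+) h) = \<nu>"
  proof (rule measure_eqI)
    fix A assume "A \<in> sets (distr \<nu> \<nu> ((+) h))"
    then have A: "A \<in> sets \<nu>" by simp
    then have AH: "A \<subseteq> H" using sets.sets_into_space space_nu by blast
    have "(+) h -` A \<inter> space \<nu> = (+) (- h) ` A"
    proof (intro Set.set_eqI iffI)
      fix x assume "x \<in> (+) h -` A \<inter> space \<nu>"
      then have "h + x \<in> A" by simp
      then show "x \<in> (+) (- h) ` A" by (intro image_eqI[of _ _ "h + x"]) (simp_all flip: add.assoc)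
    next
      fix x assume "x \<in> (+) (- h) ` A"
      then obtain y where "y \<in> A" "x = - h + y" by blast
      then show "x \<in> (+) h -` A \<inter> space \<nu>"
        using AH H_add[OF H_uminus[OF h], of y] by (auto simp: space_nu simp flip: add.assoc)
    qed
    moreover have "emeasure \<nu> ((+) (- h) ` A) = emeasure \<nu> A"
      using haar_H H_uminus[OF h] A by (simp add: left_haar_measure_on_def)
    ultimately show "emeasure (distr \<nu> \<nu> ((+) h)) A = emeasure \<nu> A"
      using m A by (simp add: emeasure_distr)
  qed simp
  then have "(\<integral>s. f s \<partial>\<nu>) = (\<integral>s. f s \<partial>(distr \<nu> \<nu> ((+) h)))" by simp
  also have "\<dots> = (\<integral>s. f (h + s) \<partial>\<nu>)" by (rule integral_distr[OF m measurable_nu[OF f]])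
  finally show ?thesis by simp
qed

text \<open>By compactness of \<open>H\<close> the integrand varies with \<open>x\<close> uniformly
  over \<open>s\<close>. Dominated convergence would give only sequential continuity, which is too
  weak in a general topological group.\<close>

lemma continuous_on_integral_nu:
  fixes F :: "'g \<times> 'g \<Rightarrow> 'b::{banach, second_countable_topology}"
  assumes F: "continuous_on (UNIV \<times> H) F"
  shows "continuous_on UNIV (\<lambda>x. \<integral>s. F (x, s) \<partial>\<nu>)"
  unfolding continuous_on_def
proof (intro ballI tendstoI)
  fix x and e :: real assume e: "e > 0"
  then have "e / 2 > 0" by simp
  from continuous_on_prod_compactE[OF F compact_H UNIV_I this, of x]
  obtain Y where Y: "x \<in> Y" "open Y" "\<forall>y\<in>Y. \<forall>s\<in>H. dist (F (y, s)) (F (x, s)) \<le> e / 2" by auto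
  have int: "integrable \<nu> (\<lambda>s. F (y, s))" for y
    by (intro integrable_nu continuous_on_compose2[OF F] continuous_intros) auto
  have "dist (\<integral>s. F (y, s) \<partial>\<nu>) (\<integral>s. F (x, s) \<partial>\<nu>) < e" if y: "y \<in> Y" for y
  proof -
    have "dist (\<integral>s. F (y, s) \<partial>\<nu>) (\<integral>s. F (x, s) \<partial>\<nu>) = norm (\<integral>s. F (y, s) - F (x, s) \<partial>\<nu>)"
      using int by (simp add: dist_norm)
    also have "\<dots> \<le> (\<integral>s. norm (F (y, s) - F (x, s)) \<partial>\<nu>)" by (rule integral_norm_bound)
    also have "\<dots> \<le> (\<integral>s. e / 2 \<partial>\<nu>)"
      using Y(3) y int
      by (intro integral_mono_AE integrable_norm Bochner_Integration.integrable_diff AE_I2)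
        (auto simp: space_nu dist_norm)
    also have "\<dots> = e / 2" by (simp add: \<nu>.prob_space)
    finally show ?thesis using e by simp
  qed
  then show "\<forall>\<^sub>F y in at x within UNIV. dist (\<integral>s. F (y, s) \<partial>\<nu>) (\<integral>s. F (x, s) \<partial>\<nu>) < e"
    unfolding eventually_at_topological using Y by blast
qed

text \<open>A conjugation-invariant bump function has the same integral as its right translates
  by \<^term>\<open>H\<close>, since these are also left translates.\<close>

lemma conjugation_invariant_bump:
  assumes V: "open V" "0 \<in> V"
  obtains \<phi> :: "'g \<Rightarrow> real" where "ccont \<phi>" "\<And>x. 0 \<le> \<phi> x" "\<phi> 0 > 0" "\<And>x. \<phi> x \<noteq> 0 \<Longrightarrow> x \<in> V"
    "\<And>x. \<phi> (- x) = \<phi> x" "\<And>h x. h \<in> H \<Longrightarrow> \<phi> (h + x) = \<phi> (x + h)"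
proof -
  obtain U K where UK: "open U" "compact K" "(0::'g) \<in> U" "U \<subseteq> K" using locally_compactE[OF lc] by blast
  \<comment> \<open>Symmetry of \<open>V'\<close> places the reflected half of the bump in it as
    well; the inclusion in \<open>K\<close> yields compact support.\<close>
  define V' where "V' = (V \<inter> uminus -` V) \<inter> (U \<inter> uminus -` U)"
  have V': "open V'" "0 \<in> V'" "V' \<subseteq> V" "V' \<subseteq> K" "\<And>x. - x \<in> V' \<longleftrightarrow> x \<in> V'"
    using V UK open_vimage_uminus by (auto simp: V'_def)
  have op: "open ((\<lambda>(v, s). s + v - s) -` V')"
    unfolding case_prod_unfold by (intro open_vimage V' continuous_intros)
  have "{0} \<times> H \<subseteq> (\<lambda>(v, s). s + v - s) -` V'" using V'(2) by auto
  \<comment> \<open>By compactness of \<open>H\<close> a single neighbourhood of 0 has all its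
    conjugates by elements of \<open>H\<close> inside \<open>V'\<close>.\<close>
  from Elementary_Topology.tube_lemma[OF compact_H op this]
  obtain U' where U': "0 \<in> U'" "open U'" "U' \<times> H \<subseteq> (\<lambda>(v, s). s + v - s) -` V'" by blast
  have "{0} \<subseteq> U'" using U' by simp
  from urysohn_ccont[OF lc compact_sing U'(2) this]
  obtain f :: "'g \<Rightarrow> real" where f: "ccont f" "\<And>x. 0 \<le> f x" "\<And>x. f x \<le> 1" "\<And>x. x \<in> {0} \<Longrightarrow> f x = 1"
    "\<And>x. f x \<noteq> 0 \<Longrightarrow> x \<in> U'" by blast
  have fc: "continuous_on UNIV f" using f by (simp add: ccont_def)
  \<comment> \<open>Averaging over conjugations creates the invariance: the substitution of
    \<open>h + s\<close> for \<open>s\<close> turns \<open>g (h + x)\<close> into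
    \<open>g (x + h)\<close>, using left invariance of \<nu> only.\<close>
  define g where "g x = (\<integral>s. f (- s + x + s) \<partial>\<nu>)" for x
  have cont: "continuous_on H (\<lambda>s. f (- s + x + s))" for x
    by (intro continuous_on_compose2[OF fc] continuous_intros) auto
  have gc: "continuous_on UNIV g"
  proof -
    have "continuous_on (UNIV \<times> H) (\<lambda>z. f (- snd z + fst z + snd z))"
      by (intro continuous_on_compose2[OF fc] continuous_intros) auto
    from continuous_on_integral_nu[OF this] show ?thesis by (simp add: g_def)
  qed
  have g0: "g 0 = 1" by (simp add: g_def f \<nu>.prob_space)
  have gnn: "0 \<le> g x" for x unfolding g_def using f(2) by simp
  have gV: "x \<in> V'" if "g x \<noteq> 0" for x
  proof -
    have "\<exists>s\<in>H. f (- s + x + s) \<noteq> 0"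
    proof (rule ccontr)
      assume "\<not> ?thesis"
      then have "g x = (\<integral>s. 0 \<partial>\<nu>)" unfolding g_def by (intro Bochner_Integration.integral_cong) (auto simp: space_nu)
      then show False using that by simp
    qed
    then obtain s where s: "s \<in> H" "- s + x + s \<in> U'" using f(5) by blast
    then have "s + (- s + x + s) - s \<in> V'" using U'(3) by auto
    moreover have "s + (- s + x + s) - s = x" by (simp add: add.assoc flip: add_diff_eq)
    ultimately show ?thesis by simp
  qed
  have gconj: "g (h + x) = g (x + h)" if h: "h \<in> H" for h x
  proof -
    have "g (h + x) = (\<integral>s. f (- (h + s) + (h + x) + (h + s)) \<partial>\<nu>)"
      unfolding g_def by (rule integral_nu_translate[OF h cont, symmetric])
    also have "\<dots> = g (x + h)"
      unfolding g_def by (simp only: minus_add add.assoc minus_add_cancel)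
    finally show ?thesis .
  qed
  show thesis
  \<comment> \<open>Adding the reflection makes the bump even and keeps the invariance. Evenness
    removes the inverse that appears when a convolution with the bump is rewritten by left
    translation.\<close>
  proof (rule that[of "\<lambda>x. g x + g (- x)"])
    have "ccont g" unfolding ccont_def using gc gV V'(4) UK(2) by blast
    then show "ccont (\<lambda>x. g x + g (- x))" by (intro ccont_add ccont_compose_uminus)
    show "0 \<le> g x + g (- x)" for x using gnn by simp
    show "g 0 + g (- 0) > 0" by (simp add: g0)
    show "x \<in> V" if "g x + g (- x) \<noteq> 0" for x
      using that gV[of x] gV[of "- x"] V'(3,5) by (cases "g x = 0") auto
    show "g (- x) + g (- (- x)) = g x + g (- x)" for x by simp
    show "g (h + x) + g (- (h + x)) = g (x + h) + g (- (x + h))" if "h \<in> H" for h x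
      using gconj[OF that, of x] gconj[OF H_uminus[OF that], of "- x"] by (simp add: minus_add)
  qed
qed

text \<open>Convolution with a narrow bump \<phi> of integral \<open>c\<close> approximates
  \<open>c * g\<close>, and a Riemann sum turns the convolution into a combination of left
  translates of \<phi>. For these, the integrals before and after right translation by
  \<open>h\<close> coincide. The uniform error is supported in a fixed compact set, so both of its
  integrals are small.\<close>

lemma integral_right_translate:
  fixes g :: "'g \<Rightarrow> complex"
  assumes g: "ccont g" and h: "h \<in> H"
  shows "(\<integral>x. g (x + h) \<partial>\<mu>) = (\<integral>x. g x \<partial>\<mu>)"
proof -
  obtain K where K: "compact K" "\<And>x. g x \<noteq> 0 \<Longrightarrow> x \<in> K" using g by (auto simp: ccont_def)
  obtain Mg where Mg: "0 \<le> Mg" "\<And>x. cmod (g x) \<le> Mg" using ccont_bounded[OF g] by blast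
  \<comment> \<open>The compact neighbourhood \<open>K1\<close> is fixed before \<open>e\<close>: it
    confines all later bumps, so the error sets \<open>C\<close> and \<open>C'\<close> and the
    constant \<open>B\<close> are independent of \<open>e\<close>.\<close>
  obtain U1 K1 where K1: "open U1" "compact K1" "(0::'g) \<in> U1" "U1 \<subseteq> K1" using locally_compactE[OF lc] by blast
  define C where "C = sumset K K1"
  have C: "compact C" unfolding C_def by (intro compact_sumset K K1)
  define C' where "C' = (\<lambda>z. z + - h) ` C"
  have C': "compact C'" unfolding C'_def by (intro compact_continuous_image continuous_intros C)
  define B where "B = (1 + measure \<mu> K) * (measure \<mu> C + measure \<mu> C')"
  have bound: "cmod ((\<integral>x. g (x + h) \<partial>\<mu>) - (\<integral>x. g x \<partial>\<mu>)) \<le> e * B" if e: "e > 0" for e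
  proof -
    obtain U where U: "open U" "0 \<in> U" "\<And>u x. u \<in> U \<Longrightarrow> cmod (g (x + u) - g x) \<le> e"
      using ccont_uniform_right[OF g e] by metis
    have "open (U \<inter> U1)" "0 \<in> U \<inter> U1" using U K1 by auto
    then obtain \<phi> :: "'g \<Rightarrow> real" where \<phi>: "ccont \<phi>" "\<And>x. 0 \<le> \<phi> x" "\<phi> 0 > 0"
      "\<And>x. \<phi> x \<noteq> 0 \<Longrightarrow> x \<in> U \<inter> U1" "\<And>x. \<phi> (- x) = \<phi> x" "\<And>h x. h \<in> H \<Longrightarrow> \<phi> (h + x) = \<phi> (x + h)"
      using conjugation_invariant_bump by metis
    obtain Mp where Mp: "0 \<le> Mp" "\<And>x. norm (\<phi> x) \<le> Mp" using ccont_bounded[OF \<phi>(1)] by blast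
    define c where "c = (\<integral>x. \<phi> x \<partial>\<mu>)"
    have c: "c > 0" unfolding c_def by (rule integral_pos[OF \<phi>(1-3)])
    define F where "F y x = g x * of_real (\<phi> (- x + y))" for y x
    have \<phi>c: "continuous_on UNIV \<phi>" and gc: "continuous_on UNIV g" using \<phi>(1) g by (auto simp: ccont_def)
    have Fcc: "ccont (F y)" for y
      unfolding ccont_def
    proof (intro conjI exI[of _ K] K allI impI)
      show "continuous_on UNIV (F y)"
        unfolding F_def by (intro continuous_intros gc continuous_on_compose2[OF \<phi>c]) auto
    qed (use K in \<open>auto simp: F_def\<close>)
    \<comment> \<open>Changing the node moves \<open>g\<close> and \<phi> by at most
      \<open>e1\<close> each, hence the product by at most \<open>(Mg + Mp) * e1\<close>. The
      tolerance is proportional to \<open>c\<close> because \<open>c\<close> is divided out at the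
      end; the 1 avoids a zero denominator.\<close>
    define e1 where "e1 = e * c / (Mg + Mp + 1)"
    have e1: "e1 > 0" "(Mg + Mp) * e1 \<le> e * c"
    proof -
      show "e1 > 0" using e c Mg Mp by (simp add: e1_def)
      have "(Mg + Mp) * e1 \<le> (Mg + Mp + 1) * e1" using \<open>e1 > 0\<close> by (intro mult_right_mono) auto
      then show "(Mg + Mp) * e1 \<le> e * c" using Mg Mp by (simp add: e1_def)
    qed
    obtain W where W: "open W" "0 \<in> W" "\<And>u x. u \<in> W \<Longrightarrow> norm (\<phi> (u + x) - \<phi> x) \<le> e1"
      using ccont_uniform_left[OF \<phi>(1) e1(1)] by metis
    have near: "\<exists>U. open U \<and> a \<in> U \<and> (\<forall>x\<in>U \<inter> K. \<forall>y. cmod (F y x - F y a) \<le> e * c)" for a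
    proof (intro exI conjI ballI allI)
      show "open ({x. - x + a \<in> W} \<inter> (g -` ball (g a) e1))"
        by (intro open_Int open_translate W open_vimage gc open_ball)
      show "a \<in> {x. - x + a \<in> W} \<inter> (g -` ball (g a) e1)" using W e1 by simp
      fix x y assume "x \<in> ({x. - x + a \<in> W} \<inter> (g -` ball (g a) e1)) \<inter> K"
      then have x: "- x + a \<in> W" "cmod (g x - g a) \<le> e1" by (auto simp: dist_norm norm_minus_commute)
      have "- x + y = (- x + a) + (- a + y)" by (simp add: add.assoc)
      then have p: "norm (\<phi> (- x + y) - \<phi> (- a + y)) \<le> e1" using W(3)[OF x(1), of "- a + y"] by simp
      have "F y x - F y a = g x * of_real (\<phi> (- x + y) - \<phi> (- a + y)) + (g x - g a) * of_real (\<phi> (- a + y))"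
        by (simp add: F_def algebra_simps)
      also have "cmod \<dots> \<le> Mg * e1 + e1 * Mp"
        using Mg Mp x p e1
        by (intro order_trans[OF norm_triangle_ineq] add_mono) (auto simp only: norm_mult norm_of_real real_norm_def intro!: mult_mono)
      also have "\<dots> \<le> e * c" using e1(2) by (simp add: algebra_simps)
      finally show "cmod (F y x - F y a) \<le> e * c" .
    qed
    have Ksets: "K \<in> sets \<mu>" by (rule compact_in_sets[OF K(1)])
    obtain S w where S: "finite S" "S \<subseteq> K" "\<And>y. cmod ((LINT x:K|\<mu>. F y x) - (\<Sum>x\<in>S. of_real (w x) * F y x)) \<le> e * c * measure \<mu> K"
    proof (rule riemann_sum[OF K(1) Ksets emeasure_compact_finite[OF K(1)], of F "e * c"])
      show "U \<inter> K \<in> sets \<mu>" if "open U" for U using that Ksets by (auto simp: sets_mu)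
      show "set_integrable \<mu> K (F y)" for y
        unfolding set_integrable_def by (rule integrable_mult_indicator[OF Ksets ccont_integrable[OF Fcc]])
    qed (use near in blast)+
    \<comment> \<open>Left translation by \<open>y\<close> and evenness of \<phi> exhibit the
      convolution as an average of values of \<open>g\<close> near \<open>y\<close>; this is what
      makes it close to \<open>c * g y\<close>.\<close>
    have LF: "(LINT x:K|\<mu>. F y x) = (\<integral>x. g (y + x) * of_real (\<phi> x) \<partial>\<mu>)" for y
    proof -
      have "(LINT x:K|\<mu>. F y x) = (\<integral>x. F y x \<partial>\<mu>)"
        unfolding set_lebesgue_integral_def
        by (intro Bochner_Integration.integral_cong) (use K in \<open>auto simp: indicator_def F_def\<close>)
      also have "\<dots> = (\<integral>x. F y (y + x) \<partial>\<mu>)" by (rule integral_translate[OF Fcc, symmetric])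
      also have "\<dots> = (\<integral>x. g (y + x) * of_real (\<phi> x) \<partial>\<mu>)"
        by (simp only: F_def minus_add add.assoc left_minus add_0_right \<phi>(5))
      finally show ?thesis .
    qed
    have \<phi>C: "ccont (\<lambda>x. complex_of_real (\<phi> x))"
      using \<phi>(1) unfolding ccont_def by (auto intro!: continuous_intros)
    have Lg: "cmod (of_real c * g y - (LINT x:K|\<mu>. F y x)) \<le> e * c" for y
    proof -
      have gp: "ccont (\<lambda>x. g (y + x) * of_real (\<phi> x))"
      proof (rule ccont_combine[OF \<phi>(1) ccont_translate[OF g, of y 0], of "\<lambda>a b. b * of_real a", simplified])
        show "continuous_on UNIV (\<lambda>x. g (y + x) * complex_of_real (\<phi> x))"
          by (intro continuous_intros \<phi>c continuous_on_compose2[OF gc]) auto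
      qed
      have "of_real c * g y = (\<integral>x. g y * of_real (\<phi> x) \<partial>\<mu>)" by (simp add: c_def)
      then have "of_real c * g y - (LINT x:K|\<mu>. F y x) = (\<integral>x. g y * of_real (\<phi> x) - g (y + x) * of_real (\<phi> x) \<partial>\<mu>)"
        unfolding LF using ccont_integrable[OF gp] ccont_integrable[OF ccont_mult_left[OF \<phi>C]] by simp
      also have "cmod \<dots> \<le> (\<integral>x. cmod (g y * of_real (\<phi> x) - g (y + x) * of_real (\<phi> x)) \<partial>\<mu>)"
        by (rule integral_norm_bound)
      also have "\<dots> \<le> (\<integral>x. e * \<phi> x \<partial>\<mu>)"
      proof (rule integral_mono)
        show "integrable \<mu> (\<lambda>x. cmod (g y * of_real (\<phi> x) - g (y + x) * of_real (\<phi> x)))"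
          by (intro integrable_norm ccont_integrable ccont_diff gp ccont_mult_left \<phi>C)
        show "integrable \<mu> (\<lambda>x. e * \<phi> x)" using ccont_integrable[OF \<phi>(1)] by simp
        fix x
        have "cmod (g y * of_real (\<phi> x) - g (y + x) * of_real (\<phi> x)) = cmod (g (y + x) - g y) * \<phi> x"
          using \<phi>(2)[of x] by (simp add: norm_mult norm_minus_commute flip: left_diff_distrib)
        also have "\<dots> \<le> e * \<phi> x"
          using U(3)[of x y] \<phi>(2)[of x] \<phi>(4)[of x] by (cases "\<phi> x = 0") (auto intro!: mult_right_mono)
        finally show "cmod (g y * of_real (\<phi> x) - g (y + x) * of_real (\<phi> x)) \<le> e * \<phi> x" .
      qed
      finally show ?thesis by (simp add: c_def)
    qed
    \<comment> \<open>\<open>D\<close> is the total error: the convolution error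
      \<open>e * c\<close> plus the Riemann error \<open>e * c * measure \<mu> K\<close>, both
      uniform in \<open>y\<close>.\<close>
    define D where "D y = of_real c * g y - (\<Sum>x\<in>S. (of_real (w x) * g x) * of_real (\<phi> (- x + y)))" for y
    have Db: "cmod (D y) \<le> e * c * (1 + measure \<mu> K)" for y
    proof -
      have "D y = (of_real c * g y - (LINT x:K|\<mu>. F y x)) + ((LINT x:K|\<mu>. F y x) - (\<Sum>x\<in>S. of_real (w x) * F y x))"
        by (simp add: D_def F_def mult.assoc)
      also have "cmod \<dots> \<le> e * c + e * c * measure \<mu> K"
        by (intro order_trans[OF norm_triangle_ineq] add_mono Lg S)
      finally show ?thesis by (simp add: algebra_simps)
    qed
    have tr: "ccont (\<lambda>y. complex_of_real (\<phi> (- x + y)))" "ccont (\<lambda>y. complex_of_real (\<phi> (- x + y + h)))" for x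
      using ccont_translate[OF \<phi>C, of "- x" 0] ccont_translate[OF \<phi>C, of "- x" h] by simp_all
    have gh: "ccont (\<lambda>y. g (y + h))" using ccont_translate[OF g, of 0 h] by simp
    have Dcc: "ccont D"
      unfolding D_def by (intro ccont_diff ccont_mult_left g ccont_sum tr)
    have Dh: "ccont (\<lambda>y. D (y + h))" using ccont_translate[OF Dcc, of 0 h] by simp
    have D0: "D y = 0" if "y \<notin> C" for y
    proof -
      have "g y = 0" using mem_sumset[of y K 0 K1] K(2)[of y] K1 that by (auto simp: C_def)
      moreover have "\<phi> (- x + y) = 0" if "x \<in> S" for x
      proof (rule ccontr)
        assume "\<phi> (- x + y) \<noteq> 0"
        then have "x + (- x + y) \<in> C" unfolding C_def using \<phi>(4) K1(4) S(2) that by (intro mem_sumset) auto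
        then show False using \<open>y \<notin> C\<close> by (simp flip: add.assoc)
      qed
      ultimately show ?thesis by (simp add: D_def)
    qed
    have b1: "cmod (\<integral>y. D y \<partial>\<mu>) \<le> e * c * (1 + measure \<mu> K) * measure \<mu> C"
      by (rule norm_integral_le[OF Dcc C D0 Db])
    have b2: "cmod (\<integral>y. D (y + h) \<partial>\<mu>) \<le> e * c * (1 + measure \<mu> K) * measure \<mu> C'"
    proof (rule norm_integral_le[OF Dh C' _ Db])
      fix y assume "y \<notin> C'"
      moreover have "(y + h) + - h = y" by (simp add: add.assoc)
      ultimately have "y + h \<notin> C" unfolding C'_def by (metis imageI)
      then show "D (y + h) = 0" by (rule D0)
    qed
    have cI: "(\<integral>y. complex_of_real (\<phi> (- x + y)) \<partial>\<mu>) = of_real c" for x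
      using integral_translate[OF \<phi>C, of "- x"] by (simp add: c_def)
    \<comment> \<open>Here the conjugation invariance is used: once the shift by \<open>- x\<close>
      is removed, right translation of \<phi> by \<open>h\<close> becomes left translation.\<close>
    have cIh: "(\<integral>y. complex_of_real (\<phi> (- x + y + h)) \<partial>\<mu>) = of_real c" for x
    proof -
      have "(\<integral>y. complex_of_real (\<phi> (- x + y + h)) \<partial>\<mu>) = (\<integral>y. complex_of_real (\<phi> (y + h)) \<partial>\<mu>)"
        using integral_translate[OF ccont_translate[OF \<phi>C, of 0 h], of "- x"] by simp
      also have "\<dots> = (\<integral>y. complex_of_real (\<phi> (h + y)) \<partial>\<mu>)" by (simp add: \<phi>(6)[OF h])
      also have "\<dots> = of_real c" using integral_translate[OF \<phi>C, of h] by (simp add: c_def)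
      finally show ?thesis .
    qed
    have i1: "(\<integral>y. D y \<partial>\<mu>) = of_real c * (\<integral>y. g y \<partial>\<mu>) - (\<Sum>x\<in>S. of_real (w x) * g x * of_real c)"
      unfolding D_def
      by (subst Bochner_Integration.integral_diff Bochner_Integration.integral_sum integral_mult_right_zero;
          (intro ccont_integrable ccont_mult_left ccont_sum g tr)?)+
        (simp only: cI)
    have i2: "(\<integral>y. D (y + h) \<partial>\<mu>) = of_real c * (\<integral>y. g (y + h) \<partial>\<mu>) - (\<Sum>x\<in>S. of_real (w x) * g x * of_real c)"
      unfolding D_def add.assoc[symmetric]
      by (subst Bochner_Integration.integral_diff Bochner_Integration.integral_sum integral_mult_right_zero;
          (intro ccont_integrable ccont_mult_left ccont_sum gh tr)?)+
        (simp only: cIh)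
    \<comment> \<open>The sums over \<open>S\<close> are the same for \<open>D\<close> and for its
      right translate, so they cancel and only the two error integrals remain.\<close>
    have "c * cmod ((\<integral>x. g (x + h) \<partial>\<mu>) - (\<integral>x. g x \<partial>\<mu>)) = cmod (of_real c * ((\<integral>x. g (x + h) \<partial>\<mu>) - (\<integral>x. g x \<partial>\<mu>)))"
      using c by (simp add: norm_mult)
    also have "of_real c * ((\<integral>x. g (x + h) \<partial>\<mu>) - (\<integral>x. g x \<partial>\<mu>)) = (\<integral>y. D (y + h) \<partial>\<mu>) - (\<integral>y. D y \<partial>\<mu>)"
      unfolding i1 i2 by (simp add: algebra_simps)
    also have "cmod \<dots> \<le> e * c * (1 + measure \<mu> K) * measure \<mu> C' + e * c * (1 + measure \<mu> K) * measure \<mu> C"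
      by (intro order_trans[OF norm_triangle_ineq4] add_mono b1 b2)
    also have "\<dots> = c * (e * B)" by (simp add: B_def algebra_simps)
    finally show ?thesis using c by simp
  qed
  have "B \<ge> 0" by (simp add: B_def)
  have "cmod ((\<integral>x. g (x + h) \<partial>\<mu>) - (\<integral>x. g x \<partial>\<mu>)) \<le> 0"
  proof (rule field_le_epsilon)
    fix e :: real assume "e > 0"
    then have "cmod ((\<integral>x. g (x + h) \<partial>\<mu>) - (\<integral>x. g x \<partial>\<mu>)) \<le> e / (B + 1) * B"
      using \<open>B \<ge> 0\<close> by (intro bound) simp
    also have "\<dots> \<le> e" using \<open>B \<ge> 0\<close> \<open>e > 0\<close> by (simp add: field_simps)
    finally show "cmod ((\<integral>x. g (x + h) \<partial>\<mu>) - (\<integral>x. g x \<partial>\<mu>)) \<le> 0 + e" by simp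
  qed
  then show ?thesis by simp
qed

end

section \<open>The averaging operator\<close>

locale haar_character = haar_pair \<mu> H \<nu>
  for \<mu> :: "'g::{topological_group_add, t2_space} measure" and H \<nu> +
  fixes \<xi> :: "'g \<Rightarrow> complex" and p :: real
  assumes char: "character_on H \<xi>" and p: "1 \<le> p"
begin

abbreviation T where "T \<equiv> T_fun \<nu> \<xi>"

lemma xi_continuous: "continuous_on H \<xi>" and xi_norm: "h \<in> H \<Longrightarrow> cmod (\<xi> h) = 1"
  and xi_add: "h \<in> H \<Longrightarrow> k \<in> H \<Longrightarrow> \<xi> (h + k) = \<xi> h * \<xi> k"
  using char by (auto simp: character_on_def)

lemma xi_cnj: "h \<in> H \<Longrightarrow> \<xi> h * cnj (\<xi> h) = 1"
  using xi_norm by (simp add: complex_norm_square[symmetric])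

lemma cnj_xi_uminus:
  assumes h: "h \<in> H" shows "cnj (\<xi> (- h)) = \<xi> h"
proof -
  \<comment> \<open>The value at 0 is idempotent and of modulus 1, hence equal to 1.\<close>
  have "\<xi> 0 * \<xi> 0 = \<xi> 0" "\<xi> 0 \<noteq> 0" using xi_add[OF H_zero H_zero] xi_norm[OF H_zero] by auto
  then have "\<xi> 0 = 1" by simp
  then have "\<xi> h * \<xi> (- h) = 1" using xi_add[OF h H_uminus[OF h]] by simp
  then have "cnj (\<xi> (- h)) = (\<xi> h * \<xi> (- h)) * cnj (\<xi> (- h))" by simp
  also have "\<dots> = \<xi> h" using xi_cnj[OF H_uminus[OF h]] by (simp add: mult.assoc)
  finally show ?thesis .
qed

lemma T_integrand_continuous:
  assumes "ccont f" shows "continuous_on H (\<lambda>s. f (x + s) * cnj (\<xi> s))"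
proof -
  have "continuous_on UNIV f" using assms by (simp add: ccont_def)
  then have "continuous_on H (\<lambda>s. f (x + s))"
    by (rule continuous_on_compose2) (auto intro!: continuous_intros)
  then show ?thesis by (intro continuous_on_mult continuous_on_cnj xi_continuous)
qed

lemma T_support:
  assumes "\<And>x. f x \<noteq> 0 \<Longrightarrow> x \<in> K" "T f x \<noteq> 0"
  shows "x \<in> sumset K H"
proof -
  have "\<exists>s\<in>H. f (x + s) \<noteq> 0"
  proof (rule ccontr)
    assume "\<not> ?thesis"
    then have "T f x = (\<integral>s. 0 \<partial>\<nu>)"
      unfolding T_fun_def by (intro Bochner_Integration.integral_cong) (auto simp: space_nu)
    then show False using assms(2) by simp
  qed
  then obtain s where s: "s \<in> H" "f (x + s) \<noteq> 0" by blast
  have "(x + s) + - s \<in> sumset K H" using s assms(1) H_uminus by (intro mem_sumset) auto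
  moreover have "(x + s) + - s = x" by (simp add: add.assoc)
  ultimately show ?thesis by simp
qed

lemma T_ccont:
  assumes f: "ccont f" shows "ccont (T f)"
proof -
  obtain K where K: "compact K" "\<And>x. f x \<noteq> 0 \<Longrightarrow> x \<in> K" and c: "continuous_on UNIV f"
    using f by (auto simp: ccont_def)
  have "continuous_on (UNIV \<times> H) (\<lambda>z. f (fst z + snd z) * cnj (\<xi> (snd z)))"
    by (intro continuous_intros continuous_on_compose2[OF c] continuous_on_compose2[OF xi_continuous]) auto
  from continuous_on_integral_nu[OF this] have "continuous_on UNIV (T f)" by (simp add: T_fun_def)
  then show ?thesis
    unfolding ccont_def using T_support[of f K] K compact_sumset[OF K(1) compact_H] by blast
qed

lemma T_covariant:
  assumes f: "ccont f" and h: "h \<in> H" shows "T f (x + h) = \<xi> h * T f x"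
proof -
  have c: "continuous_on H (\<lambda>s. f (x + s) * cnj (\<xi> (- h + s)))"
  proof -
    have "continuous_on H (\<lambda>s. f (x + s))"
      by (rule continuous_on_compose2[of UNIV f]) (use f in \<open>auto intro!: continuous_intros simp: ccont_def\<close>)
    moreover have "continuous_on H (\<lambda>s. \<xi> (- h + s))"
      by (rule continuous_on_compose2[OF xi_continuous])
        (use H_add[OF H_uminus[OF h]] in \<open>auto intro!: continuous_intros\<close>)
    ultimately show ?thesis by (intro continuous_on_mult continuous_on_cnj)
  qed
  \<comment> \<open>Writing \<open>s\<close> as \<open>- h + (h + s)\<close> inside the character
    exhibits the integrand as a left translate by \<open>h\<close>, so left invariance of \<nu>
    suffices.\<close>
  have "T f (x + h) = (\<integral>s. f (x + (h + s)) * cnj (\<xi> (- h + (h + s))) \<partial>\<nu>)"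
    by (simp only: T_fun_def add.assoc minus_add_cancel)
  also have "\<dots> = (\<integral>s. f (x + s) * cnj (\<xi> (- h + s)) \<partial>\<nu>)" by (rule integral_nu_translate[OF h c])
  also have "\<dots> = (\<integral>s. \<xi> h * (f (x + s) * cnj (\<xi> s)) \<partial>\<nu>)"
    using xi_add[OF H_uminus[OF h]] cnj_xi_uminus[OF h]
    by (intro Bochner_Integration.integral_cong) (auto simp: space_nu)
  also have "\<dots> = \<xi> h * T f x" by (simp add: T_fun_def)
  finally show ?thesis .
qed

lemma T_add: "ccont f \<Longrightarrow> ccont g \<Longrightarrow> T (\<lambda>x. f x + g x) = (\<lambda>x. T f x + T g x)"
  using integrable_nu[OF T_integrand_continuous] by (auto simp: T_fun_def distrib_right)

lemma T_scalar: "T (\<lambda>x. c * f x) = (\<lambda>x. c * T f x)"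
  by (simp add: T_fun_def mult.assoc)

section \<open>The coset space and supports of covariant functions\<close>

lemma topspace_coset: "topspace (coset_topology H) = range (left_coset H)"
proof
  show "topspace (coset_topology H) \<subseteq> range (left_coset H)"
    using openin_topspace openin_coset_topology by blast
  have "left_coset H -` range (left_coset H) = UNIV" by auto
  then have "openin (coset_topology H) (range (left_coset H))" by (simp add: openin_coset_topology)
  then show "range (left_coset H) \<subseteq> topspace (coset_topology H)" by (rule openin_subset)
qed

lemma left_coset_eq_iff: "left_coset H x = left_coset H y \<longleftrightarrow> - y + x \<in> H"
proof
  assume "left_coset H x = left_coset H y"
  moreover have "x \<in> left_coset H x" using H_zero by (auto simp: left_coset_def intro!: image_eqI[of _ _ 0])
  ultimately obtain h where "h \<in> H" "x = y + h" by (auto simp: left_coset_def)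
  then show "- y + x \<in> H" by (simp flip: add.assoc)
next
  have sub: "left_coset H x \<subseteq> left_coset H y" if "- y + x \<in> H" for x y
  proof
    fix z assume "z \<in> left_coset H x"
    then obtain h where h: "h \<in> H" "z = x + h" by (auto simp: left_coset_def)
    then have "z = y + ((- y + x) + h)" by (simp flip: add.assoc)
    then show "z \<in> left_coset H y" using H_add[OF that h(1)] unfolding left_coset_def by blast
  qed
  assume yx: "- y + x \<in> H"
  moreover have "- x + y \<in> H" using H_uminus[OF yx] by (simp only: minus_add minus_minus)
  ultimately show "left_coset H x = left_coset H y" using sub by blast
qed

lemma continuous_map_left_coset: "continuous_map euclidean (coset_topology H) (left_coset H)"
  by (auto simp: continuous_map topspace_coset openin_coset_topology vimage_def)

lemma openin_left_coset_image:
  assumes "open U" shows "openin (coset_topology H) (left_coset H ` U)"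
proof -
  \<comment> \<open>The saturation of \<open>U\<close> is a union of right translates of
    \<open>U\<close> by elements of \<open>H\<close>, hence open; so the canonical map is
    open.\<close>
  have "left_coset H -` (left_coset H ` U) = (\<Union>h\<in>H. {y. y + h \<in> U})"
  proof (intro Set.set_eqI iffI)
    fix y assume "y \<in> left_coset H -` (left_coset H ` U)"
    then obtain u where u: "u \<in> U" "- y + u \<in> H"
      by (metis imageE left_coset_eq_iff vimageE)
    moreover have "y + (- y + u) = u" by (simp flip: add.assoc)
    ultimately show "y \<in> (\<Union>h\<in>H. {y. y + h \<in> U})" by (intro UN_I[of "- y + u"]) auto
  next
    fix y assume "y \<in> (\<Union>h\<in>H. {y. y + h \<in> U})"
    then obtain h where h: "h \<in> H" "y + h \<in> U" by blast
    have "- y + (y + h) = h" by (simp flip: add.assoc)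
    then have "left_coset H (y + h) = left_coset H y" using h by (simp only: left_coset_eq_iff)
    then show "y \<in> left_coset H -` (left_coset H ` U)" using h(2) by (metis imageI vimageI)
  qed
  then show ?thesis using open_translate(2)[OF assms] by (auto simp: openin_coset_topology)
qed

text \<open>Images of relatively compact open sets cover the compact image of the support. Finitely
  many suffice, and lifting them back costs only the addition of \<open>H\<close>, which keeps the
  sets \<open>sumset (K a) H\<close> compact.\<close>

lemma M_cov_ccont:
  assumes "\<psi> \<in> M_cov H \<xi>" shows "ccont \<psi>"
proof -
  have c: "continuous_on UNIV \<psi>" and comp: "compactin (coset_topology H) (left_coset H ` supp \<psi>)"
    using assms by (auto simp: M_cov_def Cc_rel_def)
  have "\<forall>x::'g. \<exists>U K. open U \<and> compact K \<and> x \<in> U \<and> U \<subseteq> K" using locally_compactE[OF lc] by metis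
  then obtain U K where UK: "\<And>x::'g. open (U x)" "\<And>x. compact (K x)" "\<And>x. x \<in> U x" "\<And>x. U x \<subseteq> K x"
    by metis
  let ?\<U> = "range (\<lambda>x. left_coset H ` U x)"
  have "\<forall>V\<in>?\<U>. openin (coset_topology H) V" using openin_left_coset_image UK(1) by auto
  moreover have "left_coset H ` supp \<psi> \<subseteq> \<Union> ?\<U>" using UK(3) by blast
  ultimately obtain \<F> where "finite \<F>" "\<F> \<subseteq> ?\<U>" "left_coset H ` supp \<psi> \<subseteq> \<Union> \<F>"
    using comp unfolding compactin_def by meson
  then obtain A where A: "finite A" "left_coset H ` supp \<psi> \<subseteq> (\<Union>x\<in>A. left_coset H ` U x)"
    by (metis finite_subset_image)
  have "compact (\<Union>x\<in>A. sumset (K x) H)"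
    using A(1) UK(2) compact_H by (intro compact_UN compact_sumset) auto
  moreover have "x \<in> (\<Union>x\<in>A. sumset (K x) H)" if "\<psi> x \<noteq> 0" for x
  proof -
    have "x \<in> supp \<psi>" using that closure_subset[of "{x. \<psi> x \<noteq> 0}"] by (auto simp: supp_def)
    then obtain a u where au: "a \<in> A" "u \<in> U a" "left_coset H x = left_coset H u" using A(2) by blast
    then have "u + (- u + x) \<in> sumset (K a) H"
      using UK(4) left_coset_eq_iff by (intro mem_sumset) auto
    moreover have "u + (- u + x) = x" by (simp flip: add.assoc)
    ultimately show ?thesis using au by auto
  qed
  ultimately show ?thesis using c unfolding ccont_def by blast
qed

lemma T_in_M_cov:
  assumes "ccont f" shows "T f \<in> M_cov H \<xi>"
proof -
  have Tf: "T f \<in> Cc" using T_ccont[OF assms] by (simp add: Cc_iff_ccont)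
  then have "compactin (coset_topology H) (left_coset H ` supp (T f))"
    by (intro image_compactin[OF _ continuous_map_left_coset]) (simp add: Cc_def)
  then show ?thesis using Tf T_covariant[OF assms] by (simp add: M_cov_def Cc_rel_def Cc_def)
qed

lemma T_M_cov:
  assumes "\<psi> \<in> M_cov H \<xi>" shows "T \<psi> = \<psi>"
proof
  fix x
  have "T \<psi> x = (\<integral>s. \<psi> x \<partial>\<nu>)"
    unfolding T_fun_def
  proof (intro Bochner_Integration.integral_cong refl)
    fix s assume "s \<in> space \<nu>"
    then have "s \<in> H" by (simp add: space_nu)
    then have "\<psi> (x + s) * cnj (\<xi> s) = \<psi> x * (\<xi> s * cnj (\<xi> s))" using assms by (simp add: M_cov_def)
    then show "\<psi> (x + s) * cnj (\<xi> s) = \<psi> x" using xi_cnj[OF \<open>s \<in> H\<close>] by simp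
  qed
  then show "T \<psi> x = \<psi> x" by (simp add: \<nu>.prob_space)
qed

section \<open>Contractivity of the averaging operator\<close>

lemma nrm_right_translate:
  assumes f: "ccont f" and h: "h \<in> H"
  shows "nrm (Lp_functions \<mu> p) (\<lambda>x. f (x + h)) = nrm (Lp_functions \<mu> p) f"
proof -
  \<comment> \<open>Invariance of the integral is applied to the p-th power of the modulus, embedded
    in the complex numbers; \<open>p > 0\<close> makes the power continuous at zeros of
    \<open>f\<close>.\<close>
  have "ccont (\<lambda>x. complex_of_real (cmod (f x) powr p))"
    unfolding ccont_def
  proof
    show "continuous_on UNIV (\<lambda>x. complex_of_real (cmod (f x) powr p))"
      using f p by (intro continuous_intros continuous_on_powr') (auto simp: ccont_def)
    obtain K where "compact K" "\<And>x. f x \<noteq> 0 \<Longrightarrow> x \<in> K" using f by (auto simp: ccont_def)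
    then show "\<exists>K. compact K \<and> (\<forall>x. complex_of_real (cmod (f x) powr p) \<noteq> 0 \<longrightarrow> x \<in> K)" by auto
  qed
  from integral_right_translate[OF this h] show ?thesis by (simp add: Lp_nrm[OF p])
qed

lemma T_contraction:
  assumes f: "ccont f"
  shows "nrm (Lp_functions \<mu> p) (T f) \<le> nrm (Lp_functions \<mu> p) f"
proof -
  let ?n = "nrm (Lp_functions \<mu> p)"
  obtain K where K: "compact K" "\<And>x. f x \<noteq> 0 \<Longrightarrow> x \<in> K" using f by (auto simp: ccont_def)
  obtain B where B: "0 \<le> B" "\<And>x. cmod (f x) \<le> B" using ccont_bounded[OF f] by blast
  \<comment> \<open>All averages over \<open>H\<close>, exact or discretised, vanish outside
    \<open>C\<close>, so a uniform error \<open>e\<close> becomes an \<open>L\<^sup>p\<close> error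
    of at most \<open>e * measure \<mu> C powr (1 / p)\<close>.\<close>
  define C where "C = sumset K H"
  have C: "compact C" unfolding C_def by (rule compact_sumset[OF K(1) compact_H])
  define F where "F x s = f (x + s) * cnj (\<xi> s)" for x s
  have bound: "?n (T f) \<le> ?n f + e * measure \<mu> C powr (1 / p)" if e: "e > 0" for e
  proof -
    \<comment> \<open>Replacing the node costs \<open>e1\<close> through \<open>f\<close> and at
      most \<open>B * e1\<close> through the character; \<open>e1\<close> is chosen so that these
      add up to \<open>e\<close>.\<close>
    define e1 where "e1 = e / (B + 1)"
    have "(B + 1) * e1 = e" using B(1) by (simp add: e1_def)
    then have "e1 + B * e1 = e" by (simp add: distrib_right)
    moreover have "e1 > 0" using e B(1) by (simp add: e1_def)
    ultimately have e1: "e1 > 0" "e1 + B * e1 = e" by auto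
    obtain U where U: "open U" "0 \<in> U" "\<And>u x. u \<in> U \<Longrightarrow> cmod (f (x + u) - f x) \<le> e1"
      using ccont_uniform_right[OF f e1(1)] by metis
    have near: "\<exists>V. open V \<and> a \<in> V \<and> (\<forall>s\<in>V \<inter> H. \<forall>x. cmod (F x s - F x a) \<le> e)" if a: "a \<in> H" for a
    proof -
      have "\<forall>\<^sub>F s in at a within H. dist (\<xi> s) (\<xi> a) < e1"
        using xi_continuous a e1(1) by (simp add: continuous_on_def tendsto_iff)
      then obtain Y where Y: "open Y" "a \<in> Y" "\<And>s. s \<in> Y \<Longrightarrow> s \<in> H \<Longrightarrow> cmod (\<xi> s - \<xi> a) \<le> e1"
        unfolding eventually_at_topological using e1(1) by (auto simp: dist_norm) (metis diff_self less_imp_le norm_zero)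
      show ?thesis
      proof (intro exI conjI ballI allI)
        show "open ({s. - a + s \<in> U} \<inter> Y)" by (intro open_Int open_translate U Y)
        show "a \<in> {s. - a + s \<in> U} \<inter> Y" using U Y by simp
        fix s x assume s: "s \<in> ({s. - a + s \<in> U} \<inter> Y) \<inter> H"
        have "x + s = (x + a) + (- a + s)" by (simp add: add.assoc)
        then have 1: "cmod (f (x + s) - f (x + a)) \<le> e1" using U(3)[of "- a + s" "x + a"] s by auto
        have 2: "cmod (cnj (\<xi> s) - cnj (\<xi> a)) \<le> e1"
          using Y(3)[of s] s by (simp flip: complex_cnj_diff)
        have "F x s - F x a = (f (x + s) - f (x + a)) * cnj (\<xi> s) + f (x + a) * (cnj (\<xi> s) - cnj (\<xi> a))"
          by (simp add: F_def algebra_simps)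
        also have "cmod \<dots> \<le> e1 * 1 + B * e1"
          using 1 2 s B e1 xi_norm[of s]
          by (intro order_trans[OF norm_triangle_ineq] add_mono) (auto simp only: norm_mult complex_mod_cnj norm_ge_zero intro!: mult_mono)
        finally show "cmod (F x s - F x a) \<le> e" using e1(2) by simp
      qed
    qed
    have int: "integrable \<nu> (F x)" for x unfolding F_def by (rule integrable_nu[OF T_integrand_continuous[OF f]])
    have Hs: "H \<in> sets \<nu>" using sets.top[of \<nu>] by (simp add: space_nu)
    have mH: "measure \<nu> H = 1" using \<nu>.prob_space by (simp add: space_nu)
    obtain S w where S: "finite S" "S \<subseteq> H" "\<And>s. 0 \<le> w s" "sum w S = measure \<nu> H"
      "\<And>x. cmod ((LINT s:H|\<nu>. F x s) - (\<Sum>s\<in>S. of_real (w s) * F x s)) \<le> e * measure \<nu> H"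
    proof (rule riemann_sum[OF compact_H Hs, of F e])
      show "emeasure \<nu> H < \<infinity>" by (simp add: less_top[symmetric])
      show "U \<inter> H \<in> sets \<nu>" if "open U" for U using that by (auto simp: sets_nu sets_restrict_space)
      show "set_integrable \<nu> H (F x)" for x
        unfolding set_integrable_def by (rule integrable_mult_indicator[OF Hs int])
    qed (use near in blast)+
    have TF: "(LINT s:H|\<nu>. F x s) = T f x" for x
      using set_integral_space[OF int] by (simp add: T_fun_def F_def space_nu)
    \<comment> \<open>The weights of \<open>R\<close> sum to 1 and the character has modulus 1, so
      the triangle inequality bounds the norm of \<open>R\<close> by that of \<open>f\<close>, with
      no constant.\<close>
    define R where "R x = (\<Sum>s\<in>S. (of_real (w s) * cnj (\<xi> s)) * f (x + s))" for x
    have tr: "ccont (\<lambda>x. f (x + s))" for s using ccont_translate[OF f, of 0 s] by simp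
    have R: "ccont R" unfolding R_def by (intro ccont_sum ccont_mult_left tr)
    have "?n R \<le> (\<Sum>s\<in>S. ?n (\<lambda>x. (of_real (w s) * cnj (\<xi> s)) * f (x + s)))"
      unfolding R_def by (intro Lp_sum[OF p S(1)] Lp_ccont[OF p] ccont_mult_left tr)
    also have "\<dots> = (\<Sum>s\<in>S. w s * ?n f)"
    proof (rule sum.cong)
      fix s assume s: "s \<in> S"
      show "?n (\<lambda>x. (of_real (w s) * cnj (\<xi> s)) * f (x + s)) = w s * ?n f"
        using s S(2,3) xi_norm[of s] by (auto simp: Lp_scalar(2)[OF p Lp_ccont[OF p tr]] norm_mult nrm_right_translate[OF f])
    qed simp
    also have "\<dots> = ?n f" using S(4) mH by (simp flip: sum_distrib_right)
    finally have nR: "?n R \<le> ?n f" .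
    have Rd: "cmod (T f x - R x) \<le> e" for x
    proof -
      have "R x = (\<Sum>s\<in>S. of_real (w s) * F x s)" by (simp add: R_def F_def mult_ac)
      then show ?thesis using S(5)[of x] by (simp add: TF mH)
    qed
    have D0: "T f x - R x = 0" if "x \<notin> C" for x
    proof -
      have "T f x = 0" using T_support[OF K(2)] that unfolding C_def by blast
      moreover have "f (x + s) = 0" if s: "s \<in> S" for s
      proof (rule ccontr)
        assume "f (x + s) \<noteq> 0"
        then have "(x + s) + - s \<in> C"
          unfolding C_def using K(2) H_uminus S(2) s by (intro mem_sumset) auto
        moreover have "(x + s) + - s = x" by (simp add: add.assoc)
        ultimately show False using \<open>x \<notin> C\<close> by simp
      qed
      ultimately show ?thesis by (simp add: R_def)
    qed
    have Dcc: "ccont (\<lambda>x. T f x - R x)" by (intro ccont_diff T_ccont f R)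
    have "?n (\<lambda>x. (T f x - R x) + R x) \<le> ?n (\<lambda>x. T f x - R x) + ?n R"
      by (intro Lp_minkowski(2)[OF p] Lp_ccont[OF p] Dcc R)
    also have "\<dots> \<le> e * measure \<mu> C powr (1 / p) + ?n f"
      using e by (intro add_mono nR Lp_sup_bound[OF p Dcc C D0 _ Rd]) auto
    finally show ?thesis by simp
  qed
  show ?thesis
  proof (rule field_le_epsilon)
    fix e :: real assume e: "e > 0"
    define m where "m = measure \<mu> C powr (1 / p)"
    have m: "m \<ge> 0" by (simp add: m_def)
    have "?n (T f) \<le> ?n f + e / (m + 1) * m" unfolding m_def by (rule bound) (use e m in \<open>auto simp: m_def add_nonneg_pos\<close>)
    also have "e / (m + 1) * m \<le> e" using e m by (simp add: field_simps)
    finally show "?n (T f) \<le> ?n f + e" by simp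
  qed
qed

end

section \<open>The space \<open>L\<^sup>p\<close> as a Banach space\<close>

lemma Lp_functions_complex_normed:
  assumes p: "1 \<le> p" shows "complex_normed (Lp_functions M p)"
proof -
  have "Module.module (ring_of_type_algebra :: complex ring) (Lp_functions M p)"
    by (rule complex_moduleI)
      (auto simp: Lp_ops[OF p] Lp_minkowski[OF p] Lp_zero[OF p] Lp_scalar[OF p] algebra_simps)
  then interpret complex_module "Lp_functions M p" by (simp add: complex_module_def)
  show ?thesis
    by unfold_locales
      (auto simp: Lp_ops[OF p] Lp_nrm_nonneg[OF p] Lp_scalar[OF p] Lp_minkowski[OF p])
qed

lemma Lp_null_eq: "1 \<le> p \<Longrightarrow> Lp_null M p = {f \<in> carrier (Lp_functions M p). nrm (Lp_functions M p) f = 0}"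
  using Lp_nrm_eq_0_iff by (auto simp: Lp_null_def)

lemma Lp_functions_diff:
  assumes p: "1 \<le> p" and "f \<in> carrier (Lp_functions M p)" "g \<in> carrier (Lp_functions M p)"
  shows "f \<ominus>\<^bsub>Lp_functions M p\<^esub> g = (\<lambda>x. f x - g x)"
proof -
  interpret complex_normed "Lp_functions M p" by (rule Lp_functions_complex_normed[OF p])
  show ?thesis using assms by (simp add: diff_eq_scalar Lp_ops[OF p])
qed

lemma Lp_space_facts:
  assumes p: "1 \<le> p"
  shows "quotient_module (Lp_functions M p) (Lp_null M p)" "banach_space (Lp_space M p)"
    "\<And>f. f \<in> carrier (Lp_functions M p) \<Longrightarrow> nrm (Lp_space M p) (Lp_class M p f) = nrm (Lp_functions M p) f"
proof -
  interpret complex_normed "Lp_functions M p" by (rule Lp_functions_complex_normed[OF p])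
  note sq = seminorm_quotient[OF complex_normed_axioms Lp_null_eq[OF p]]
  have "complete_nrm"
    unfolding complete_nrm_def
  proof safe
    fix s :: "nat \<Rightarrow> 'a \<Rightarrow> complex"
    assume s: "\<forall>n. s n \<in> carrier (Lp_functions M p)"
      and c: "\<forall>e>0. \<exists>N. \<forall>m\<ge>N. \<forall>n\<ge>N. nrm (Lp_functions M p) (s m \<ominus>\<^bsub>Lp_functions M p\<^esub> s n) < e"
    have "\<exists>l\<in>carrier (Lp_functions M p). (\<lambda>n. nrm (Lp_functions M p) (\<lambda>x. s n x - l x)) \<longlonglongrightarrow> 0"
      by (rule Lp_complete[OF p]) (use s c in \<open>simp_all add: Lp_functions_diff[OF p]\<close>)
    then obtain l where "l \<in> carrier (Lp_functions M p)"
      "(\<lambda>n. nrm (Lp_functions M p) (\<lambda>x. s n x - l x)) \<longlonglongrightarrow> 0" by blast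
    then show "\<exists>l\<in>carrier (Lp_functions M p). (\<lambda>n. nrm (Lp_functions M p) (s n \<ominus>\<^bsub>Lp_functions M p\<^esub> l)) \<longlonglongrightarrow> 0"
      using s by (intro bexI[of _ l]) (simp_all add: Lp_functions_diff[OF p])
  qed
  then show "banach_space (Lp_space M p)" using sq(4) by (simp add: Lp_space_def)
  show "quotient_module (Lp_functions M p) (Lp_null M p)"
    using sq(1) by unfold_locales
  show "nrm (Lp_space M p) (Lp_class M p f) = nrm (Lp_functions M p) f"
    if "f \<in> carrier (Lp_functions M p)" for f
    using sq(2)[OF that] by (simp add: Lp_space_def Lp_class_def)
qed

lemma Lp_class_ops:
  assumes p: "1 \<le> p" and f: "f \<in> carrier (Lp_functions M p)"
  shows "Lp_class M p f \<in> carrier (Lp_space M p)"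
    "c \<odot>\<^bsub>Lp_space M p\<^esub> Lp_class M p f = Lp_class M p (\<lambda>x. c * f x)"
    "g \<in> carrier (Lp_functions M p) \<Longrightarrow>
      Lp_class M p f \<oplus>\<^bsub>Lp_space M p\<^esub> Lp_class M p g = Lp_class M p (\<lambda>x. f x + g x)"
    "g \<in> carrier (Lp_functions M p) \<Longrightarrow>
      Lp_class M p f \<ominus>\<^bsub>Lp_space M p\<^esub> Lp_class M p g = Lp_class M p (\<lambda>x. f x - g x)"
proof -
  interpret quotient_module "Lp_functions M p" "Lp_null M p" by (rule Lp_space_facts[OF p])
  show "Lp_class M p f \<in> carrier (Lp_space M p)"
    "c \<odot>\<^bsub>Lp_space M p\<^esub> Lp_class M p f = Lp_class M p (\<lambda>x. c * f x)"
    using f by (simp_all add: Lp_space_def Lp_class_def scalar_quotient Lp_ops[OF p])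
  assume g: "g \<in> carrier (Lp_functions M p)"
  show "Lp_class M p f \<oplus>\<^bsub>Lp_space M p\<^esub> Lp_class M p g = Lp_class M p (\<lambda>x. f x + g x)"
    using f g by (simp add: Lp_space_def Lp_class_def add_quotient Lp_ops[OF p])
  show "Lp_class M p f \<ominus>\<^bsub>Lp_space M p\<^esub> Lp_class M p g = Lp_class M p (\<lambda>x. f x - g x)"
    using f g by (simp add: Lp_space_def Lp_class_def diff_quotient Lp_functions_diff[OF p])
qed

lemma Lp_space_zero: "1 \<le> p \<Longrightarrow> \<zero>\<^bsub>Lp_space M p\<^esub> = Lp_class M p (\<lambda>x. 0)"
proof -
  assume p: "1 \<le> p"
  interpret quotient_module "Lp_functions M p" "Lp_null M p" by (rule Lp_space_facts[OF p])
  show ?thesis by (simp add: Lp_space_def Lp_class_def zero_quotient Lp_ops[OF p])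
qed

lemma Lp_spaceE:
  assumes p: "1 \<le> p" and A: "A \<in> carrier (Lp_space M p)"
  obtains f where "f \<in> carrier (Lp_functions M p)" "A = Lp_class M p f"
proof -
  interpret quotient_module "Lp_functions M p" "Lp_null M p" by (rule Lp_space_facts[OF p])
  show thesis using A that by (auto simp: Lp_space_def Lp_class_def elim: quotientE)
qed

section \<open>The bounded extension of the averaging operator to \<open>L\<^sup>p\<close>\<close>

context haar_character
begin

text \<open>Existence of the described operator comes from \<open>contraction_extension\<close>,
  uniqueness from density of \<open>Cc\<close>. Only then do its properties transfer to
  \<open>T_ext\<close>.\<close>

lemma T_ext_properties:
  defines "V \<equiv> Lp_space \<mu> p" and "W \<equiv> Lp_cov \<mu> p H \<xi>" and "P \<equiv> T_ext \<mu> p H \<nu> \<xi>"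
  shows "subspace_of V (carrier W)" "banach_space W" "linear_map V W P"
    "\<And>x. x \<in> carrier V \<Longrightarrow> nrm V (P x) \<le> nrm V x" "\<And>x. x \<in> carrier W \<Longrightarrow> P x = x"
proof -
  let ?L = "Lp_functions \<mu> p"
  let ?cl = "Lp_class \<mu> p"
  let ?S = "?cl ` M_cov H \<xi>"
  have V: "banach_space V" unfolding V_def by (rule Lp_space_facts[OF p])
  interpret V: complex_normed V by (intro normed_space_imp_complex_normed banach_imp_normed V)
  have L: "f \<in> carrier ?L" if "ccont f" for f using Lp_ccont[OF p that] .
  note ops = Lp_class_ops[OF p L, folded V_def]
  have nrm_cl: "nrm V (?cl f) = nrm ?L f" if "ccont f" for f
    unfolding V_def using Lp_space_facts(3)[OF p L[OF that]] .
  have zero_M: "(\<lambda>x. 0) \<in> M_cov H \<xi>"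
    using T_in_M_cov[OF ccont_zero] by (simp add: T_fun_def)
  \<comment> \<open>Covariant functions are fixed by \<open>T\<close>, so their sum is a value of
    \<open>T\<close> and hence covariant again; no argument about supports in the coset space is
    required.\<close>
  have M_add: "(\<lambda>x. f x + g x) \<in> M_cov H \<xi>" if "f \<in> M_cov H \<xi>" "g \<in> M_cov H \<xi>" for f g
    using T_in_M_cov[OF ccont_add[OF that[THEN M_cov_ccont]]] T_add[OF that[THEN M_cov_ccont]]
      that[THEN T_M_cov] by simp
  have M_scalar: "(\<lambda>x. c * f x) \<in> M_cov H \<xi>" if "f \<in> M_cov H \<xi>" for c f
    using T_in_M_cov[OF ccont_mult_left[OF M_cov_ccont[OF that]], of c] T_M_cov[OF that] by (simp add: T_scalar)
  have sub: "subspace_of V ?S"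
    unfolding subspace_of_def
    using M_cov_ccont M_add M_scalar zero_M ops Lp_space_zero[OF p, of \<mu>, folded V_def] L
    by (auto intro!: imageI)
  have W_eq: "W = V\<lparr>carrier := norm_closure V ?S\<rparr>" by (simp add: W_def V_def Lp_cov_def)
  note nc = norm_closure_banach[OF V sub, folded W_eq]
  have cW: "carrier W = norm_closure V ?S" by (simp add: W_eq)
  have WV: "\<And>x. nrm W x = nrm V x" "\<And>x y. x \<oplus>\<^bsub>W\<^esub> y = x \<oplus>\<^bsub>V\<^esub> y" "\<And>c x. c \<odot>\<^bsub>W\<^esub> x = c \<odot>\<^bsub>V\<^esub> x"
    by (simp_all add: W_eq)
  show subW: "subspace_of V (carrier W)" unfolding cW by (rule nc)
  show W: "banach_space W" by (rule nc)
  interpret W: complex_normed W by (intro normed_space_imp_complex_normed banach_imp_normed W)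
  have SW: "?S \<subseteq> carrier W" unfolding cW by (rule nc)
  \<comment> \<open>The graph consists of pairs of classes because \<open>T\<close> acts on
    functions; that the class of \<open>T f\<close> depends only on the class of \<open>f\<close> is
    a consequence of contractivity.\<close>
  define \<Gamma> where "\<Gamma> = (\<lambda>f. (?cl f, ?cl (T f))) ` {f. ccont f}"
  have dense: "\<exists>(v, w)\<in>\<Gamma>. nrm V (x \<ominus>\<^bsub>V\<^esub> v) < e" if x: "x \<in> carrier V" and e: "e > 0" for x e
  proof -
    obtain f where f: "f \<in> carrier ?L" "x = ?cl f" using Lp_spaceE[OF p x[unfolded V_def]] by blast
    obtain g where g: "ccont g" "nrm ?L (\<lambda>x. f x - g x) < e"
      using Cc_dense[OF p f(1) e] Cc_iff_ccont by blast
    have "nrm V (x \<ominus>\<^bsub>V\<^esub> ?cl g) = nrm ?L (\<lambda>x. f x - g x)"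
      unfolding V_def f(2) Lp_class_ops(4)[OF p f(1) L[OF g(1)]]
      by (rule Lp_space_facts(3)[OF p Lp_diff[OF p f(1) L[OF g(1)]]])
    then show ?thesis using g unfolding \<Gamma>_def by auto
  qed
  obtain Q where Q: "Q \<in> extensional (carrier V)" "linear_map V W Q"
    "\<And>x. x \<in> carrier V \<Longrightarrow> nrm W (Q x) \<le> nrm V x" "\<And>v w. (v, w) \<in> \<Gamma> \<Longrightarrow> Q v = w"
  proof (rule contraction_extension[OF banach_imp_normed[OF V] W, of \<Gamma>])
    show "\<Gamma> \<subseteq> carrier V \<times> carrier W"
      using ops(1) SW T_in_M_cov unfolding \<Gamma>_def by blast
    fix v w assume vw: "(v, w) \<in> \<Gamma>"
    then obtain f where f: "ccont f" "v = ?cl f" "w = ?cl (T f)" unfolding \<Gamma>_def by blast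
    show "nrm W w \<le> nrm V v" using f T_contraction[OF f(1)] by (simp add: WV nrm_cl T_ccont)
    show "(c \<odot>\<^bsub>V\<^esub> v, c \<odot>\<^bsub>W\<^esub> w) \<in> \<Gamma>" for c
      unfolding \<Gamma>_def using f ccont_mult_left[OF f(1), of c]
      by (auto simp: WV ops T_ccont T_scalar intro!: image_eqI[of _ _ "\<lambda>x. c * f x"])
    fix v' w' assume "(v', w') \<in> \<Gamma>"
    then obtain g where g: "ccont g" "v' = ?cl g" "w' = ?cl (T g)" unfolding \<Gamma>_def by blast
    show "(v \<oplus>\<^bsub>V\<^esub> v', w \<oplus>\<^bsub>W\<^esub> w') \<in> \<Gamma>"
      unfolding \<Gamma>_def using f g ccont_add[OF f(1) g(1)]
      by (auto simp: WV ops T_ccont T_add L intro!: image_eqI[of _ _ "\<lambda>x. f x + g x"])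
  qed (use dense in blast)+
  have bQ: "bounded_linear_map V W Q" unfolding bounded_linear_map_def using Q(2,3) by (intro conjI exI[of _ 1]) auto
  have QT: "Q (?cl f) = ?cl (T f)" if "f \<in> Cc" for f
    using that by (intro Q(4)) (auto simp: \<Gamma>_def Cc_iff_ccont)
  have PQ: "P = Q"
    unfolding P_def T_ext_def V_def[symmetric] W_def[symmetric]
  proof (rule the_equality)
    show "Q \<in> extensional (carrier V) \<and> bounded_linear_map V W Q \<and> (\<forall>f\<in>Cc. Q (?cl f) = ?cl (T f))"
      using Q(1) bQ QT by blast
    fix R assume R: "R \<in> extensional (carrier V) \<and> bounded_linear_map V W R \<and> (\<forall>f\<in>Cc. R (?cl f) = ?cl (T f))"
    show "R = Q"
    proof (rule extensionalityI[of _ "carrier V"])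
      fix x assume x: "x \<in> carrier V"
      show "R x = Q x"
      proof (rule bounded_linear_map_eq_on_dense[OF banach_imp_normed[OF V] banach_imp_normed[OF W] _ bQ _ _ _ x, where D = "?cl ` Cc"])
        show "?cl ` Cc \<subseteq> carrier V" using ops(1) by (auto simp: Cc_iff_ccont)
        show "\<exists>d\<in>?cl ` Cc. nrm V (x \<ominus>\<^bsub>V\<^esub> d) < e" if "x \<in> carrier V" "e > 0" for x e
          using dense[OF that] by (auto simp: \<Gamma>_def Cc_iff_ccont)
      qed (use R QT in auto)
    qed (use R Q in auto)
  qed
  show "linear_map V W P" unfolding PQ by (rule Q)
  show "nrm V (P x) \<le> nrm V x" if "x \<in> carrier V" for x using Q(3)[OF that] by (simp add: PQ WV)
  show "P x = x" if x: "x \<in> carrier W" for x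
  proof -
    have CV: "y \<in> carrier V" if "y \<in> carrier W" for y using subW that by (auto simp: subspace_of_def)
    \<comment> \<open>On classes of covariant functions the operator is the identity, and these are
      dense in \<open>W\<close> by construction; both maps are bounded from \<open>W\<close> to
      itself.\<close>
    have "Q x = id x"
    proof (rule bounded_linear_map_eq_on_dense[OF banach_imp_normed[OF W] banach_imp_normed[OF W] _ _ SW _ _ x])
      show "bounded_linear_map W W Q"
        unfolding bounded_linear_map_def linear_map_def
        using Q(2,3) CV by (intro conjI exI[of _ 1]) (auto simp: linear_map_def WV)
      show "bounded_linear_map W W id"
        unfolding bounded_linear_map_def linear_map_def by (intro conjI exI[of _ 1]) auto
      show "\<exists>d\<in>?S. nrm W (y \<ominus>\<^bsub>W\<^esub> d) < e" if y: "y \<in> carrier W" and e: "e > 0" for y e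
      proof -
        obtain d where d: "d \<in> ?S" "nrm V (y \<ominus>\<^bsub>V\<^esub> d) < e"
          using y e unfolding cW norm_closure_def by blast
        have "y \<ominus>\<^bsub>W\<^esub> d = y \<ominus>\<^bsub>V\<^esub> d"
          using V.subspace_diff_eq[OF nc(1), folded W_eq] y d(1) SW unfolding cW by blast
        then show ?thesis using d by (intro bexI[of _ d]) (simp_all add: WV)
      qed
      show "Q d = id d" if "d \<in> ?S" for d
        using that QT M_cov_ccont T_M_cov by (auto simp: Cc_iff_ccont)
    qed
    then show ?thesis by (simp add: PQ)
  qed
qed

end

theorem theorem4p9:
  fixes \<mu>G \<mu>H :: "'g :: {topological_group_add, t2_space} measure"
    and H :: "'g set" and \<xi> :: "'g \<Rightarrow> complex" and p :: real
  assumes "locally_compact_space (euclidean :: 'g topology)"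
    and "is_subgroup H" and "compact H"
    and "left_haar_measure_on UNIV \<mu>G"
    and "left_haar_measure_on H \<mu>H" and "prob_space \<mu>H"
    and "1 \<le> p"
    and "character_on H \<xi>"
  shows "banach_space (Lp_cov \<mu>G p H \<xi>) \<and>
         banach_space (quotient_space (Lp_space \<mu>G p) (N_cov \<mu>G p H \<mu>H \<xi>)) \<and>
         isometrically_isomorphic (Lp_cov \<mu>G p H \<xi>)
           (quotient_space (Lp_space \<mu>G p) (N_cov \<mu>G p H \<mu>H \<xi>))"
proof -
  interpret haar_character \<mu>G H \<mu>H \<xi> p
    by (intro haar_character.intro haar_pair.intro haar_group.intro haar_pair_axioms.intro
        haar_character_axioms.intro assms)
  let ?V = "Lp_space \<mu>G p"
  let ?W = "Lp_cov \<mu>G p H \<xi>"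
  note T = T_ext_properties
  \<comment> \<open>\<open>Lp_cov\<close> differs from \<open>Lp_space\<close> in its carrier alone;
    this identifies it with the record in the projection lemma and makes the zeros of both spaces
    coincide.\<close>
  have W: "?V\<lparr>carrier := carrier ?W\<rparr> = ?W" by (simp add: Lp_cov_def)
  have N: "N_cov \<mu>G p H \<mu>H \<xi> = {x \<in> carrier ?V. T_ext \<mu>G p H \<mu>H \<xi> x = \<zero>\<^bsub>?V\<^esub>}"
    by (simp add: N_cov_def Lp_cov_def)
  note main = contractive_projection_quotient[OF Lp_space_facts(2)[OF assms(7)] T(1), unfolded W, OF T(2-5) N]
  show ?thesis using T(2) main by blast
qed

end
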